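(* Let $n\ge m\ge 0$ be integers. Define the rational functions of $t$ \[ R_{n,m}(t)=(-1)^m\Bigl(t+\frac n2\Bigr)\frac{(t-n)_m}{m!}\,\frac{(t-2n+m)_{2n-m}}{(2n-m)!}\, \frac{(t+n+1)_n}{(t)_{n+1}}\,\frac{(t+n+1)_{2n-m}}{(t)_{2n-m+1}}\,\biggl(\frac{n!}{(t)_{n+1}}\biggr)^2 \] and \[ \tilde R_{n,m}(t)=\frac{n!\,(t-n)_{2n-m}}{(t)_{n+1}\,(t)_{2n-m+1}} \sum_{j=0}^n{\binom nj}^2\binom{2n-m+j}{n}\frac{(t-j)_n}{n!}. \] Then \[ -\frac13\sum_{\nu=n-m+1}^\infty\frac{\mathrm{d} R_{n,m}(t)}{\mathrm{d} t}\bigg|_{t=\nu} =\frac16\sum_{\nu=1}^\infty\frac{\mathrm{d}^2\tilde R_{n,m}(t)}{\mathrm{d} t^2}\bigg|_{t=\nu}. \]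
   Context: For a quantity $x$ and an integer $k\ge0$, $(x)_k=x(x+1)\cdots(x+k-1)$ denotes the Pochhammer symbol (rising factorial), with $(x)_0=1$. Both rational functions have poles only at non-positive integers $t$, so all derivatives are evaluated at points of regularity, and both series converge. *)

theory Defs
  imports "HOL-Analysis.Analysis"
begin

definition R :: "nat \<Rightarrow> nat \<Rightarrow> real \<Rightarrow> real" where
  "R n m t = (-1) ^ m * (t + real n / 2)
     * (pochhammer (t - real n) m / fact m)
     * (pochhammer (t - 2 * real n + real m) (2 * n - m) / fact (2 * n - m))
     * (pochhammer (t + real n + 1) n / pochhammer t (n + 1))
     * (pochhammer (t + real n + 1) (2 * n - m) / pochhammer t (2 * n - m + 1))
     * (fact n / pochhammer t (n + 1)) ^ 2"

definition Rt :: "nat \<Rightarrow> nat \<Rightarrow> real \<Rightarrow> real" where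
  "Rt n m t = fact n * pochhammer (t - real n) (2 * n - m)
     / (pochhammer t (n + 1) * pochhammer t (2 * n - m + 1))
     * (\<Sum>j = 0..n. real (n choose j) ^ 2 * real ((2 * n - m + j) choose n)
          * (pochhammer (t - real j) n / fact n))"

end

theory Submission
  imports Defs "HOL-Computational_Algebra.Polynomial"
begin

text \<open>Put \<open>N = 2 * n - m\<close> and, for real \<open>\<eta> \<ge> n\<close>,
  \<open>q\<^sub>\<eta>(t) = (\<Prod>l=1..n. (t - l) * (t + \<eta> + l)) / (\<Prod>k=0..n. (t + k) * (t + \<eta> - k))\<close>. Both series are compared with the sum of the
  derivatives of \<open>(t + \<eta>/2) * q\<^sub>\<eta>(t)\<^sup>2\<close> at \<open>\<eta> = N\<close>.

  For the series of \<open>R\<close>, creative telescoping shows that both sums satisfy the same three-term recurrence in \<open>N\<close>; the initial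
  cases \<open>N = n\<close> and \<open>N = n + 1\<close> are an identity of functions and a further telescoping.

  For the second series, \<open>Rt\<close> extends to real \<open>\<eta>\<close>. When the poles of \<open>q\<^sub>\<eta>\<close>, in the variable \<open>t * (t + \<eta>)\<close>, are distinct,
  partial fractions \<open>q\<^sub>\<eta> = (\<Sum>k. A\<^sub>k / w\<^sub>k)\<close> turn \<open>Rt\<close> into a bilinear form \<open>\<Sum>k l. A\<^sub>k * A\<^sub>l * v\<^sub>k / (v\<^sub>l * w\<^sub>l)\<close>, where
  \<open>v\<^sub>k(t + 1) / v\<^sub>k(t) = w\<^sub>k(t) / w\<^sub>0(t)\<close>. Its off-diagonal terms are differences in \<open>t\<close>, and so are the off-diagonal products
  \<open>(2 * t + \<eta>) * A\<^sub>k * A\<^sub>l / (w\<^sub>k * w\<^sub>l)\<close> in \<open>(2 * t + \<eta>) * q\<^sub>\<eta>\<^sup>2\<close>; the diagonal terms match because \<open>A\<^sub>k\<^sup>2 / w\<^sub>k\<close> has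
  the derivative \<open>- (2 * t + \<eta>) * A\<^sub>k\<^sup>2 / w\<^sub>k\<^sup>2\<close>. The boundary terms cancel by antisymmetry in \<open>k\<close> and \<open>l\<close>. The integral
  value \<open>\<eta> = N\<close>, where poles collide, is reached by continuity.\<close>

subsection \<open>Rational decay, uniformly in a parameter\<close>

text \<open>For \<open>N > n\<close> the summands cannot be matched function by function:
  \<open>well_poised n N\<close> is built on the reflection \<open>t -> - n - t\<close>,
  \<open>quot_square n N\<close> on \<open>t -> - N - t\<close>, and the latter has a double pole at
  \<open>t = - N\<close> where the former has none. Only the sums agree, up to a constant. The
  partial fraction argument needs a function of the single variable \<open>t * (t + \<eta>)\<close>
  with simple poles there. This dictates the moving centre \<open>- \<eta>/2\<close> and makes
  \<open>quot_square\<close> the natural middle term. Poles k and l with \<open>k \<noteq> l\<close>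
  collide exactly when \<open>k + l = \<eta>\<close>, which integral \<open>\<eta>\<close> in
  general allows; the denominators \<open>node l - node k\<close> then vanish. A shift of
  \<open>\<eta>\<close> slightly to the right of \<open>N\<close> removes every collision. Going
  back requires limits under both infinite sums, and this is why decay is formulated with bounds
  uniform in a parameter and with continuity of two derivatives. All telescoping happens for
  functions, but the sums involve derivatives. Boundary terms are therefore derivatives of the
  antidifferences, and it is enough that these have a double zero, or otherwise a critical point, at
  the first summation point.\<close>

text \<open>The parameter \<open>e\<close> ranges over \<open>I\<close>. The region \<open>t > 1/2\<close> contains every summation point and no pole; the uniform
  bounds on two derivatives are what allows passing to the limit in \<open>e\<close> under a sum.\<close>

definition decay_data ::
    "real set \<Rightarrow> nat \<Rightarrow> (real \<Rightarrow> real \<Rightarrow> real) \<Rightarrow> (real \<Rightarrow> real \<Rightarrow> real) \<Rightarrow> (real \<Rightarrow> real \<Rightarrow> real) \<Rightarrow> bool" where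
  "decay_data I d f f' f'' \<longleftrightarrow>
     (\<forall>e\<in>I. \<forall>t>1/2. (f e has_real_derivative f' e t) (at t) \<and> (f' e has_real_derivative f'' e t) (at t)) \<and>
     (\<forall>t>1/2. continuous_on I (\<lambda>e. f e t) \<and> continuous_on I (\<lambda>e. f' e t) \<and> continuous_on I (\<lambda>e. f'' e t)) \<and>
     (\<exists>C. \<forall>e\<in>I. \<forall>t>1/2. \<bar>f e t\<bar> \<le> C / t ^ d \<and> \<bar>f' e t\<bar> \<le> C / t ^ (d + 1) \<and> \<bar>f'' e t\<bar> \<le> C / t ^ (d + 2))"

definition decay :: "real set \<Rightarrow> nat \<Rightarrow> (real \<Rightarrow> real \<Rightarrow> real) \<Rightarrow> bool" where
  "decay I d f \<longleftrightarrow> (\<exists>f' f''. decay_data I d f f' f'')"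

lemma decay_dataE:
  assumes "decay_data I d f f' f''"
  obtains C where "C \<ge> 0"
    "\<And>e t. e \<in> I \<Longrightarrow> t > 1/2 \<Longrightarrow> \<bar>f e t\<bar> \<le> C / t ^ d"
    "\<And>e t. e \<in> I \<Longrightarrow> t > 1/2 \<Longrightarrow> \<bar>f' e t\<bar> \<le> C / t ^ (d + 1)"
    "\<And>e t. e \<in> I \<Longrightarrow> t > 1/2 \<Longrightarrow> \<bar>f'' e t\<bar> \<le> C / t ^ (d + 2)"
proof -
  obtain C where C: "\<forall>e\<in>I. \<forall>t>1/2. \<bar>f e t\<bar> \<le> C / t ^ d \<and> \<bar>f' e t\<bar> \<le> C / t ^ (d + 1) \<and> \<bar>f'' e t\<bar> \<le> C / t ^ (d + 2)"
    using assms unfolding decay_data_def by blast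
  have le: "C / t ^ k \<le> max C 0 / t ^ k" if "t > 1/2" for t :: real and k
    using that by (intro divide_right_mono) auto
  show thesis
  proof (rule that[of "max C 0"])
    fix e t assume "e \<in> I" "t > (1/2::real)"
    with C le[of t] show "\<bar>f e t\<bar> \<le> max C 0 / t ^ d" "\<bar>f' e t\<bar> \<le> max C 0 / t ^ (d + 1)"
      "\<bar>f'' e t\<bar> \<le> max C 0 / t ^ (d + 2)"
      by (meson order_trans)+
  qed simp
qed

lemma decay_dataI:
  assumes "\<And>e t. e \<in> I \<Longrightarrow> t > 1/2 \<Longrightarrow> (f e has_real_derivative f' e t) (at t)"
    and "\<And>e t. e \<in> I \<Longrightarrow> t > 1/2 \<Longrightarrow> (f' e has_real_derivative f'' e t) (at t)"
    and "\<And>t. t > 1/2 \<Longrightarrow> continuous_on I (\<lambda>e. f e t)"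
    and "\<And>t. t > 1/2 \<Longrightarrow> continuous_on I (\<lambda>e. f' e t)"
    and "\<And>t. t > 1/2 \<Longrightarrow> continuous_on I (\<lambda>e. f'' e t)"
    and "\<And>e t. e \<in> I \<Longrightarrow> t > 1/2 \<Longrightarrow> \<bar>f e t\<bar> \<le> C / t ^ d"
    and "\<And>e t. e \<in> I \<Longrightarrow> t > 1/2 \<Longrightarrow> \<bar>f' e t\<bar> \<le> C / t ^ (d + 1)"
    and "\<And>e t. e \<in> I \<Longrightarrow> t > 1/2 \<Longrightarrow> \<bar>f'' e t\<bar> \<le> C / t ^ (d + 2)"
  shows "decay_data I d f f' f''"
  unfolding decay_data_def using assms by blast

lemma decay_dataD:
  assumes "decay_data I d f f' f''"
  shows "\<And>e t. e \<in> I \<Longrightarrow> t > 1/2 \<Longrightarrow> (f e has_real_derivative f' e t) (at t)"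
    and "\<And>e t. e \<in> I \<Longrightarrow> t > 1/2 \<Longrightarrow> (f' e has_real_derivative f'' e t) (at t)"
    and "\<And>t. t > 1/2 \<Longrightarrow> continuous_on I (\<lambda>e. f e t)"
    and "\<And>t. t > 1/2 \<Longrightarrow> continuous_on I (\<lambda>e. f' e t)"
    and "\<And>t. t > 1/2 \<Longrightarrow> continuous_on I (\<lambda>e. f'' e t)"
  using assms unfolding decay_data_def by blast+

lemma decay_cong:
  assumes "decay I d f" and "\<And>e t. e \<in> I \<Longrightarrow> t > 1/2 \<Longrightarrow> f e t = g e t"
  shows "decay I d g"
proof -
  obtain f' f'' where D: "decay_data I d f f' f''" using assms(1) decay_def by blast
  obtain C where C: "\<And>e t. e \<in> I \<Longrightarrow> t > 1/2 \<Longrightarrow> \<bar>f e t\<bar> \<le> C / t ^ d"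
    "\<And>e t. e \<in> I \<Longrightarrow> t > 1/2 \<Longrightarrow> \<bar>f' e t\<bar> \<le> C / t ^ (d + 1)"
    "\<And>e t. e \<in> I \<Longrightarrow> t > 1/2 \<Longrightarrow> \<bar>f'' e t\<bar> \<le> C / t ^ (d + 2)"
    using D by (metis decay_dataE)
  have "decay_data I d g f' f''"
  proof (rule decay_dataI[where C = C])
    fix e t assume et: "e \<in> I" "t > (1/2::real)"
    show "(g e has_real_derivative f' e t) (at t)"
      by (rule has_field_derivative_transform_within_open
           [OF decay_dataD(1)[OF D et], of "{1/2<..}"]) (use et assms(2) in auto)
  next
    fix t :: real assume "t > 1/2"
    then show "continuous_on I (\<lambda>e. g e t)"
      using decay_dataD(3)[OF D] assms(2) by (metis (mono_tags, lifting) continuous_on_cong)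
  qed (use C assms(2) decay_dataD[OF D] in auto)
  then show ?thesis unfolding decay_def by blast
qed

text \<open>Since \<open>t > 1/2\<close>, each surplus factor \<open>1 / t\<close> is at most
  2.\<close>

lemma decay_weaken:
  assumes "decay I d f" "d' \<le> d"
  shows "decay I d' f"
proof -
  obtain f' f'' where D: "decay_data I d f f' f''" using assms(1) decay_def by blast
  obtain C where C: "C \<ge> 0" "\<And>e t. e \<in> I \<Longrightarrow> t > 1/2 \<Longrightarrow> \<bar>f e t\<bar> \<le> C / t ^ d"
    "\<And>e t. e \<in> I \<Longrightarrow> t > 1/2 \<Longrightarrow> \<bar>f' e t\<bar> \<le> C / t ^ (d + 1)"
    "\<And>e t. e \<in> I \<Longrightarrow> t > 1/2 \<Longrightarrow> \<bar>f'' e t\<bar> \<le> C / t ^ (d + 2)"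
    using D by (metis decay_dataE)
  obtain k where k: "d = d' + k" using assms(2) le_Suc_ex by blast
  have *: "C / t ^ (d + j) \<le> C * 2 ^ k / t ^ (d' + j)" if "t > 1/2" for t :: real and j
  proof -
    have "(1 / t) ^ k \<le> 2 ^ k" using that by (intro power_mono) (auto simp: field_simps)
    then have "C / t ^ (d' + j) * (1 / t) ^ k \<le> C / t ^ (d' + j) * 2 ^ k"
      using C(1) that by (intro mult_left_mono) auto
    then show ?thesis by (simp add: k power_add power_one_over field_simps)
  qed
  have "decay_data I d' f f' f''"
  proof (rule decay_dataI[where C = "C * 2 ^ k"])
    fix e t assume et: "e \<in> I" "t > (1/2::real)"
    show "\<bar>f e t\<bar> \<le> C * 2 ^ k / t ^ d'" using C(2)[OF et] *[OF et(2), of 0] by simp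
    show "\<bar>f' e t\<bar> \<le> C * 2 ^ k / t ^ (d' + 1)" using C(3)[OF et] *[OF et(2), of 1] by simp
    show "\<bar>f'' e t\<bar> \<le> C * 2 ^ k / t ^ (d' + 2)" using C(4)[OF et] *[OF et(2), of 2] by simp
  qed (use decay_dataD[OF D] in auto)
  then show ?thesis unfolding decay_def by blast
qed

lemma decay_add:
  assumes "decay I d f" "decay I d g"
  shows "decay I d (\<lambda>e t. f e t + g e t)"
proof -
  obtain f' f'' g' g'' where D: "decay_data I d f f' f''" "decay_data I d g g' g''"
    using assms decay_def by blast
  obtain C where C: "\<And>e t. e \<in> I \<Longrightarrow> t > 1/2 \<Longrightarrow> \<bar>f e t\<bar> \<le> C / t ^ d"
    "\<And>e t. e \<in> I \<Longrightarrow> t > 1/2 \<Longrightarrow> \<bar>f' e t\<bar> \<le> C / t ^ (d + 1)"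
    "\<And>e t. e \<in> I \<Longrightarrow> t > 1/2 \<Longrightarrow> \<bar>f'' e t\<bar> \<le> C / t ^ (d + 2)"
    using D(1) by (metis decay_dataE)
  obtain B where B: "\<And>e t. e \<in> I \<Longrightarrow> t > 1/2 \<Longrightarrow> \<bar>g e t\<bar> \<le> B / t ^ d"
    "\<And>e t. e \<in> I \<Longrightarrow> t > 1/2 \<Longrightarrow> \<bar>g' e t\<bar> \<le> B / t ^ (d + 1)"
    "\<And>e t. e \<in> I \<Longrightarrow> t > 1/2 \<Longrightarrow> \<bar>g'' e t\<bar> \<le> B / t ^ (d + 2)"
    using D(2) by (metis decay_dataE)
  have "decay_data I d (\<lambda>e t. f e t + g e t) (\<lambda>e t. f' e t + g' e t) (\<lambda>e t. f'' e t + g'' e t)"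
  proof (rule decay_dataI[where C = "C + B"])
    fix e t assume et: "e \<in> I" "t > (1/2::real)"
    show "\<bar>f e t + g e t\<bar> \<le> (C + B) / t ^ d"
      using C(1)[OF et] B(1)[OF et] by (simp add: add_divide_distrib)
    show "\<bar>f' e t + g' e t\<bar> \<le> (C + B) / t ^ (d + 1)"
      using C(2)[OF et] B(2)[OF et] unfolding add_divide_distrib by linarith
    show "\<bar>f'' e t + g'' e t\<bar> \<le> (C + B) / t ^ (d + 2)"
      using C(3)[OF et] B(3)[OF et] unfolding add_divide_distrib by linarith
    show "((\<lambda>t. f e t + g e t) has_real_derivative f' e t + g' e t) (at t)"
      "((\<lambda>t. f' e t + g' e t) has_real_derivative f'' e t + g'' e t) (at t)"
      by (intro DERIV_add decay_dataD[OF D(1)] decay_dataD[OF D(2)] et)+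
  qed (intro continuous_on_add decay_dataD[OF D(1)] decay_dataD[OF D(2)]; assumption)+
  then show ?thesis unfolding decay_def by blast
qed

lemma decay_mult:
  assumes "decay I d f" "decay I c g"
  shows "decay I (d + c) (\<lambda>e t. f e t * g e t)"
proof -
  obtain f' f'' g' g'' where D: "decay_data I d f f' f''" "decay_data I c g g' g''"
    using assms decay_def by blast
  obtain C where C: "C \<ge> 0" "\<And>e t. e \<in> I \<Longrightarrow> t > 1/2 \<Longrightarrow> \<bar>f e t\<bar> \<le> C / t ^ d"
    "\<And>e t. e \<in> I \<Longrightarrow> t > 1/2 \<Longrightarrow> \<bar>f' e t\<bar> \<le> C / t ^ (d + 1)"
    "\<And>e t. e \<in> I \<Longrightarrow> t > 1/2 \<Longrightarrow> \<bar>f'' e t\<bar> \<le> C / t ^ (d + 2)"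
    using D(1) by (metis decay_dataE)
  obtain B where B: "B \<ge> 0" "\<And>e t. e \<in> I \<Longrightarrow> t > 1/2 \<Longrightarrow> \<bar>g e t\<bar> \<le> B / t ^ c"
    "\<And>e t. e \<in> I \<Longrightarrow> t > 1/2 \<Longrightarrow> \<bar>g' e t\<bar> \<le> B / t ^ (c + 1)"
    "\<And>e t. e \<in> I \<Longrightarrow> t > 1/2 \<Longrightarrow> \<bar>g'' e t\<bar> \<le> B / t ^ (c + 2)"
    using D(2) by (metis decay_dataE)
  have prod: "\<bar>x * y\<bar> \<le> C * B / t ^ k"
    if "\<bar>x\<bar> \<le> C / t ^ i" "\<bar>y\<bar> \<le> B / t ^ j" "t > 1/2" "k = i + j" for x y t :: real and i j k
  proof -
    have "\<bar>x\<bar> * \<bar>y\<bar> \<le> (C / t ^ i) * (B / t ^ j)"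
      using that C(1) B(1) by (intro mult_mono) auto
    then show ?thesis using that by (simp add: abs_mult power_add)
  qed
  have CB: "C * B / t ^ k \<le> 4 * (C * B) / t ^ k" "2 * (C * B) / t ^ k \<le> 4 * (C * B) / t ^ k" if "t > 1/2" for t :: real and k
    using C(1) B(1) that by (intro divide_right_mono; simp)+
  have "decay_data I (d + c) (\<lambda>e t. f e t * g e t) (\<lambda>e t. f' e t * g e t + f e t * g' e t)
     (\<lambda>e t. f'' e t * g e t + 2 * (f' e t * g' e t) + f e t * g'' e t)"
  proof (rule decay_dataI[where C = "4 * (C * B)"])
    fix e t assume et: "e \<in> I" "t > (1/2::real)"
    show "\<bar>f e t * g e t\<bar> \<le> 4 * (C * B) / t ^ (d + c)"
      using prod[OF C(2)[OF et] B(2)[OF et] et(2) refl] CB(1)[OF et(2)] order_trans by blast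
    have 1: "\<bar>f' e t * g e t\<bar> \<le> C * B / t ^ (d + c + 1)" "\<bar>f e t * g' e t\<bar> \<le> C * B / t ^ (d + c + 1)"
      using prod[OF C(3)[OF et] B(2)[OF et] et(2)] prod[OF C(2)[OF et] B(3)[OF et] et(2)] by auto
    have "\<bar>f' e t * g e t + f e t * g' e t\<bar> \<le> 2 * (C * B) / t ^ (d + c + 1)"
      using abs_triangle_ineq[of "f' e t * g e t" "f e t * g' e t"] 1 by (simp only: times_divide_eq_right[symmetric])
    then show "\<bar>f' e t * g e t + f e t * g' e t\<bar> \<le> 4 * (C * B) / t ^ (d + c + 1)"
      using CB(2)[OF et(2)] order_trans by blast
    have "\<bar>f'' e t * g e t\<bar> \<le> C * B / t ^ (d + c + 2)" "\<bar>f e t * g'' e t\<bar> \<le> C * B / t ^ (d + c + 2)"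
       "\<bar>f' e t * g' e t\<bar> \<le> C * B / t ^ (d + c + 2)"
      using prod[OF C(4)[OF et] B(2)[OF et] et(2)] prod[OF C(2)[OF et] B(4)[OF et] et(2)]
        prod[OF C(3)[OF et] B(3)[OF et] et(2)] by auto
    then have "\<bar>f'' e t * g e t + 2 * (f' e t * g' e t) + f e t * g'' e t\<bar> \<le> 4 * (C * B / t ^ (d + c + 2))"
      by linarith
    then show "\<bar>f'' e t * g e t + 2 * (f' e t * g' e t) + f e t * g'' e t\<bar> \<le> 4 * (C * B) / t ^ (d + c + 2)"
      by simp
    show "((\<lambda>t. f e t * g e t) has_real_derivative f' e t * g e t + f e t * g' e t) (at t)"
      using decay_dataD(1)[OF D(1) et] decay_dataD(1)[OF D(2) et] by (auto intro!: derivative_eq_intros)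
    show "((\<lambda>t. f' e t * g e t + f e t * g' e t) has_real_derivative
      f'' e t * g e t + 2 * (f' e t * g' e t) + f e t * g'' e t) (at t)"
      using decay_dataD(1,2)[OF D(1) et] decay_dataD(1,2)[OF D(2) et]
      by (auto intro!: derivative_eq_intros)
  qed (intro continuous_on_add continuous_on_mult continuous_on_const decay_dataD[OF D(1)] decay_dataD[OF D(2)]; assumption)+
  then show ?thesis unfolding decay_def by blast
qed

lemma decay_coeff:
  assumes "compact I" "continuous_on I c"
  shows "decay I 0 (\<lambda>e t. c e)"
proof -
  obtain B where B: "\<And>e. e \<in> I \<Longrightarrow> \<bar>c e\<bar> \<le> B"
    using compact_imp_bounded[OF compact_continuous_image[OF assms(2,1)]] unfolding bounded_iff by auto
  have "decay_data I 0 (\<lambda>e t. c e) (\<lambda>e t. 0) (\<lambda>e t. 0)"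
  proof (rule decay_dataI[where C = "\<bar>B\<bar>"])
    fix e t assume "e \<in> I"
    then show "\<bar>c e\<bar> \<le> \<bar>B\<bar> / t ^ 0" using B[of e] by simp
  qed (use assms in \<open>auto intro!: derivative_eq_intros\<close>)
  then show ?thesis unfolding decay_def by blast
qed

lemma decay_inverse:
  assumes "continuous_on I b" "\<And>e. e \<in> I \<Longrightarrow> b e \<ge> 0"
  shows "decay I 1 (\<lambda>e t. 1 / (t + b e))"
proof -
  have le: "1 / (t + b e) ^ k \<le> 1 / t ^ k" if "e \<in> I" "t > 1/2" for e t k
    using that assms(2)[of e] by (intro divide_left_mono power_mono mult_pos_pos) auto
  have "decay_data I 1 (\<lambda>e t. 1 / (t + b e)) (\<lambda>e t. - (1 / (t + b e) ^ 2)) (\<lambda>e t. 2 * (1 / (t + b e) ^ 3))"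
  proof (rule decay_dataI[where C = 2])
    fix e t assume et: "e \<in> I" "t > (1/2::real)"
    then have pos: "t + b e > 0" using assms(2)[of e] by auto
    have dbl: "1 / t ^ k \<le> 2 / t ^ k" for k using et by (intro divide_right_mono) auto
    show "\<bar>1 / (t + b e)\<bar> \<le> 2 / t ^ 1"
      using order_trans[OF le[OF et, of 1] dbl] pos by simp
    have "1 / (t + b e)^2 \<le> 2 / t ^ 2"
      using order_trans[OF le[OF et, of 2] dbl] .
    then show "\<bar>- (1 / (t + b e)^2)\<bar> \<le> 2 / t ^ (1 + 1)" by (simp only: one_add_one) simp
    have "\<bar>2 * (1 / (t + b e)^3)\<bar> \<le> 2 / t ^ 3"
      using le[OF et, of 3] pos by simp
    then show "\<bar>2 * (1 / (t + b e)^3)\<bar> \<le> 2 / t ^ (1 + 2)" by (simp add: power3_eq_cube)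
    show "((\<lambda>t. 1 / (t + b e)) has_real_derivative - (1 / (t + b e)\<^sup>2)) (at t)"
      using pos by (auto intro!: derivative_eq_intros simp: power2_eq_square)
    show "((\<lambda>t. - (1 / (t + b e)\<^sup>2)) has_real_derivative 2 * (1 / (t + b e) ^ 3)) (at t)"
      using pos by (auto intro!: derivative_eq_intros simp: divide_simps power_numeral_reduce)
  next
    fix t :: real assume "t > 1/2"
    then have nz: "t + b e \<noteq> 0" if "e \<in> I" for e using assms(2)[OF that] by linarith
    show "continuous_on I (\<lambda>e. 1 / (t + b e))" "continuous_on I (\<lambda>e. - (1 / (t + b e)\<^sup>2))"
      "continuous_on I (\<lambda>e. 2 * (1 / (t + b e) ^ 3))"
      using nz assms(1) by (auto intro!: continuous_intros)
  qed
  then show ?thesis unfolding decay_def by blast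
qed

lemma decay_quotient:
  assumes "compact I" "continuous_on I a" "continuous_on I b" "\<And>e. e \<in> I \<Longrightarrow> b e \<ge> 0"
  shows "decay I 0 (\<lambda>e t. (t + a e) / (t + b e))"
proof -
  have "decay I 0 (\<lambda>e t. 1 + (a e - b e) * (1 / (t + b e)))"
    using decay_add[OF decay_coeff[OF assms(1), of "\<lambda>_. 1"] decay_weaken
      [OF decay_mult[OF decay_coeff[OF assms(1), of "\<lambda>e. a e - b e"] decay_inverse[OF assms(3,4)]], of 0]]
    using assms by (auto intro!: continuous_intros)
  then show ?thesis
  proof (rule decay_cong)
    fix e t assume "e \<in> I" "t > (1/2::real)"
    then have "t + b e > 0" using assms(4)[of e] by linarith
    then show "1 + (a e - b e) * (1 / (t + b e)) = (t + a e) / (t + b e)" by (simp add: field_simps)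
  qed
qed

lemma decay_sum:
  assumes "compact I" "\<And>i. i \<in> A \<Longrightarrow> decay I d (f i)"
  shows "decay I d (\<lambda>e t. \<Sum>i\<in>A. f i e t)"
  using assms(2)
proof (induction A rule: infinite_finite_induct)
  case (infinite A)
  have "decay I d (\<lambda>e t. 0)" unfolding decay_def
    by (rule exI[of _ "\<lambda>_ _. 0"], rule exI[of _ "\<lambda>_ _. 0"], rule decay_dataI[where C = 0]) auto
  with infinite show ?case by simp
next
  case empty
  have "decay I d (\<lambda>e t. 0)" unfolding decay_def
    by (rule exI[of _ "\<lambda>_ _. 0"], rule exI[of _ "\<lambda>_ _. 0"], rule decay_dataI[where C = 0]) auto
  then show ?case by simp
next
  case (insert i A)
  then show ?case by (simp add: decay_add)
qed

lemma decay_prod: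
  assumes "compact I" "\<And>i. i \<in> A \<Longrightarrow> decay I 0 (f i)"
  shows "decay I 0 (\<lambda>e t. \<Prod>i\<in>A. f i e t)"
  using assms(2)
proof (induction A rule: infinite_finite_induct)
  case (insert i A)
  then show ?case using decay_mult[of I 0 "f i" 0 "\<lambda>e t. \<Prod>i\<in>A. f i e t"] by simp
qed (simp_all add: decay_coeff[OF assms(1)])

lemma decay_imp_deriv:
  assumes "decay I d f"
  obtains f' f'' where "decay_data I d f f' f''"
    "\<And>e t. e \<in> I \<Longrightarrow> t > 1/2 \<Longrightarrow> deriv (f e) t = f' e t"
    "\<And>e t. e \<in> I \<Longrightarrow> t > 1/2 \<Longrightarrow> (deriv ^^ 2) (f e) t = f'' e t"
proof -
  obtain f' f'' where D: "decay_data I d f f' f''" using assms decay_def by blast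
  have 1: "deriv (f e) t = f' e t" if "e \<in> I" "t > 1/2" for e t
    using decay_dataD(1)[OF D that] by (rule DERIV_imp_deriv)
  have "(deriv ^^ 2) (f e) t = f'' e t" if "e \<in> I" "t > 1/2" for e t
  proof -
    have "(deriv (f e) has_real_derivative f'' e t) (at t)"
      by (rule has_field_derivative_transform_within_open
           [OF decay_dataD(2)[OF D that], of "{1/2<..}"]) (use that 1 in auto)
    then show ?thesis by (simp add: numeral_2_eq_2 DERIV_imp_deriv)
  qed
  with D 1 show thesis using that by blast
qed

section \<open>Telescoping and continuity for sums of derivatives\<close>

lemma deriv_telescope_sums:
  fixes F G G' :: "real \<Rightarrow> real"
  assumes G: "\<And>t. t > a \<Longrightarrow> (G has_real_derivative G' t) (at t)"
    and F: "\<And>t. t > a \<Longrightarrow> F t = G (t + 1) - G t"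
    and lim: "(\<lambda>k. G' (s + real k)) \<longlonglongrightarrow> 0" and "s > a"
  shows "(\<lambda>k. deriv F (s + real k)) sums (- G' s)"
proof -
  have "deriv F (s + real k) = G' (s + real (Suc k)) - G' (s + real k)" for k
  proof -
    have "s + real k > a" using \<open>s > a\<close> by simp
    then have "((\<lambda>t. G (t + 1) - G t) has_real_derivative G' (s + real k + 1) - G' (s + real k)) (at (s + real k))"
      by (intro DERIV_diff G DERIV_shift[THEN iffD1] ) (auto simp: add.commute)
    then have "(F has_real_derivative G' (s + real k + 1) - G' (s + real k)) (at (s + real k))"
      by (rule has_field_derivative_transform_within_open[where S = "{a<..}"])
         (use \<open>s + real k > a\<close> F in auto)
    then show ?thesis by (simp add: DERIV_imp_deriv add.commute add.left_commute)
  qed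
  moreover have "(\<lambda>k. G' (s + real (Suc k)) - G' (s + real k)) sums (0 - G' (s + real 0))"
    by (rule telescope_sums[OF lim])
  ultimately show ?thesis by simp
qed

text \<open>Degree 0 is enough for \<open>G\<close>: only the derivative of \<open>G\<close> has to
  tend to zero, and differentiation gains one power of \<open>1 / t\<close>.\<close>

lemma decay_telescope_sums:
  fixes G :: "real \<Rightarrow> real"
  assumes "decay {e} d (\<lambda>_. G)" and F: "\<And>t. t > a \<Longrightarrow> F t = G (t + 1) - G t"
    and "a \<ge> 1/2" "s > a"
  shows "(\<lambda>k. deriv F (s + real k)) sums (- deriv G s)"
proof -
  have "decay {e} 0 (\<lambda>_. G)" using decay_weaken[OF assms(1)] by simp
  then obtain G' G'' where D: "decay_data {e} 0 (\<lambda>_. G) G' G''"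
    "\<And>e' t. e' \<in> {e} \<Longrightarrow> t > 1/2 \<Longrightarrow> deriv G t = G' e' t"
    by (metis decay_imp_deriv)
  obtain C where C: "\<And>e' t. e' \<in> {e} \<Longrightarrow> t > 1/2 \<Longrightarrow> \<bar>G' e' t\<bar> \<le> C / t ^ (0 + 1)"
    using D(1) by (metis decay_dataE)
  have "(\<lambda>k. C / (s + real k)) \<longlonglongrightarrow> 0"
    by (rule real_tendsto_divide_at_top[OF tendsto_const
          filterlim_tendsto_add_at_top[OF tendsto_const filterlim_real_sequentially]])
  then have "(\<lambda>k. G' e (s + real k)) \<longlonglongrightarrow> 0"
    by (rule Lim_null_comparison[rotated]) (use C assms in \<open>auto intro!: always_eventually\<close>)
  then have "(\<lambda>k. deriv F (s + real k)) sums (- G' e s)"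
    by (intro deriv_telescope_sums[where a = a and G = G])
       (use decay_dataD(1)[OF D(1)] F assms(3,4) in auto)
  then show ?thesis using D(2)[of e s] assms by simp
qed

text \<open>For \<open>s < 1\<close> the comparison with the inverse squares rests on
  \<open>s + k \<ge> s * (k + 1)\<close>, which costs a factor \<open>1 / s^2\<close>.\<close>

lemma summable_inverse_square: "summable (\<lambda>k. C / (s + real k) ^ 2)" if "s > 0" for C s :: real
proof -
  have "summable (\<lambda>k. C * (1 / (real (Suc k)) ^ 2) * (if s \<ge> 1 then 1 else 1 / s ^ 2))"
    using inverse_squares_sums
    by (intro summable_mult2 summable_mult) (auto simp: sums_iff add.commute)
  then have "summable (\<lambda>k. \<bar>C\<bar> * (1 / (real (Suc k)) ^ 2) * (if s \<ge> 1 then 1 else 1 / s ^ 2))"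
    using inverse_squares_sums
    by (intro summable_mult2 summable_mult) (auto simp: sums_iff add.commute)
  then show ?thesis
  proof (rule summable_comparison_test'[where N = 0])
    fix k :: nat
    show "norm (C / (s + real k) ^ 2) \<le> \<bar>C\<bar> * (1 / (real (Suc k)) ^ 2) * (if s \<ge> 1 then 1 else 1 / s ^ 2)"
    proof (cases "s \<ge> 1")
      case True
      then show ?thesis using that by (auto simp: abs_divide intro!: divide_left_mono power_mono)
    next
      case False
      have "s * real (Suc k) \<le> s + real k" using False that
        by (simp add: algebra_simps mult_left_le_one_le)
      then have "(s * real (Suc k))^2 \<le> (s + real k)^2" using that by (intro power_mono) auto
      then have "\<bar>C\<bar> / (s + real k)^2 \<le> \<bar>C\<bar> / (s * real (Suc k))^2"
        using that by (intro divide_left_mono) auto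
      then show ?thesis using that False by (simp add: abs_divide power_mult_distrib mult.commute)
    qed
  qed
qed

text \<open>Weierstrass M-test: from degree 1 a single differentiation already yields a majorant
  \<open>2 * C / (s + k)^2\<close> independent of \<open>e\<close>; for the second derivative the
  additional \<open>1 / (s + k)\<close> is bounded by 2.\<close>

lemma suminf_deriv_continuous:
  assumes "decay I d f" "d \<ge> 1" "s > 1/2"
  shows "continuous_on I (\<lambda>e. \<Sum>k. deriv (f e) (s + real k))"
    and "\<And>e. e \<in> I \<Longrightarrow> summable (\<lambda>k. deriv (f e) (s + real k))"
    and "continuous_on I (\<lambda>e. \<Sum>k. (deriv ^^ 2) (f e) (s + real k))"
    and "\<And>e. e \<in> I \<Longrightarrow> summable (\<lambda>k. (deriv ^^ 2) (f e) (s + real k))"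
proof -
  have "decay I 1 f" using decay_weaken assms by blast
  then obtain f' f'' where D: "decay_data I 1 f f' f''"
    "\<And>e t. e \<in> I \<Longrightarrow> t > 1/2 \<Longrightarrow> deriv (f e) t = f' e t"
    "\<And>e t. e \<in> I \<Longrightarrow> t > 1/2 \<Longrightarrow> (deriv ^^ 2) (f e) t = f'' e t"
    by (metis decay_imp_deriv)
  obtain C where C: "C \<ge> 0" "\<And>e t. e \<in> I \<Longrightarrow> t > 1/2 \<Longrightarrow> \<bar>f' e t\<bar> \<le> C / t ^ (1 + 1)"
      "\<And>e t. e \<in> I \<Longrightarrow> t > 1/2 \<Longrightarrow> \<bar>f'' e t\<bar> \<le> C / t ^ (1 + 2)"
    using D(1) by (metis decay_dataE)
  have t: "s + real k > 1/2" for k using assms(3) by simp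
  have b1: "norm (deriv (f e) (s + real k)) \<le> 2 * C / (s + real k) ^ 2" if "e \<in> I" for e k
  proof -
    have "C / (s + real k)^2 \<le> 2 * C / (s + real k) ^ 2" using C(1) by (intro divide_right_mono) auto
    then show ?thesis using C(2)[OF that t[of k]] D(2)[OF that t[of k]] by (simp add: power2_eq_square)
  qed
  have b2: "norm ((deriv ^^ 2) (f e) (s + real k)) \<le> 2 * C / (s + real k) ^ 2" if "e \<in> I" for e k
  proof -
    have "1 / (s + real k) \<le> 2" using t[of k] by (simp add: field_simps)
    then have "C / (s + real k)^2 * (1 / (s + real k)) \<le> C / (s + real k) ^ 2 * 2"
      using C(1) by (intro mult_left_mono) auto
    then show ?thesis using C(3)[OF that t[of k]] D(3)[OF that t[of k]] 
      by (simp add: power_numeral_reduce field_simps)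
  qed
  have s: "summable (\<lambda>k. 2 * C / (s + real k) ^ 2)" using assms(3) by (intro summable_inverse_square) auto
  show "summable (\<lambda>k. deriv (f e) (s + real k))" if "e \<in> I" for e
    by (rule summable_comparison_test'[OF s, of 0]) (use b1 that in auto)
  show "summable (\<lambda>k. (deriv ^^ 2) (f e) (s + real k))" if "e \<in> I" for e
    by (rule summable_comparison_test'[OF s, of 0]) (use b2 that in auto)
  have c1: "continuous_on I (\<lambda>e. deriv (f e) (s + real k))" for k
    using decay_dataD(4)[OF D(1) t[of k]] D(2)[OF _ t[of k]] by (metis (mono_tags, lifting) continuous_on_cong)
  have c2: "continuous_on I (\<lambda>e. (deriv ^^ 2) (f e) (s + real k))" for k
    using decay_dataD(5)[OF D(1) t[of k]] D(3)[OF _ t[of k]] by (metis (mono_tags, lifting) continuous_on_cong)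
  show "continuous_on I (\<lambda>e. \<Sum>k. deriv (f e) (s + real k))"
    by (rule uniform_limit_theorem[OF _ Weierstrass_m_test[OF b1 s]])
       (auto intro!: always_eventually continuous_on_sum c1)
  show "continuous_on I (\<lambda>e. \<Sum>k. (deriv ^^ 2) (f e) (s + real k))"
    by (rule uniform_limit_theorem[OF _ Weierstrass_m_test[OF b2 s]])
       (auto intro!: always_eventually continuous_on_sum c2)
qed

text \<open>Each numerator factor is paired with a denominator factor into a bounded quotient; every
  denominator factor left over contributes one power of \<open>1 / t\<close>.\<close>

lemma decay_prod_list_quotient:
  fixes as bs :: "(real \<Rightarrow> real) list"
  assumes I: "compact I"
    and as: "\<And>a. a \<in> set as \<Longrightarrow> continuous_on I a"
    and bs: "\<And>b. b \<in> set bs \<Longrightarrow> continuous_on I b" "\<And>b e. b \<in> set bs \<Longrightarrow> e \<in> I \<Longrightarrow> b e \<ge> 0"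
    and "length as \<le> length bs"
  shows "decay I (length bs - length as) (\<lambda>e t. (\<Prod>a\<leftarrow>as. t + a e) / (\<Prod>b\<leftarrow>bs. t + b e))"
  using assms(2-)
proof (induction bs arbitrary: as)
  case Nil
  then show ?case using decay_coeff[OF I, of "\<lambda>_. 1"] by simp
next
  case (Cons b bs)
  show ?case
  proof (cases as)
    case Nil
    have "decay I (1 + (length bs - 0)) (\<lambda>e t. (1 / (t + b e)) * ((\<Prod>a\<leftarrow>[]. t + a e) / (\<Prod>b\<leftarrow>bs. t + b e)))"
      using Cons.IH[of "[]"] Cons.prems by (intro decay_mult decay_inverse) auto
    then show ?thesis using Nil by simp
  next
    case as: (Cons a as')
    have "decay I (0 + (length bs - length as'))
        (\<lambda>e t. ((t + a e) / (t + b e)) * ((\<Prod>a\<leftarrow>as'. t + a e) / (\<Prod>b\<leftarrow>bs. t + b e)))"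
      using Cons.IH[of as'] Cons.prems as by (intro decay_mult decay_quotient I) auto
    then show ?thesis using as by simp
  qed
qed

subsection \<open>The squared quotient and its recurrence in the parameter\<close>

text \<open>The quotient depends on \<open>t\<close> only through \<open>t * (t + \<eta>)\<close>.\<close>

definition quot :: "nat \<Rightarrow> real \<Rightarrow> real \<Rightarrow> real" where
  "quot n \<eta> t = (\<Prod>l=1..n. (t - real l) * (t + \<eta> + real l)) / (\<Prod>k=0..n. (t + real k) * (t + \<eta> - real k))"

definition quot_square :: "nat \<Rightarrow> real \<Rightarrow> real \<Rightarrow> real" where
  "quot_square n \<eta> t = (t + \<eta> / 2) * (quot n \<eta> t)\<^sup>2"

lemma quot_0: "quot 0 \<eta> t = 1 / (t * (t + \<eta>))"
  by (simp add: quot_def)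

lemma quot_Suc:
  "quot (Suc n) \<eta> t = quot n \<eta> t * ((t - real (Suc n)) * (t + \<eta> + real (Suc n)) / ((t + real (Suc n)) * (t + \<eta> - real (Suc n))))"
  by (simp add: quot_def)

text \<open>The factors containing \<open>\<eta>\<close> are \<open>t + \<eta> + i\<close> at
  consecutive integers i, so raising \<open>\<eta>\<close> by one changes only the end factors of
  the two products.\<close>

lemma quot_center_shift:
  assumes "t > 0" "\<eta> \<ge> real n"
  shows "quot n (\<eta> + 1) t * (t + \<eta> + 1)\<^sup>2 = quot n \<eta> t * ((t + \<eta> + real n + 1) * (t + \<eta> - real n))"
  using assms(2)
proof (induction n)
  case 0
  with assms(1) show ?case by (simp add: quot_0 divide_simps power2_eq_square)
next
  case (Suc n)
  then have IH: "quot n (\<eta> + 1) t * (t + \<eta> + 1)\<^sup>2 = quot n \<eta> t * ((t + \<eta> + real n + 1) * (t + \<eta> - real n))" by simp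
  have nz: "t + \<eta> - real n \<noteq> 0" "t + \<eta> - real (Suc n) \<noteq> 0" "t + real (Suc n) \<noteq> 0" "t + \<eta> + real n + 1 \<noteq> 0"
    using Suc.prems assms(1) by auto
  have "quot (Suc n) (\<eta> + 1) t * (t + \<eta> + 1)\<^sup>2
      = (quot n (\<eta> + 1) t * (t + \<eta> + 1)\<^sup>2) * ((t - real (Suc n)) * (t + \<eta> + real n + 2) / ((t + real (Suc n)) * (t + \<eta> - real n)))"
    by (simp add: quot_Suc algebra_simps)
  also have "\<dots> = quot n \<eta> t * (t + \<eta> + real n + 1) * ((t - real (Suc n)) * (t + \<eta> + real n + 2) / (t + real (Suc n)))"
    unfolding IH using nz by simp
  also have "\<dots> = quot (Suc n) \<eta> t * ((t + \<eta> + real (Suc n) + 1) * (t + \<eta> - real (Suc n)))"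
    using nz by (simp add: quot_Suc add_ac)
  finally show ?case .
qed

text \<open>Here all four products move by one step. The cross-multiplied form stays valid at
  \<open>t = n\<close>, where dividing by \<open>t - n\<close> would not be possible.\<close>

lemma quot_arg_shift:
  assumes "t > 0" "\<eta> \<ge> real n"
  shows "quot n \<eta> (t + 1) * ((t - real n) * (t + real n + 1) * (t + \<eta> + 1)\<^sup>2)
    = quot n \<eta> t * (t\<^sup>2 * ((t + \<eta> + real n + 1) * (t + \<eta> - real n)))"
  using assms(2)
proof (induction n)
  case 0
  with assms(1) show ?case by (simp add: quot_0 divide_simps power2_eq_square add_ac)
next
  case (Suc n)
  then have IH: "quot n \<eta> (t + 1) * ((t - real n) * (t + real n + 1) * (t + \<eta> + 1)\<^sup>2)
    = quot n \<eta> t * (t\<^sup>2 * ((t + \<eta> + real n + 1) * (t + \<eta> - real n)))" by simp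
  have nz: "t + \<eta> - real n \<noteq> 0" "t + \<eta> - real n - 1 \<noteq> 0" "t + real n + 1 \<noteq> 0" "t + real n + 2 \<noteq> 0"
    using Suc.prems assms(1) by auto
  have e1: "quot (Suc n) \<eta> (t + 1) = quot n \<eta> (t + 1) * ((t - real n) * (t + \<eta> + real n + 2) / ((t + real n + 2) * (t + \<eta> - real n)))"
    by (simp add: quot_Suc algebra_simps)
  have e2: "quot (Suc n) \<eta> t = quot n \<eta> t * ((t - real n - 1) * (t + \<eta> + real n + 1) / ((t + real n + 1) * (t + \<eta> - real n - 1)))"
    by (simp add: quot_Suc algebra_simps)
  have "quot (Suc n) \<eta> (t + 1) * ((t - real (Suc n)) * (t + real (Suc n) + 1) * (t + \<eta> + 1)\<^sup>2)
     = (quot n \<eta> (t + 1) * ((t - real n) * (t + real n + 1) * (t + \<eta> + 1)\<^sup>2))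
       * ((t + \<eta> + real n + 2) * (t - real n - 1) / ((t + real n + 1) * (t + \<eta> - real n)))"
    unfolding e1 using nz by (simp add: divide_simps) (simp add: algebra_simps)
  also have "\<dots> = quot (Suc n) \<eta> t * (t\<^sup>2 * ((t + \<eta> + real (Suc n) + 1) * (t + \<eta> - real (Suc n))))"
    unfolding IH e2 using nz by (simp add: divide_simps) (simp add: algebra_simps)
  finally show ?case .
qed

text \<open>This coefficient and the certificate below were found by creative telescoping; with \<open>z = t + N\<close> and
  \<open>p = (z - n - 1) * (z + n)\<close> the certificate is a polynomial in \<open>N\<close>, \<open>z\<close>, \<open>p\<close>.\<close>

definition rec_mid :: "real \<Rightarrow> real \<Rightarrow> real" where
  "rec_mid n N = (let a = n * (n + 1) in
     (-2 - 4 * N) * a\<^sup>2 + (-2 - 6 * N - 6 * N\<^sup>2 - 4 * N^3) * a + N + 4 * N\<^sup>2 + 6 * N^3 + 5 * N^4 + 2 * N^5)"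

definition quot_square_cert :: "real \<Rightarrow> real \<Rightarrow> real \<Rightarrow> real" where
  "quot_square_cert N z p = (2 * z\<^sup>2 + 2 * (N + 1) * z + (N + 1)\<^sup>2) * p\<^sup>2 - 2 * p * z^4 - N * (2 * z + N - 1) * z^4"

text \<open>The telescoping identity, cleared of denominators, is cut into two halves linked by the
  bracket on the right. This half collects what stands over \<open>p^2\<close>: the term of
  parameter \<open>N - 1\<close> and the antidifference at \<open>t\<close>. The next lemma collects
  the rest over \<open>(z + 1)^4\<close> and produces the same bracket with the opposite sign. Here
  n has been eliminated in favour of \<open>p\<close>, which may then be arbitrary.\<close>

lemma quot_square_cert_identity1:
  fixes z N p :: real
  shows "N^3 * ((2*z-1-N) * (2*z-1+N) - 4*p) * (2*z-N-1) * z^4 + (p - N*(2*z-N-1))\<^sup>2 * quot_square_cert N z p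
   = p\<^sup>2 * (p\<^sup>2 * (2*z\<^sup>2+2*(N+1)*z+(N+1)\<^sup>2) - 2*p*(z^4+4*N*z^3+2*N*(N+1)*z\<^sup>2-N*(N+1)^3)
     + 6*N*z^5-3*N*(1-N)*z^4-2*N\<^sup>2*(N+1)\<^sup>2*z\<^sup>2-2*N\<^sup>2*(N+1)^3*z+N\<^sup>2*(N+1)^4)"
  unfolding quot_square_cert_def by algebra

lemma quot_square_cert_identity2:
  fixes z N p n :: real
  assumes "p = (z - n - 1) * (z + n)"
  shows "rec_mid n N * (2*z-N) * (z+1)^4 - (N+1)^5 * (2*z-N+1) * (p+2*z)\<^sup>2 - (z-N)^4 * quot_square_cert N (z+1) (p+2*z)
   = (-1) * (z+1)^4 * (p\<^sup>2 * (2*z\<^sup>2+2*(N+1)*z+(N+1)\<^sup>2) - 2*p*(z^4+4*N*z^3+2*N*(N+1)*z\<^sup>2-N*(N+1)^3)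
     + 6*N*z^5-3*N*(1-N)*z^4-2*N\<^sup>2*(N+1)\<^sup>2*z\<^sup>2-2*N\<^sup>2*(N+1)^3*z+N\<^sup>2*(N+1)^4)"
proof -
  have a: "n * (n + 1) = z\<^sup>2 - z - p" using assms by algebra
  show ?thesis unfolding quot_square_cert_def rec_mid_def Let_def a by algebra
qed

definition quot_square_anti :: "nat \<Rightarrow> real \<Rightarrow> real \<Rightarrow> real" where
  "quot_square_anti n N t = (quot n N t * ((t - real n - 1) * (t + real n)) / ((t + N - real n - 1) * (t + N + real n)))\<^sup>2
     * quot_square_cert N (t + N) ((t + N - real n - 1) * (t + N + real n)) / 2"

lemma quot_square_recurrence:
  assumes t: "t > 0" and N: "N \<ge> real n + 1"
  shows "- ((N + 1)^5) * quot_square n (N + 1) t + rec_mid n N * quot_square n N t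
      + N^3 * ((2 * real n + 1)\<^sup>2 - N\<^sup>2) * quot_square n (N - 1) t = quot_square_anti n N (t + 1) - quot_square_anti n N t"
proof -
  define z p q where "z = t + N" and "p = (z - real n - 1) * (z + real n)" and "q = quot n N t"
  have pos: "z - real n - 1 > 0" "z + real n > 0" "z + 1 > 0" "z + real n + 1 > 0" "z - real n > 0" "z > 0"
    using t N unfolding z_def by auto
  have p: "p > 0" unfolding p_def using pos by simp
  \<comment> \<open>\<open>p + 2 * z\<close> is the value of \<open>p\<close> after \<open>z\<close>
    is replaced by \<open>z + 1\<close>, so it serves both the parameter \<open>N + 1\<close> and
    the argument \<open>t + 1\<close>.\<close>
  have p2: "p + 2 * z = (z + real n + 1) * (z - real n)" unfolding p_def by (simp add: algebra_simps)
  have p2pos: "p + 2 * z > 0" unfolding p2 using pos by simp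
  have qp: "quot n (N + 1) t = q * (p + 2 * z) / (z + 1)\<^sup>2"
  proof -
    have "quot n (N + 1) t * (z + 1)\<^sup>2 = q * (p + 2 * z)"
      unfolding p2 unfolding z_def q_def using quot_center_shift[of t n N] t N by simp
    then show ?thesis using pos(3) by (simp add: eq_divide_eq)
  qed
  have qm: "quot n (N - 1) t = q * z\<^sup>2 / p"
  proof -
    have "q * z\<^sup>2 = quot n (N - 1) t * p"
      using quot_center_shift[of t n "N - 1"] t N by (simp add: q_def p_def z_def algebra_simps)
    then show ?thesis using p by (simp add: eq_divide_eq)
  qed
  have qs: "quot n N (t + 1) * ((t - real n) * (t + real n + 1)) = q * (t\<^sup>2 * (p + 2 * z)) / (z + 1)\<^sup>2"
  proof -
    have "quot n N (t + 1) * ((t - real n) * (t + real n + 1)) * (z + 1)\<^sup>2 = q * (t\<^sup>2 * (p + 2 * z))"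
      unfolding p2 unfolding z_def q_def using quot_arg_shift[of t n N] t N by (simp add: mult.assoc)
    then show ?thesis using pos(3) by (simp add: eq_divide_eq)
  qed
  have a0: "quot_square_anti n N t = q\<^sup>2 * ((t - real n - 1) * (t + real n))\<^sup>2 * quot_square_cert N z p / (2 * p\<^sup>2)"
    unfolding quot_square_anti_def q_def p_def z_def by (simp add: power_divide power_mult_distrib)
  have "quot_square_anti n N (t + 1) = (quot n N (t + 1) * ((t - real n) * (t + real n + 1)))\<^sup>2 * quot_square_cert N (z + 1) (p + 2 * z) / (2 * (p + 2 * z)\<^sup>2)"
  proof -
    have e: "(t + 1 + N - real n - 1) * (t + 1 + N + real n) = p + 2 * z" "t + 1 + N = z + 1"
      "(t + 1 - real n - 1) * (t + 1 + real n) = (t - real n) * (t + real n + 1)"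
      unfolding p2 by (auto simp: z_def algebra_simps)
    show ?thesis unfolding quot_square_anti_def e(1,3) unfolding e(2) by (simp add: power_divide)
  qed
  also have "\<dots> = q\<^sup>2 * t^4 * quot_square_cert N (z + 1) (p + 2 * z) / (2 * (z + 1)^4)"
    unfolding qs using p2pos pos(3) by (simp add: power_divide power_mult_distrib divide_simps flip: power_mult)
  finally have a1: "quot_square_anti n N (t + 1) = q\<^sup>2 * t^4 * quot_square_cert N (z + 1) (p + 2 * z) / (2 * (z + 1)^4)" .
  have tt: "t = z - N" by (simp add: z_def)
  have c: "t + (N + 1) / 2 = (2 * z - N + 1) / 2" "t + N / 2 = (2 * z - N) / 2" "t + (N - 1) / 2 = (2 * z - N - 1) / 2"
    by (auto simp: z_def field_simps)
  have r1: "quot_square n (N + 1) t = (2 * z - N + 1) / 2 * (q\<^sup>2 * (p + 2 * z)\<^sup>2 / (z + 1)^4)"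
    unfolding quot_square_def qp c by (simp add: power_divide power_mult_distrib flip: power_mult)
  have r0: "quot_square n N t = (2 * z - N) / 2 * q\<^sup>2"
    unfolding quot_square_def c q_def ..
  have rm: "quot_square n (N - 1) t = (2 * z - N - 1) / 2 * (q\<^sup>2 * z^4 / p\<^sup>2)"
    unfolding quot_square_def qm c by (simp add: power_divide power_mult_distrib flip: power_mult)
  define S where "S = p\<^sup>2 * (2*z\<^sup>2+2*(N+1)*z+(N+1)\<^sup>2) - 2*p*(z^4+4*N*z^3+2*N*(N+1)*z\<^sup>2-N*(N+1)^3)
     + 6*N*z^5-3*N*(1-N)*z^4-2*N\<^sup>2*(N+1)\<^sup>2*z\<^sup>2-2*N\<^sup>2*(N+1)^3*z+N\<^sup>2*(N+1)^4"
  have am: "(2 * real n + 1)\<^sup>2 - N\<^sup>2 = (2*z-1-N) * (2*z-1+N) - 4*p" unfolding p_def by algebra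
  have tn: "(t - real n - 1) * (t + real n) = p - N*(2*z-N-1)" unfolding p_def tt by algebra
  have i1: "N^3 * ((2 * real n + 1)\<^sup>2 - N\<^sup>2) * (2*z-N-1) * z^4 + ((t - real n - 1) * (t + real n))\<^sup>2 * quot_square_cert N z p = p\<^sup>2 * S"
    using quot_square_cert_identity1[of N z p] unfolding am tn S_def by (simp add: mult_ac)
  have i2: "rec_mid n N * (2*z-N) * (z+1)^4 - (N+1)^5 * (2*z-N+1) * (p+2*z)\<^sup>2 - t^4 * quot_square_cert N (z+1) (p+2*z) = (-1) * (z+1)^4 * S"
    using quot_square_cert_identity2[OF p_def, of N] unfolding tt S_def .
  have zz: "(z+1)^4 \<noteq> 0" "p\<^sup>2 \<noteq> 0" using pos p by auto
  have collect: "(- k1 * (x1 / 2 * (Q * y1 / A)) + k0 * (x0 / 2 * Q) + km * (xm / 2 * (Q * zm / B)))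
      - (Q * T * c1 / (2 * A) - Q * w * c0 / (2 * B))
      = Q / 2 * ((k0 * x0 * A - k1 * x1 * y1 - T * c1) / A + (km * xm * zm + w * c0) / B)"
    if "A \<noteq> 0" "B \<noteq> 0" for k1 x1 Q y1 A k0 x0 km xm zm B T c1 w c0 :: real
    using that by (simp add: field_simps)
  have "(- ((N + 1)^5) * quot_square n (N + 1) t + rec_mid n N * quot_square n N t
      + N^3 * ((2 * real n + 1)\<^sup>2 - N\<^sup>2) * quot_square n (N - 1) t) - (quot_square_anti n N (t + 1) - quot_square_anti n N t)
     = q\<^sup>2 / 2 * ((rec_mid n N * (2*z-N) * (z+1)^4 - (N+1)^5 * (2*z-N+1) * (p+2*z)\<^sup>2 - t^4 * quot_square_cert N (z+1) (p+2*z)) / (z+1)^4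
       + (N^3 * ((2 * real n + 1)\<^sup>2 - N\<^sup>2) * (2*z-N-1) * z^4 + ((t - real n - 1) * (t + real n))\<^sup>2 * quot_square_cert N z p) / p\<^sup>2)"
    unfolding r1 r0 rm a0 a1 by (rule collect) (fact zz)+
  also have "\<dots> = 0" unfolding i1 i2 using zz by simp
  finally show ?thesis by simp
qed

subsection \<open>The well-poised summand and its recurrence\<close>

text \<open>\<open>R n m\<close> is a constant multiple of this function at \<open>N = 2 * n - m\<close>. In this form its sums satisfy, after rescaling by
  \<open>well_poised_coeff\<close>, the same recurrence in \<open>N\<close> as those of \<open>quot_square n (real N)\<close>.\<close>

definition well_poised :: "nat \<Rightarrow> nat \<Rightarrow> real \<Rightarrow> real" where
  "well_poised n N t = (t + real n / 2) * (\<Prod>l=1..N. (t - real l) * (t + real n + real l))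
     * (\<Prod>l\<in>{N-n<..n}. (t - real l) * (t + real n + real l)) / (\<Prod>k=0..n. t + real k) ^ 4"

definition well_poised_anti :: "nat \<Rightarrow> nat \<Rightarrow> real \<Rightarrow> real" where
  "well_poised_anti n N t = - (real n * (2 * real N + 1)) *
     ((\<Prod>l=1..N-1. (t - real l) * (t + real n + real l)) * (\<Prod>l\<in>{N-n+1<..n}. (t - real l) * (t + real n + real l)) / (\<Prod>k=0..n. t + real k) ^ 4)
      * ((t + real n)^5 * (t - real n - 1) * (t - real N) * (t + real N + 1))"

text \<open>Both kinds of factors run over consecutive integers, so the shift of \<open>t\<close>
  only moves the ends of the products. No division is used, because \<open>t - b\<close> may
  vanish.\<close>

lemma prod_quad_arg_shift:
  fixes t c :: real
  shows "a \<le> b \<Longrightarrow> (\<Prod>l\<in>{a<..b}. (t + 1 - real l) * (t + 1 + c + real l)) * ((t - real b) * (t + c + 1 + real a))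
     = (\<Prod>l\<in>{a<..b}. (t - real l) * (t + c + real l)) * ((t - real a) * (t + c + 1 + real b))"
proof (induction b)
  case 0
  then show ?case by simp
next
  case (Suc b)
  show ?case
  proof (cases "a = Suc b")
    case True
    then show ?thesis by simp
  next
    case False
    then have ab: "a \<le> b" using Suc.prems by simp
    then have *: "{a<..Suc b} = insert (Suc b) {a<..b}" by auto
    have "(\<Prod>l\<in>{a<..Suc b}. (t + 1 - real l) * (t + 1 + c + real l)) * ((t - real (Suc b)) * (t + c + 1 + real a))
      = ((\<Prod>l\<in>{a<..b}. (t + 1 - real l) * (t + 1 + c + real l)) * ((t - real b) * (t + c + 1 + real a))) * ((t + 1 + c + real (Suc b)) * (t - real (Suc b)))"
      unfolding * by (simp add: mult_ac)
    also have "\<dots> = (\<Prod>l\<in>{a<..Suc b}. (t - real l) * (t + c + real l)) * ((t - real a) * (t + c + 1 + real (Suc b)))"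
      unfolding Suc.IH[OF ab] * by (simp add: mult_ac add_ac)
    finally show ?thesis .
  qed
qed

lemma prod_lin_arg_shift:
  fixes t :: real
  shows "(\<Prod>k=0..n. t + 1 + real k) * t = (\<Prod>k=0..n. t + real k) * (t + real n + 1)"
proof (induction n)
  case (Suc n)
  have "(\<Prod>k=0..Suc n. t + 1 + real k) * t = ((\<Prod>k=0..n. t + 1 + real k) * t) * (t + 1 + real (Suc n))" by simp
  then show ?case unfolding Suc.IH by (simp add: add_ac)
qed simp

lemma greaterThanAtMost_1: "{1..b} = {0<..(b::nat)}" by auto

lemma well_poised_rec_identity:
  fixes t n N :: real
  shows "(2*t+n) * ((N+1)^4*(2*n-N)*((t-N)*(t+n+N)*((t-N-1)*(t+n+N+1)))
      + rec_mid n N * ((t-N)*(t+n+N)*((t-(N-n)-1)*(t+N+1)))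
      - N^4*(2*n+1+N)*((t-(N-n))*(t+N)*((t-(N-n)-1)*(t+N+1))))
    = 2 * (- (n*(2*N+1)) * (t^5*(t+2*n+1)*(t+n+N)*(t-(N-n)-1) - (t+n)^5*(t-n-1)*(t-N)*(t+N+1)))"
  unfolding rec_mid_def Let_def by algebra

lemma well_poised_recurrence:
  assumes t: "t > 0" and N: "n + 1 \<le> N" "N + 1 \<le> 2 * n"
  shows "(real N + 1)^4 * (2 * real n - real N) * well_poised n (N + 1) t + rec_mid n N * well_poised n N t
      - real N^4 * (2 * real n + 1 + real N) * well_poised n (N - 1) t = well_poised_anti n N (t + 1) - well_poised_anti n N t"
proof -
  define f where "f l = (t - real l) * (t + real n + real l)" for l
  define P where "P = (\<Prod>k=0..n. t + real k)"
  define M where "M = N - n"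
  have M: "real M = real N - real n" "1 \<le> M" "M + 1 \<le> n" using N by (auto simp: M_def)
  \<comment> \<open>\<open>E1\<close> and \<open>E2\<close> contain exactly the factors shared by
    the parameters \<open>N - 1\<close>, \<open>N\<close>, \<open>N + 1\<close> and the
    antidifference. Over the common core \<open>b\<close> each summand keeps two quadratic factors,
    and the recurrence becomes a polynomial identity.\<close>
  define E1 where "E1 = (\<Prod>l\<in>{0<..N-1}. f l)"
  define E2 where "E2 = (\<Prod>l\<in>{M+1<..n}. f l)"
  define b where "b = E1 * E2 / P ^ 4"
  have P: "P > 0" unfolding P_def using t by (intro prod_pos) auto
  have s1: "{0<..N} = insert N {0<..N-1}" "{0<..N+1} = insert (N+1) (insert N {0<..N-1})" using N by auto
  have s2: "{M<..n} = insert (M+1) {M+1<..n}" "{M-1<..n} = insert M (insert (M+1) {M+1<..n})" using M by auto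
  have wpf: "well_poised n K t = (t + real n / 2) * (\<Prod>l\<in>{0<..K}. f l) * (\<Prod>l\<in>{K-n<..n}. f l) / P ^ 4" for K
    by (simp only: well_poised_def f_def P_def greaterThanAtMost_1)
  have idx: "N + 1 - n = M + 1" "N - n = M" "N - 1 - n = M - 1" using N by (auto simp: M_def)
  have w1: "well_poised n (N + 1) t = (t + real n / 2) * b * (f N * f (N + 1))"
    unfolding wpf idx s1(2) b_def E1_def E2_def using N by (simp add: mult_ac)
  have w0: "well_poised n N t = (t + real n / 2) * b * (f N * f (M + 1))"
    unfolding wpf idx s1(1) s2(1) b_def E1_def E2_def using N by (simp add: mult_ac)
  have wm: "well_poised n (N - 1) t = (t + real n / 2) * b * (f M * f (M + 1))"
    unfolding wpf idx s2(2) b_def E1_def E2_def using N by (simp add: mult_ac)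
  define c where "c = - (real n * (2 * real N + 1))"
  have a0: "well_poised_anti n N t = c * b * ((t + real n)^5 * (t - real n - 1) * (t - real N) * (t + real N + 1))"
    unfolding well_poised_anti_def greaterThanAtMost_1 idx c_def b_def E1_def E2_def P_def f_def by simp
  have a1: "well_poised_anti n N (t + 1) = c * b * (t^5 * (t + 2 * real n + 1) * (t + real n + real N) * (t - real M - 1))"
  proof -
    define E1' where "E1' = (\<Prod>l\<in>{0<..N-1}. (t + 1 - real l) * (t + 1 + real n + real l))"
    define E2' where "E2' = (\<Prod>l\<in>{M+1<..n}. (t + 1 - real l) * (t + 1 + real n + real l))"
    define P' where "P' = (\<Prod>k=0..n. t + 1 + real k)"
    have e1: "E1' * ((t + 1 - real N) * (t + real n + 1)) = E1 * (t * (t + real n + real N))"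
    proof -
      have c: "t - real (N - 1) = t + 1 - real N" "t - real 0 = t" "t + real n + 1 + real 0 = t + real n + 1"
         "t + real n + 1 + real (N - 1) = t + real n + real N" using N by (auto simp: of_nat_diff)
      show ?thesis using prod_quad_arg_shift[of 0 "N - 1" t "real n"] unfolding E1'_def E1_def f_def c by simp
    qed
    have e2: "E2' * ((t - real n) * (t + real N + 2)) = E2 * ((t - real M - 1) * (t + 2 * real n + 1))"
    proof -
      have c: "t + real n + 1 + real (M + 1) = t + real N + 2" "t - real (M + 1) = t - real M - 1"
         "t + real n + 1 + real n = t + 2 * real n + 1" using M(1) by auto
      show ?thesis using prod_quad_arg_shift[OF M(3), of t "real n"] unfolding E2'_def E2_def f_def c .
    qed
    have e3: "P' * t = P * (t + real n + 1)"
      using prod_lin_arg_shift[of t n] by (simp add: P'_def P_def)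
    have y: "t + real n + 1 > 0" using t by simp
    have P': "P' = P * (t + real n + 1) / t" using e3 t by (simp add: eq_divide_eq)
    have y5: "(t + 1 + real n)^5 = (t + real n + 1)^4 * (t + real n + 1)"
      by (simp add: eval_nat_numeral add_ac mult_ac)
    have sh: "t + 1 - real n - 1 = t - real n" "t + 1 + real N + 1 = t + real N + 2" by auto
    have "well_poised_anti n N (t + 1) = c * (E1' * E2' / P' ^ 4) * ((t + 1 + real n)^5 * (t + 1 - real n - 1) * (t + 1 - real N) * (t + 1 + real N + 1))"
      unfolding well_poised_anti_def greaterThanAtMost_1 idx c_def E1'_def E2'_def P'_def by simp
    \<comment> \<open>The certificate supplies \<open>t - n\<close> and \<open>t + 1 - N\<close>
      precisely where \<open>e1\<close> and \<open>e2\<close> need them, so these possibly vanishing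
      factors are never divided out.\<close>
    also have "\<dots> = c * (E1' * ((t + 1 - real N) * (t + real n + 1))) * (E2' * ((t - real n) * (t + real N + 2))) * (t + real n + 1)^4 / P' ^ 4"
      unfolding y5 sh by (simp only: times_divide_eq_left times_divide_eq_right mult_ac)
    also have "\<dots> = c * b * (t^5 * (t + 2 * real n + 1) * (t + real n + real N) * (t - real M - 1))"
      unfolding e1 e2 P' b_def using t P y
      by (simp add: power_mult_distrib power_divide) (simp add: power_numeral_reduce mult_ac)
    finally show ?thesis .
  qed
  have "(real N + 1)^4 * (2 * real n - real N) * well_poised n (N + 1) t + rec_mid n N * well_poised n N t
      - real N^4 * (2 * real n + 1 + real N) * well_poised n (N - 1) t
    = b / 2 * ((2*t+n) * ((real N+1)^4*(2*real n-real N)*((t-N)*(t+n+N)*((t-N-1)*(t+n+N+1)))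
      + rec_mid n N * ((t-N)*(t+n+N)*((t-(real N-n)-1)*(t+N+1)))
      - real N^4*(2*real n+1+N)*((t-(real N-n))*(t+N)*((t-(real N-n)-1)*(t+N+1)))))"
  proof -
    have c: "t - real (N + 1) = t - N - 1" "t + real n + real (N + 1) = t + n + N + 1"
      "t - real (M + 1) = t - (real N - n) - 1" "t + real n + real (M + 1) = t + N + 1"
      "t - real M = t - (real N - n)" "t + real n + real M = t + N"
      using M(1) by simp_all
    have f: "f N = (t-N)*(t+n+N)" "f (N+1) = (t-N-1)*(t+n+N+1)" "f (M+1) = (t-(real N-n)-1)*(t+N+1)"
       "f M = (t-(real N-n))*(t+N)" unfolding f_def c by simp_all
    have tn: "t + real n / 2 = (2*t+n) / 2" by simp
    have collect: "k1 * (x / 2 * b * F1) + k0 * (x / 2 * b * F0) - km * (x / 2 * b * Fm)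
      = b / 2 * (x * (k1 * F1 + k0 * F0 - km * Fm))" for k1 x F1 k0 F0 km Fm
      by (simp add: algebra_simps)
    show ?thesis unfolding w1 w0 wm f tn by (rule collect)
  qed
  also have "\<dots> = well_poised_anti n N (t + 1) - well_poised_anti n N t"
  proof -
    have collect: "b / 2 * (2 * (d * (A - B))) = d * b * A - d * b * B" for d A B
      by (simp add: algebra_simps)
    show ?thesis unfolding well_poised_rec_identity a1 a0 c_def M(1) by (rule collect[THEN trans]) simp
  qed
  finally show ?thesis .
qed

section \<open>The two initial cases of the recurrence\<close>

lemma quot_center: "quot n (real n) t = (\<Prod>l\<in>{0<..n}. (t - real l) * (t + real n + real l)) / (\<Prod>k=0..n. t + real k)\<^sup>2"
proof -
  have "(\<Prod>k=0..n. t + real n - real k) = (\<Prod>k=0..n. t + real k)"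
    by (rule prod.reindex_bij_witness[of _ "\<lambda>k. n - k" "\<lambda>k. n - k"]) auto
  then show ?thesis
    by (simp only: quot_def prod.distrib power2_eq_square greaterThanAtMost_1)
qed

lemma well_poised_eq_quot_square: "well_poised n n t = quot_square n (real n) t"
  unfolding well_poised_def quot_square_def quot_center greaterThanAtMost_1
  by (simp add: power_divide power2_eq_square eval_nat_numeral)

text \<open>The recurrences have order two, so besides \<open>N = n\<close> the case \<open>N = n + 1\<close> needs an argument of its own.\<close>

definition base_anti :: "nat \<Rightarrow> real \<Rightarrow> real" where
  "base_anti n t = (\<Prod>l\<in>{0<..n}. (t - real l) * (t + real n + real l)) * (\<Prod>l\<in>{1<..n}. (t - real l) * (t + real n + real l))
     / (\<Prod>k=0..n. t + real k) ^ 4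
     * ((t + real n + 1) * (t - real n - 1)\<^sup>2 * (t + real n)\<^sup>2 * (t + 2 * real n + 1)) / (2 * (real n + 1)^3)"

lemma base_identity:
  fixes t n y :: real
  assumes "y = t + n + 1"
  shows "(n+1)^3 * (2*t+n+1) * (t-1) * (t+2*n+1) * t\<^sup>2 + n * (n+1)\<^sup>2 * (2*t+n) * (t-n-1) * y^3
    = t^5 * (t-1) * (t+2*n+1) * (t+2*n+2) - y^4 * (t-n-1)\<^sup>2 * (t+n)\<^sup>2"
  unfolding assms by algebra

lemma base_telescope:
  assumes t: "t > 0" and n: "n \<ge> 1"
  shows "quot_square n (real n + 1) t + real n / (real n + 1) * well_poised n (n + 1) t = base_anti n (t + 1) - base_anti n t"
proof -
  define f where "f l = (t - real l) * (t + real n + real l)" for l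
  define P where "P = (\<Prod>k=0..n. t + real k)"
  define E1 where "E1 = (\<Prod>l\<in>{0<..n}. f l)"
  define E2 where "E2 = (\<Prod>l\<in>{1<..n}. f l)"
  define b where "b = E1 * E2 / P ^ 4"
  define y where "y = t + real n + 1"
  have P: "P > 0" unfolding P_def using t by (intro prod_pos) auto
  have y: "y > 0" using t by (simp add: y_def)
  \<comment> \<open>Squaring \<open>quot\<close> gives \<open>E1^2\<close>, whereas
    \<open>well_poised n (n + 1)\<close> contains \<open>E1 * E2\<close>; splitting off the factor
    with \<open>l = 1\<close> puts both over the same core \<open>b\<close>.\<close>
  have "{0<..n} = insert 1 {1<..n}" using n by auto
  then have E1: "E1 = (t - 1) * y * E2" by (simp add: E1_def E2_def f_def y_def add_ac)
  have "quot n (real n + 1) t * y\<^sup>2 = E1 / P\<^sup>2 * ((t + 2 * real n + 1) * t)"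
    using quot_center_shift[of t n "real n"] t by (simp add: quot_center y_def E1_def f_def P_def)
  then have "quot n (real n + 1) t = E1 * (t + 2 * real n + 1) * t / (P\<^sup>2 * y\<^sup>2)"
    using y P by (simp add: field_simps)
  then have "(quot n (real n + 1) t)\<^sup>2 = E1 * ((t - 1) * y * E2) * (t + 2 * real n + 1)\<^sup>2 * t\<^sup>2 / (P^4 * y^4)"
    by (simp add: power_divide power_mult_distrib power2_eq_square[of E1] E1[symmetric] flip: power_mult)
  then have "(quot n (real n + 1) t)\<^sup>2 = b * (t - 1) * (t + 2 * real n + 1)\<^sup>2 * t\<^sup>2 / y^3"
    using y by (simp add: b_def power4_eq_xxxx power3_eq_cube mult_ac)
  then have s: "quot_square n (real n + 1) t = (t + (real n + 1) / 2) * (b * (t - 1) * (t + 2 * real n + 1)\<^sup>2 * t\<^sup>2 / y^3)"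
    by (simp add: quot_square_def)
  have w: "well_poised n (n + 1) t = (t + real n / 2) * b * ((t - real n - 1) * (t + 2 * real n + 1))"
  proof -
    have "{0<..n+1} = insert (n+1) {0<..n}" by auto
    then show ?thesis unfolding well_poised_def greaterThanAtMost_1
      by (simp add: b_def E1_def E2_def f_def P_def mult_ac) (simp add: algebra_simps)
  qed
  have a0: "base_anti n t = b * (y * (t - real n - 1)\<^sup>2 * (t + real n)\<^sup>2 * (t + 2 * real n + 1)) / (2 * (real n + 1)^3)"
    by (simp add: base_anti_def b_def E1_def E2_def f_def P_def y_def)
  have a1: "base_anti n (t + 1) = b * (t^5 * (t - 1) * (t + 2 * real n + 1)\<^sup>2 * (t + 2 * real n + 2) / y^3) / (2 * (real n + 1)^3)"
  proof -
    define E1' where "E1' = (\<Prod>l\<in>{0<..n}. (t + 1 - real l) * (t + 1 + real n + real l))"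
    define E2' where "E2' = (\<Prod>l\<in>{1<..n}. (t + 1 - real l) * (t + 1 + real n + real l))"
    define P' where "P' = (\<Prod>k=0..n. t + 1 + real k)"
    have e1: "E1' * ((t - real n) * y) = E1 * (t * (t + 2 * real n + 1))"
    proof -
      have c: "t - real 0 = t" "t + real n + 1 + real 0 = y" "t + real n + 1 + real n = t + 2 * real n + 1" by (auto simp: y_def)
      show ?thesis using prod_quad_arg_shift[of 0 n t "real n"] unfolding E1'_def E1_def f_def c by simp
    qed
    have e2: "E2' * ((t - real n) * (y + 1)) = E2 * ((t - 1) * (t + 2 * real n + 1))"
    proof -
      have c: "t - real 1 = t - 1" "t + real n + 1 + real 1 = y + 1" "t + real n + 1 + real n = t + 2 * real n + 1" by (auto simp: y_def)
      show ?thesis using prod_quad_arg_shift[OF n, of t "real n"] unfolding E2'_def E2_def f_def c .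
    qed
    have "P' * t = P * y" using prod_lin_arg_shift[of t n] by (simp add: P'_def P_def y_def add_ac)
    then have P': "P' = P * y / t" using t by (simp add: eq_divide_eq)
    have sh: "t + 1 + real n + 1 = y + 1" "t + 1 - real n - 1 = t - real n" "t + 1 + real n = y"
      "t + 1 + 2 * real n + 1 = t + 2 * real n + 2" by (auto simp: y_def)
    have "base_anti n (t + 1) = E1' * E2' / P' ^ 4 * ((y + 1) * (t - real n)\<^sup>2 * y\<^sup>2 * (t + 2 * real n + 2)) / (2 * (real n + 1)^3)"
      unfolding base_anti_def E1'_def[symmetric] E2'_def[symmetric] P'_def[symmetric] sh(1,2,4) unfolding sh(3) ..
    also have "\<dots> = (E1' * ((t - real n) * y)) * (E2' * ((t - real n) * (y + 1))) / P' ^ 4 * (y * (t + 2 * real n + 2)) / (2 * (real n + 1)^3)"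
      by (simp only: power2_eq_square times_divide_eq_left times_divide_eq_right mult_ac)
    also have "\<dots> = b * (t^5 * (t - 1) * (t + 2 * real n + 1)\<^sup>2 * (t + 2 * real n + 2) / y^3) / (2 * (real n + 1)^3)"
      unfolding e1 e2 P' b_def using t y
      by (simp add: power_mult_distrib power_divide) (simp add: power_numeral_reduce mult_ac)
    finally show ?thesis .
  qed
  have n1: "real n + 1 \<noteq> 0" by linarith
  have "quot_square n (real n + 1) t + real n / (real n + 1) * well_poised n (n + 1) t - (base_anti n (t + 1) - base_anti n t)
     = b * (t + 2 * real n + 1) / (2 * (real n + 1)^3 * y^3) *
       (((real n+1)^3 * (2*t+n+1) * (t-1) * (t+2*real n+1) * t\<^sup>2 + n * (real n+1)\<^sup>2 * (2*t+n) * (t-n-1) * y^3)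
        - (t^5 * (t-1) * (t+2*real n+1) * (t+2*real n+2) - y^4 * (t-n-1)\<^sup>2 * (t+n)\<^sup>2))"
  proof -
    have c: "t + (real n + 1) / 2 = (2*t+n+1) / 2" "t + real n / 2 = (2*t+n) / 2" by auto
    have collect: "X1 / 2 * (b * w * T\<^sup>2 * t2 / y^3) + k / m * (X2 / 2 * b * (d * T))
        - (b * (t5 * w * T\<^sup>2 * e / y^3) / (2 * m^3) - b * (y * d2 * g2 * T) / (2 * m^3))
      = b * T / (2 * m^3 * y^3) * ((m^3 * X1 * w * T * t2 + k * m\<^sup>2 * X2 * d * y^3) - (t5 * w * T * e - y^4 * d2 * g2))"
      if "m \<noteq> 0" "y \<noteq> 0" for X1 b w T t2 y k m X2 d t5 e d2 g2 :: real
      using that by (simp add: divide_simps) (simp add: algebra_simps power_numeral_reduce)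
    show ?thesis unfolding s w a0 a1 c by (rule collect) (use n1 y in auto)
  qed
  also have "\<dots> = 0" unfolding base_identity[OF y_def] by simp
  finally show ?thesis by simp
qed

subsection \<open>Decay of the summands\<close>

lemma prod_list_map_upt: "(\<Prod>i\<leftarrow>[a..<b]. f i) = (\<Prod>i\<in>{a..<b}. f i)"
  using prod.distinct_set_conv_list[of "[a..<b]" f] by simp

lemma decay_prod_list_quotient':
  fixes as bs :: "(real \<Rightarrow> real) list" and f :: "real \<Rightarrow> real \<Rightarrow> real"
  assumes "compact I"
    and "\<And>a. a \<in> set as \<Longrightarrow> continuous_on I a"
    and "\<And>b. b \<in> set bs \<Longrightarrow> continuous_on I b" "\<And>b e. b \<in> set bs \<Longrightarrow> e \<in> I \<Longrightarrow> b e \<ge> 0"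
    and "length bs = length as + d"
    and "\<And>e t. e \<in> I \<Longrightarrow> t > 1/2 \<Longrightarrow> f e t = (\<Prod>a\<leftarrow>as. t + a e) / (\<Prod>b\<leftarrow>bs. t + b e)"
  shows "decay I d f"
proof (rule decay_cong)
  have "decay I (length bs - length as) (\<lambda>e t. (\<Prod>a\<leftarrow>as. t + a e) / (\<Prod>b\<leftarrow>bs. t + b e))"
    by (rule decay_prod_list_quotient) (fact assms | simp add: assms(5))+
  then show "decay I d (\<lambda>e t. (\<Prod>a\<leftarrow>as. t + a e) / (\<Prod>b\<leftarrow>bs. t + b e))"
    by (simp add: assms(5))
qed (simp add: assms(6))

text \<open>\<open>quot\<close> has 2n numerator and 2n + 2 denominator factors, hence the 2 in the
  length condition. The hypothesis \<open>e \<ge> n\<close> keeps the offsets \<open>e - k\<close>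
  nonnegative, away from poles.\<close>

lemma decay_quot_aux:
  assumes I: "compact I" "\<And>e. e \<in> I \<Longrightarrow> e \<ge> real n"
    and as: "\<And>a. a \<in> set as \<Longrightarrow> continuous_on I a"
    and bs: "\<And>b. b \<in> set bs \<Longrightarrow> continuous_on I b" "\<And>b e. b \<in> set bs \<Longrightarrow> e \<in> I \<Longrightarrow> b e \<ge> 0"
    and "length bs + 2 = length as + d"
  shows "decay I d (\<lambda>e t. quot n e t * (\<Prod>a\<leftarrow>as. t + a e) / (\<Prod>b\<leftarrow>bs. t + b e))"
proof (rule decay_prod_list_quotient'[where
    as = "as @ map (\<lambda>l e. - real l) [1..<n+1] @ map (\<lambda>l e. e + real l) [1..<n+1]" and
    bs = "bs @ map (\<lambda>k e. real k) [0..<n+1] @ map (\<lambda>k e. e - real k) [0..<n+1]"])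
  fix e t assume "e \<in> I" "t > (1/2::real)"
  have s: "{1..n} = {1..<n+1}" "{0..n} = {0..<n+1}" by auto
  show "quot n e t * (\<Prod>a\<leftarrow>as. t + a e) / (\<Prod>b\<leftarrow>bs. t + b e) =
    (\<Prod>a\<leftarrow>as @ map (\<lambda>l e. - real l) [1..<n+1] @ map (\<lambda>l e. e + real l) [1..<n+1]. t + a e) /
    (\<Prod>b\<leftarrow>bs @ map (\<lambda>k e. real k) [0..<n+1] @ map (\<lambda>k e. e - real k) [0..<n+1]. t + b e)"
    unfolding quot_def s prod.distrib prod_list_map_upt[symmetric]
    by (simp add: o_def add_diff_eq add.assoc[symmetric] del: upt_Suc) (simp only: mult_ac)
next
  fix b e assume b: "b \<in> set (bs @ map (\<lambda>k e. real k) [0..<n+1] @ map (\<lambda>k e. e - real k) [0..<n+1])" and e: "e \<in> I"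
  have "real k \<le> e" if "k < Suc n" for k using I(2)[OF e] that by linarith
  with b bs(2)[OF _ e] show "b e \<ge> 0" by (auto simp del: upt_Suc)
next
  fix a assume "a \<in> set (as @ map (\<lambda>l e. - real l) [1..<n+1] @ map (\<lambda>l e. e + real l) [1..<n+1])"
  then consider "a \<in> set as" | l where "a = (\<lambda>e. - real l)" | l where "a = (\<lambda>e. e + real l)" by auto
  then show "continuous_on I a" using as by cases (simp_all add: continuous_on_add)
next
  fix b assume "b \<in> set (bs @ map (\<lambda>k e. real k) [0..<n+1] @ map (\<lambda>k e. e - real k) [0..<n+1])"
  then consider "b \<in> set bs" | k where "b = (\<lambda>e. real k)" | k where "b = (\<lambda>e. e - real k)" by auto
  then show "continuous_on I b" using bs(1) by cases (simp_all add: continuous_on_diff)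
next
  show "compact I" by fact
  show "length (bs @ map (\<lambda>k e. real k) [0..<n+1] @ map (\<lambda>k e. e - real k) [0..<n+1])
    = length (as @ map (\<lambda>l e. - real l) [1..<n+1] @ map (\<lambda>l e. e + real l) [1..<n+1]) + d"
    using assms(6) by simp
qed

lemma decay_quot:
  assumes "compact I" "\<And>e. e \<in> I \<Longrightarrow> e \<ge> real n"
  shows "decay I 2 (quot n)"
  using decay_quot_aux[of I n "[]" "[]" 2] assms by simp

lemma decay_quot_square:
  assumes "compact I" "\<And>e. e \<in> I \<Longrightarrow> e \<ge> real n"
  shows "decay I 3 (quot_square n)"
proof -
  have "continuous_on I (\<lambda>e. e / 2)" by (intro continuous_intros) auto
  then have "decay I (1 + 2) (\<lambda>e t. (quot n e t * (t + e / 2)) * quot n e t)"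
    using decay_quot_aux[of I n "[\<lambda>e. e / 2]" "[]" 1] assms
    by (intro decay_mult decay_quot) auto
  then have "decay I 3 (\<lambda>e t. (quot n e t * (t + e / 2)) * quot n e t)" by (simp add: numeral_3_eq_3)
  then show ?thesis by (rule decay_cong) (auto simp: quot_square_def power2_eq_square)
qed

text \<open>These functions carry no real parameter; the set \<open>{0}\<close> is a dummy.\<close>

lemma decay_quad_prod_aux:
  assumes "length as + 2 * length ls + d = 4 * (n + 1)"
  shows "decay {0} d (\<lambda>_ t. (\<Prod>a\<leftarrow>as. t + a) * (\<Prod>l\<leftarrow>ls. (t - real l) * (t + real n + real l)) / (\<Prod>k=0..n. t + real k) ^ 4)"
proof (rule decay_prod_list_quotient'[where
    as = "map (\<lambda>a _. a) as @ map (\<lambda>l e. - real l) ls @ map (\<lambda>l e. real n + real l) ls" and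
    bs = "concat (replicate 4 (map (\<lambda>k e. real k) [0..<n+1]))"])
  fix e t :: real
  have s: "{0..n} = {0..<n+1}" by auto
  have "(\<Prod>l\<leftarrow>ls. (t - real l) * (t + real n + real l)) = (\<Prod>l\<leftarrow>ls. t + - real l) * (\<Prod>l\<leftarrow>ls. t + (real n + real l))"
    by (induction ls) (auto simp: mult_ac add_ac)
  then show "(\<Prod>a\<leftarrow>as. t + a) * (\<Prod>l\<leftarrow>ls. (t - real l) * (t + real n + real l)) / (\<Prod>k=0..n. t + real k) ^ 4 =
    (\<Prod>a\<leftarrow>map (\<lambda>a _. a) as @ map (\<lambda>l e. - real l) ls @ map (\<lambda>l e. real n + real l) ls. t + a e) /
    (\<Prod>b\<leftarrow>concat (replicate 4 (map (\<lambda>k e. real k) [0..<n+1])). t + b e)"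
    unfolding s by (simp add: o_def prod_list_map_upt eval_nat_numeral mult_ac del: upt_Suc)
qed (use assms in \<open>auto simp: eval_nat_numeral simp del: upt_Suc\<close>)

text \<open>The number of numerator factors does not depend on \<open>N\<close>: it is 1 + 2N + 2(2n
  - N) = 4n + 1, against 4n + 4 in the denominator.\<close>

lemma decay_well_poised:
  assumes "n \<le> N" "N \<le> 2 * n"
  shows "decay {0} 3 (\<lambda>_. well_poised n N)"
proof -
  have "decay {0} 3 (\<lambda>_ t. (\<Prod>a\<leftarrow>[real n / 2]. t + a) * (\<Prod>l\<leftarrow>[1..<N+1] @ [N-n+1..<n+1]. (t - real l) * (t + real n + real l))
     / (\<Prod>k=0..n. t + real k) ^ 4)"
    using assms by (intro decay_quad_prod_aux) (simp del: upt_Suc)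
  moreover have "{N-n<..n} = {N-n+1..<n+1}" "{1..N} = {1..<N+1}" by auto
  ultimately show ?thesis
    by (simp add: well_poised_def[abs_def] prod_list_map_upt mult_ac del: upt_Suc)
qed

lemma decay_well_poised_anti:
  assumes "n + 1 \<le> N" "N + 1 \<le> 2 * n"
  shows "decay {0} 0 (\<lambda>_. well_poised_anti n N)"
proof -
  have "decay {0} 0 (\<lambda>_ t. (\<Prod>a\<leftarrow>[real n, real n, real n, real n, real n, - real n - 1, - real N, real N + 1]. t + a) *
     (\<Prod>l\<leftarrow>[1..<N] @ [N-n+2..<n+1]. (t - real l) * (t + real n + real l)) / (\<Prod>k=0..n. t + real k) ^ 4)"
    using assms by (intro decay_quad_prod_aux) (simp del: upt_Suc)
  from decay_mult[OF decay_coeff[of "{0}" "\<lambda>_. - (real n * (2 * real N + 1))"] this]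
  have "decay {0} 0 (\<lambda>_ t. - (real n * (2 * real N + 1)) * ((\<Prod>a\<leftarrow>[real n, real n, real n, real n, real n, - real n - 1, - real N, real N + 1]. t + a) *
     (\<Prod>l\<leftarrow>[1..<N] @ [N-n+2..<n+1]. (t - real l) * (t + real n + real l)) / (\<Prod>k=0..n. t + real k) ^ 4))"
    by simp
  moreover have "{N-n+1<..n} = {N-n+2..<n+1}" "{1..N-1} = {1..<N}" using assms by auto
  ultimately show ?thesis
  proof (elim decay_cong)
    fix t :: real
    assume s: "{N-n+1<..n} = {N-n+2..<n+1}" "{1..N-1} = {1..<N}"
    have c: "(\<Prod>a\<leftarrow>[real n, real n, real n, real n, real n, - real n - 1, - real N, real N + 1]. t + a)
      = (t + real n)^5 * (t - real n - 1) * (t - real N) * (t + real N + 1)"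
    proof -
      have m: "t + (- real n - 1) = t - real n - 1" by simp
      show ?thesis unfolding list.map prod_list.Cons prod_list.Nil m by (simp add: eval_nat_numeral add.assoc)
    qed
    show "- (real n * (2 * real N + 1)) * ((\<Prod>a\<leftarrow>[real n, real n, real n, real n, real n, - real n - 1, - real N, real N + 1]. t + a) *
     (\<Prod>l\<leftarrow>[1..<N] @ [N-n+2..<n+1]. (t - real l) * (t + real n + real l)) / (\<Prod>k=0..n. t + real k) ^ 4) = well_poised_anti n N t"
      unfolding well_poised_anti_def s prod_list_map_upt[symmetric] c map_append prod_list.append
      by (simp only: times_divide_eq_left times_divide_eq_right mult_ac)
  qed
qed

lemma decay_base_anti:
  assumes "n \<ge> 1"
  shows "decay {0} 0 (\<lambda>_. base_anti n)"
proof -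
  have "decay {0} 0 (\<lambda>_ t. (\<Prod>a\<leftarrow>[real n + 1, - real n - 1, - real n - 1, real n, real n, 2 * real n + 1]. t + a) *
     (\<Prod>l\<leftarrow>[1..<n+1] @ [2..<n+1]. (t - real l) * (t + real n + real l)) / (\<Prod>k=0..n. t + real k) ^ 4)"
    using assms by (intro decay_quad_prod_aux) (simp del: upt_Suc)
  from decay_mult[OF decay_coeff[of "{0}" "\<lambda>_. 1 / (2 * (real n + 1)^3)"] this]
  have "decay {0} 0 (\<lambda>_ t. 1 / (2 * (real n + 1)^3) * ((\<Prod>a\<leftarrow>[real n + 1, - real n - 1, - real n - 1, real n, real n, 2 * real n + 1]. t + a) *
     (\<Prod>l\<leftarrow>[1..<n+1] @ [2..<n+1]. (t - real l) * (t + real n + real l)) / (\<Prod>k=0..n. t + real k) ^ 4))"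
    by simp
  moreover have "{1<..n} = {2..<n+1}" "{0<..n} = {1..<n+1}" by auto
  ultimately show ?thesis
  proof (elim decay_cong)
    fix t :: real
    assume s: "{1<..n} = {2..<n+1}" "{0<..n} = {1..<n+1}"
    have c: "(\<Prod>a\<leftarrow>[real n + 1, - real n - 1, - real n - 1, real n, real n, 2 * real n + 1]. t + a)
      = (t + real n + 1) * (t - real n - 1)\<^sup>2 * (t + real n)\<^sup>2 * (t + 2 * real n + 1)"
    proof -
      have m: "t + (- real n - 1) = t - real n - 1" by simp
      show ?thesis unfolding list.map prod_list.Cons prod_list.Nil m power2_eq_square by (simp add: add.assoc)
    qed
    show "1 / (2 * (real n + 1)^3) * ((\<Prod>a\<leftarrow>[real n + 1, - real n - 1, - real n - 1, real n, real n, 2 * real n + 1]. t + a) *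
     (\<Prod>l\<leftarrow>[1..<n+1] @ [2..<n+1]. (t - real l) * (t + real n + real l)) / (\<Prod>k=0..n. t + real k) ^ 4) = base_anti n t"
      unfolding base_anti_def s prod_list_map_upt[symmetric] c map_append prod_list.append
      by (simp only: times_divide_eq_left times_divide_eq_right divide_divide_eq_left mult_1_left mult_ac)
  qed
qed

text \<open>As a polynomial in \<open>z\<close> alone the certificate loses its terms of degree 6
  and 5. The remaining degree 4 is exactly what keeps \<open>quot_square_anti\<close>
  bounded.\<close>

lemma quot_square_cert_poly:
  fixes n N z a :: real
  assumes "a = n * (n + 1)"
  shows "quot_square_cert N z ((z - n - 1) * (z + n)) =
    (- 2 * a - N - 1) * z^4 + (4 * a + 2 * (N+1) * (1 - 2 * a) - 2 * (N+1)\<^sup>2) * z^3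
    + (2 * a\<^sup>2 + 4 * a * (N+1) + (N+1)\<^sup>2 * (1 - 2 * a)) * z\<^sup>2
    + (2 * (N+1) * a\<^sup>2 + 2 * a * (N+1)\<^sup>2) * z + a\<^sup>2 * (N+1)\<^sup>2"
proof -
  have p: "(z - n - 1) * (z + n) = z\<^sup>2 - z - a"
    unfolding assms by (simp add: algebra_simps power2_eq_square)
  show ?thesis unfolding quot_square_cert_def p by (simp add: algebra_simps power_numeral_reduce)
qed

lemma decay_quot_square_anti:
  assumes N: "N \<ge> real n + 1"
  shows "decay {N} 0 (quot_square_anti n)"
proof -
  define X where "X e t = quot n e t * ((t - real n - 1) * (t + real n)) / ((t + e - real n - 1) * (t + e + real n))" for e t
  \<comment> \<open>\<open>X\<close> is of order \<open>t^(-2)\<close>. Writing a power of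
    \<open>t + e\<close> up to the fourth as a product of two powers of exponent at most 2 keeps
    each half bounded.\<close>
  have X: "decay {N} (2 - j) (\<lambda>e t. X e t * (t + e) ^ j)" if "j \<le> 2" for j
  proof -
    have "decay {N} (2 - j) (\<lambda>e t. quot n e t * (\<Prod>a\<leftarrow>[\<lambda>_. - real n - 1, \<lambda>_. real n] @ replicate j (\<lambda>e. e). t + a e)
       / (\<Prod>b\<leftarrow>[\<lambda>e. e - real n - 1, \<lambda>e. e + real n]. t + b e))"
      using N that by (intro decay_quot_aux) (auto intro!: continuous_intros)
    then show ?thesis
      by (rule decay_cong) (simp add: X_def add_diff_eq add.assoc[symmetric])
  qed
  have X0: "decay {N} 0 (\<lambda>e t. X e t * (t + e) ^ j)" if "j \<le> 2" for j
    using decay_weaken[OF X[OF that]] by simp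
  have XX: "decay {N} 0 (\<lambda>e t. c * (X e t * (t + e) ^ i * (X e t * (t + e) ^ j)))" if "i \<le> 2" "j \<le> 2" for i j c
    using decay_mult[OF decay_coeff[of "{N}" "\<lambda>_. c"] decay_mult[OF X0[OF that(1)] X0[OF that(2)]]] by simp
  define a where "a = real n * (real n + 1)"
  define k4 k3 k2 k1 k0 where "k4 = - 2 * a - N - 1" and "k3 = 4 * a + 2 * (N+1) * (1 - 2 * a) - 2 * (N+1)\<^sup>2"
    and "k2 = 2 * a\<^sup>2 + 4 * a * (N+1) + (N+1)\<^sup>2 * (1 - 2 * a)" and "k1 = 2 * (N+1) * a\<^sup>2 + 2 * a * (N+1)\<^sup>2"
    and "k0 = a\<^sup>2 * (N+1)\<^sup>2"
  have "decay {N} 0 (\<lambda>e t. k4 / 2 * (X e t * (t + e) ^ 2 * (X e t * (t + e) ^ 2))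
     + k3 / 2 * (X e t * (t + e) ^ 1 * (X e t * (t + e) ^ 2))
     + k2 / 2 * (X e t * (t + e) ^ 1 * (X e t * (t + e) ^ 1))
     + k1 / 2 * (X e t * (t + e) ^ 0 * (X e t * (t + e) ^ 1))
     + k0 / 2 * (X e t * (t + e) ^ 0 * (X e t * (t + e) ^ 0)))"
    by (rule decay_add[OF decay_add[OF decay_add[OF decay_add[OF XX[of 2 2 "k4 / 2"] XX[of 1 2 "k3 / 2"]]
          XX[of 1 1 "k2 / 2"]] XX[of 0 1 "k1 / 2"]] XX[of 0 0 "k0 / 2"]]) simp_all
  then show ?thesis
  proof (rule decay_cong)
    fix e t assume "e \<in> {N}"
    then have e: "e = N" by simp
    have collect: "k4 / 2 * (x * z ^ 2 * (x * z ^ 2)) + k3 / 2 * (x * z ^ 1 * (x * z ^ 2)) + k2 / 2 * (x * z ^ 1 * (x * z ^ 1))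
     + k1 / 2 * (x * z ^ 0 * (x * z ^ 1)) + k0 / 2 * (x * z ^ 0 * (x * z ^ 0))
     = x\<^sup>2 * (k4 * z^4 + k3 * z^3 + k2 * z\<^sup>2 + k1 * z + k0) / 2" for x z
      by (simp add: field_simps power_numeral_reduce)
    have "quot_square_anti n e t = (X e t)\<^sup>2 * quot_square_cert N (t + e) ((t + e - real n - 1) * (t + e + real n)) / 2"
      by (simp add: quot_square_anti_def X_def e)
    also have "quot_square_cert N (t + e) ((t + e - real n - 1) * (t + e + real n))
      = k4 * (t + e)^4 + k3 * (t + e)^3 + k2 * (t + e)\<^sup>2 + k1 * (t + e) + k0"
      unfolding quot_square_cert_poly[OF a_def] k4_def k3_def k2_def k1_def k0_def by simp
    finally show "k4 / 2 * (X e t * (t + e) ^ 2 * (X e t * (t + e) ^ 2))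
     + k3 / 2 * (X e t * (t + e) ^ 1 * (X e t * (t + e) ^ 2))
     + k2 / 2 * (X e t * (t + e) ^ 1 * (X e t * (t + e) ^ 1))
     + k1 / 2 * (X e t * (t + e) ^ 0 * (X e t * (t + e) ^ 1))
     + k0 / 2 * (X e t * (t + e) ^ 0 * (X e t * (t + e) ^ 0)) = quot_square_anti n e t"
      unfolding collect by simp
  qed
qed

subsection \<open>Equality of the two sums\<close>

lemma DERIV_double_zero:
  fixes G v :: "real \<Rightarrow> real"
  assumes "\<And>t. G t = (t - s) * v t" "isCont v s" "v s = 0"
  shows "deriv G s = 0"
proof -
  have "(G has_real_derivative 0) (at s)"
    unfolding CARAT_DERIV by (rule exI[of _ v]) (use assms in auto)
  then show ?thesis by (rule DERIV_imp_deriv)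
qed

lemma isCont_quot:
  assumes "t > 0" "\<eta> \<ge> real n"
  shows "isCont (quot n \<eta>) t"
proof -
  have "(\<Prod>k=0..n. (t + real k) * (t + \<eta> - real k)) \<noteq> 0"
    using assms by (auto simp: prod_zero_iff)
  then show ?thesis unfolding quot_def[abs_def] by (intro continuous_intros) auto
qed

lemma quot_zero:
  assumes "1 \<le> i" "i \<le> n"
  shows "quot n \<eta> (real i) = 0"
  using assms unfolding quot_def by (auto simp: prod_zero_iff)

lemma deriv_quot_square_zero:
  assumes "1 \<le> i" "i \<le> n" "\<eta> \<ge> real n"
  shows "deriv (quot_square n \<eta>) (real i) = 0"
proof -
  define v where "v t = (\<Prod>l\<in>{1..n} - {i}. (t - real l)) * (\<Prod>l=1..n. t + \<eta> + real l) / (\<Prod>k=0..n. (t + real k) * (t + \<eta> - real k))" for t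
  have v: "quot n \<eta> t = (t - real i) * v t" for t
  proof -
    have "(\<Prod>l=1..n. (t - real l)) = (t - real i) * (\<Prod>l\<in>{1..n} - {i}. (t - real l))"
      using assms by (intro prod.remove) auto
    then show ?thesis by (simp add: quot_def v_def prod.distrib)
  qed
  have nz: "(\<Prod>k=0..n. (real i + real k) * (real i + \<eta> - real k)) \<noteq> 0"
    using assms by (auto simp: prod_zero_iff)
  show ?thesis
  proof (rule DERIV_double_zero[where v = "\<lambda>t. (t + \<eta> / 2) * v t * quot n \<eta> t"])
    show "quot_square n \<eta> t = (t - real i) * ((t + \<eta> / 2) * v t * quot n \<eta> t)" for t
      by (simp add: quot_square_def power2_eq_square v)
    have "isCont v (real i)" unfolding v_def[abs_def] using nz by (intro continuous_intros) auto
    then show "isCont (\<lambda>t. (t + \<eta> / 2) * v t * quot n \<eta> t) (real i)"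
      using assms by (intro continuous_intros isCont_quot) auto
    show "(real i + \<eta> / 2) * v (real i) * quot n \<eta> (real i) = 0" using quot_zero[of i n] assms by simp
  qed
qed

text \<open>The index i lies in both product ranges and so gives a double zero. For positive
  \<open>i \<le> N - n = n - m\<close> the zero is only simple, which matches the start
  \<open>n - m + 1\<close> of the series of \<open>R\<close>.\<close>

lemma deriv_well_poised_zero:
  assumes i: "N - n < i" "i \<le> n" and N: "n \<le> N" 
  shows "deriv (well_poised n N) (real i) = 0"
proof -
  define f where "f l t = (t - real l) * (t + real n + real l)" for l t
  define v where "v t = (t + real n / 2) * (t + real n + real i) * (\<Prod>l\<in>{1..N} - {i}. f l t) * (\<Prod>l\<in>{N-n<..n}. f l t) / (\<Prod>k=0..n. t + real k) ^ 4" for t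
  show ?thesis
  proof (rule DERIV_double_zero[where v = v])
    fix t
    have "(\<Prod>l=1..N. f l t) = f i t * (\<Prod>l\<in>{1..N} - {i}. f l t)"
      using i N by (intro prod.remove) auto
    then show "well_poised n N t = (t - real i) * v t"
      unfolding well_poised_def v_def f_def[symmetric] by (simp add: f_def[of i] mult_ac)
  next
    have "(\<Prod>k=0..n. real i + real k) \<noteq> 0" using i by (auto simp: prod_zero_iff)
    then show "isCont v (real i)" unfolding v_def[abs_def] f_def by (intro continuous_intros) auto
    show "v (real i) = 0" using i unfolding v_def f_def by (auto simp: prod_zero_iff)
  qed
qed

text \<open>One zero at \<open>n + 1\<close> is explicit in the certificate; the other is the factor
  \<open>t - N\<close> if \<open>N = n + 1\<close>, and the product factor with
  \<open>l = n + 1\<close> otherwise.\<close>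

lemma deriv_well_poised_anti_zero:
  assumes N: "n + 1 \<le> N"
  shows "deriv (well_poised_anti n N) (real n + 1) = 0"
proof -
  define f where "f l t = (t - real l) * (t + real n + real l)" for l t
  define v where "v t = - (real n * (2 * real N + 1)) *
     ((\<Prod>l=1..N-1. f l t) * (\<Prod>l\<in>{N-n+1<..n}. f l t) / (\<Prod>k=0..n. t + real k) ^ 4)
      * ((t + real n)^5 * (t - real N) * (t + real N + 1))" for t
  show ?thesis
  proof (rule DERIV_double_zero[where v = v])
    show "well_poised_anti n N t = (t - (real n + 1)) * v t" for t
    proof -
      have "t - real n - 1 = t - (real n + 1)" by simp
      then show ?thesis unfolding well_poised_anti_def v_def f_def[symmetric]
        by (simp only: times_divide_eq_left times_divide_eq_right mult_ac)
    qed
    have "(\<Prod>k=0..n. real n + 1 + real k) \<noteq> 0" by (auto simp: prod_zero_iff add_nonneg_eq_0_iff)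
    then show "isCont v (real n + 1)" unfolding v_def[abs_def] f_def by (intro continuous_intros) auto
    show "v (real n + 1) = 0"
    proof (cases "N = n + 1")
      case False
      then have "(\<Prod>l=1..N-1. f l (real n + 1)) = 0"
        using N by (intro prod_zero bexI[of _ "n + 1"]) (auto simp: f_def)
      then show ?thesis by (simp add: v_def)
    qed (simp add: v_def)
  qed
qed

lemma deriv_base_anti_zero: "deriv (base_anti n) (real n + 1) = 0"
proof -
  define f where "f l t = (t - real l) * (t + real n + real l)" for l t
  define v where "v t = (\<Prod>l\<in>{0<..n}. f l t) * (\<Prod>l\<in>{1<..n}. f l t)
     / (\<Prod>k=0..n. t + real k) ^ 4
     * ((t + real n + 1) * (t - (real n + 1)) * (t + real n)\<^sup>2 * (t + 2 * real n + 1)) / (2 * (real n + 1)^3)" for t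
  show ?thesis
  proof (rule DERIV_double_zero[where v = v])
    show "base_anti n t = (t - (real n + 1)) * v t" for t
    proof -
      have "t - real n - 1 = t - (real n + 1)" by simp
      then show ?thesis unfolding base_anti_def v_def f_def[symmetric] power2_eq_square
        by (simp only: times_divide_eq_left times_divide_eq_right mult_ac)
    qed
    have "(\<Prod>k=0..n. real n + 1 + real k) \<noteq> 0" "real n + 1 \<noteq> 0" by (auto simp: prod_zero_iff add_nonneg_eq_0_iff)
    then show "isCont v (real n + 1)" unfolding v_def[abs_def] f_def by (intro continuous_intros) auto
    show "v (real n + 1) = 0" by (simp add: v_def)
  qed
qed

lemma deriv_quot_square_anti_zero:
  assumes "N \<ge> real n + 1"
  shows "deriv (quot_square_anti n N) (real n + 1) = 0"
proof (rule DERIV_double_zero)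
  let ?v = "\<lambda>t. (t - (real n + 1)) * ((quot n N t * (t + real n) / ((t + N - real n - 1) * (t + N + real n)))\<^sup>2
     * quot_square_cert N (t + N) ((t + N - real n - 1) * (t + N + real n)) / 2)"
  show "quot_square_anti n N t = (t - (real n + 1)) * ?v t" for t
  proof -
    have "t - real n - 1 = t - (real n + 1)" by simp
    then show ?thesis unfolding quot_square_anti_def power2_eq_square
      by (simp only: times_divide_eq_left times_divide_eq_right mult_ac)
  qed
  show "isCont ?v (real n + 1)" unfolding quot_square_cert_def
    using assms by (intro continuous_intros isCont_quot) auto
qed simp

section \<open>Recurrences for the sums\<close>

lemma decay_has_deriv:
  assumes "decay I d f" "e \<in> I" "t > 1/2"
  shows "(f e has_real_derivative deriv (f e) t) (at t)"
  using assms by (metis decay_imp_deriv decay_dataD(1))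

text \<open>The common engine for both recurrences and for the initial case
  \<open>N = n + 1\<close>. The critical point of \<open>G\<close> at \<open>s\<close> removes the
  boundary term, so the resulting relations are homogeneous. The singletons are separate because the
  three functions may belong to different parameter values.\<close>

lemma decay_telescope_combination:
  fixes f g h G :: "real \<Rightarrow> real"
  assumes "decay {x} 1 (\<lambda>_. f)" "decay {y} 1 (\<lambda>_. g)" "decay {z} 1 (\<lambda>_. h)" "decay {w} 0 (\<lambda>_. G)"
    and tel: "\<And>t. t > 1/2 \<Longrightarrow> a * f t + b * g t + c * h t = G (t + 1) - G t"
    and s: "s > 1/2" and "deriv G s = 0"
  shows "a * (\<Sum>k. deriv f (s + real k)) + b * (\<Sum>k. deriv g (s + real k)) + c * (\<Sum>k. deriv h (s + real k)) = 0"
proof -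
  have "(\<lambda>k. deriv (\<lambda>t. a * f t + b * g t + c * h t) (s + real k)) sums (- deriv G s)"
    using assms(4) tel s by (intro decay_telescope_sums[where a = "1/2"]) auto
  moreover have "deriv (\<lambda>t. a * f t + b * g t + c * h t) t = a * deriv f t + b * deriv g t + c * deriv h t" if "t > 1/2" for t
    by (rule DERIV_imp_deriv, intro DERIV_add DERIV_cmult
        decay_has_deriv[OF assms(1), of x] decay_has_deriv[OF assms(2), of y] decay_has_deriv[OF assms(3), of z])
       (use that in auto)
  ultimately have "(\<lambda>k. a * deriv f (s + real k) + b * deriv g (s + real k) + c * deriv h (s + real k)) sums 0"
    using s assms(7) by simp
  moreover have "(\<lambda>k. a * deriv f (s + real k) + b * deriv g (s + real k) + c * deriv h (s + real k)) sums
     (a * (\<Sum>k. deriv f (s + real k)) + b * (\<Sum>k. deriv g (s + real k)) + c * (\<Sum>k. deriv h (s + real k)))"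
    using suminf_deriv_continuous(2)[OF assms(1) _ s] suminf_deriv_continuous(2)[OF assms(2) _ s]
      suminf_deriv_continuous(2)[OF assms(3) _ s]
    by (intro sums_add sums_mult summable_sums) auto
  ultimately show ?thesis using sums_unique2 by blast
qed

text \<open>Both sums may start at \<open>n + 1\<close>, because the summands have double zeros at the earlier integers of interest.\<close>

definition quot_square_sum :: "nat \<Rightarrow> real \<Rightarrow> real" where
  "quot_square_sum n \<eta> = (\<Sum>k. deriv (quot_square n \<eta>) (real n + 1 + real k))"

definition well_poised_sum :: "nat \<Rightarrow> nat \<Rightarrow> real" where
  "well_poised_sum n N = (\<Sum>k. deriv (well_poised n N) (real n + 1 + real k))"

lemma decay_quot_square_single: "\<eta> \<ge> real n \<Longrightarrow> decay {\<eta>} 1 (\<lambda>_. quot_square n \<eta>)"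
  by (rule decay_cong[OF decay_weaken[OF decay_quot_square[of "{\<eta>}" n]]]) auto

lemma decay_well_poised_single: "n \<le> N \<Longrightarrow> N \<le> 2 * n \<Longrightarrow> decay {0} 1 (\<lambda>_. well_poised n N)"
  using decay_weaken[OF decay_well_poised] by simp

lemma quot_square_sum_recurrence:
  assumes "N \<ge> real n + 1"
  shows "- ((N + 1)^5) * quot_square_sum n (N + 1) + rec_mid n N * quot_square_sum n N
     + N^3 * ((2 * real n + 1)\<^sup>2 - N\<^sup>2) * quot_square_sum n (N - 1) = 0"
  unfolding quot_square_sum_def
proof (rule decay_telescope_combination)
  show "decay {N} 0 (\<lambda>_. quot_square_anti n N)"
    using decay_quot_square_anti[OF assms] by (rule decay_cong) simp
  show "decay {N + 1} 1 (\<lambda>_. quot_square n (N + 1))" "decay {N} 1 (\<lambda>_. quot_square n N)" "decay {N - 1} 1 (\<lambda>_. quot_square n (N - 1))"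
    by (rule decay_quot_square_single; use assms in simp)+
  show "- ((N + 1)^5) * quot_square n (N + 1) t + rec_mid n N * quot_square n N t
     + N^3 * ((2 * real n + 1)\<^sup>2 - N\<^sup>2) * quot_square n (N - 1) t = quot_square_anti n N (t + 1) - quot_square_anti n N t"
    if "t > 1/2" for t
    using that by (intro quot_square_recurrence assms) simp
qed (use deriv_quot_square_anti_zero[OF assms] in simp_all)

lemma well_poised_sum_recurrence:
  assumes N: "n + 1 \<le> N" "N + 1 \<le> 2 * n"
  shows "(real N + 1)^4 * (2 * real n - real N) * well_poised_sum n (N + 1) + rec_mid n N * well_poised_sum n N
      + (- (real N^4 * (2 * real n + 1 + real N))) * well_poised_sum n (N - 1) = 0"
  unfolding well_poised_sum_def
proof (rule decay_telescope_combination)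
  show "decay {0} 0 (\<lambda>_. well_poised_anti n N)" by (rule decay_well_poised_anti[OF N])
  show "decay {0} 1 (\<lambda>_. well_poised n (N + 1))" "decay {0} 1 (\<lambda>_. well_poised n N)" "decay {0} 1 (\<lambda>_. well_poised n (N - 1))"
    by (rule decay_well_poised_single; use N in simp)+
  show "(real N + 1)^4 * (2 * real n - real N) * well_poised n (N + 1) t + rec_mid n N * well_poised n N t
      + (- (real N^4 * (2 * real n + 1 + real N))) * well_poised n (N - 1) t = well_poised_anti n N (t + 1) - well_poised_anti n N t"
    if "t > 1/2" for t
    using well_poised_recurrence[OF _ N, of t] that by simp
qed (use deriv_well_poised_anti_zero[OF N(1)] in simp_all)

lemma quot_square_sum_base:
  assumes "n \<ge> 1"
  shows "quot_square_sum n (real n + 1) = - (real n / (real n + 1)) * well_poised_sum n (n + 1)"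
proof -
  have "1 * quot_square_sum n (real n + 1) + real n / (real n + 1) * well_poised_sum n (n + 1) + 0 * well_poised_sum n (n + 1) = 0"
    unfolding quot_square_sum_def well_poised_sum_def
  proof (rule decay_telescope_combination)
    show "decay {0} 0 (\<lambda>_. base_anti n)" by (rule decay_base_anti[OF assms])
    show "decay {real n + 1} 1 (\<lambda>_. quot_square n (real n + 1))" by (rule decay_quot_square_single) simp
    show "decay {0} 1 (\<lambda>_. well_poised n (n + 1))" "decay {0} 1 (\<lambda>_. well_poised n (n + 1))"
      by (rule decay_well_poised_single; use assms in simp)+
    show "1 * quot_square n (real n + 1) t + real n / (real n + 1) * well_poised n (n + 1) t + 0 * well_poised n (n + 1) t
      = base_anti n (t + 1) - base_anti n t" if "t > 1/2" for t
      using base_telescope[of t n] assms that by simp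
  qed (simp_all add: deriv_base_anti_zero)
  then show ?thesis by simp
qed

text \<open>Up to the sign \<open>(-1)^n\<close> this is the constant relating \<open>R n m\<close>
  to \<open>well_poised n N\<close> for \<open>N = 2 * n - m\<close>; it equals 1 at
  \<open>N = n\<close>.\<close>

definition well_poised_coeff :: "nat \<Rightarrow> nat \<Rightarrow> real" where
  "well_poised_coeff n N = (-1) ^ (n + N) * (fact n)\<^sup>2 / (fact (2 * n - N) * fact N)"

lemma well_poised_coeff_Suc:
  assumes "N < 2 * n"
  shows "well_poised_coeff n (N + 1) = - well_poised_coeff n N * ((2 * real n - real N) / (real N + 1))"
proof -
  obtain j where j: "2 * n - N = Suc j" using assms by (metis Suc_diff_Suc)
  then have "2 * n - (N + 1) = j" "2 * real n - real N = real j + 1" by (simp, linarith)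
  moreover have "(fact (Suc j) :: real) = (real j + 1) * fact j" "(fact (Suc N) :: real) = (real N + 1) * fact N"
    by (simp_all add: algebra_simps)
  ultimately show ?thesis
    unfolding well_poised_coeff_def j by (simp del: fact_Suc add: divide_simps) 
qed

text \<open>The recurrence of \<open>quot_square_sum\<close> can be solved for its top term, since
  \<open>(N + 1)^5\<close> never vanishes. The ratio of consecutive values of
  \<open>well_poised_coeff\<close> converts it into the recurrence of
  \<open>well_poised_sum\<close>.\<close>

lemma quot_square_sum_eq_well_poised_sum:
  assumes "n \<le> N" "N \<le> 2 * n"
  shows "quot_square_sum n (real N) = well_poised_coeff n N * well_poised_sum n N"
  using assms
proof (induction N rule: less_induct)
  case (less N)
  consider "N = n" | "N = n + 1" | "n + 2 \<le> N" using less.prems by linarith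
  then show ?case
  proof cases
    case 1
    have "well_poised n n = quot_square n (real n)" by (rule ext) (rule well_poised_eq_quot_square)
    then show ?thesis using 1 by (simp add: quot_square_sum_def well_poised_sum_def well_poised_coeff_def power2_eq_square flip: mult_2)
  next
    case 2
    then have n: "n \<ge> 1" using less.prems by simp
    have "well_poised_coeff n n = 1" by (simp add: well_poised_coeff_def power2_eq_square flip: mult_2)
    then have "well_poised_coeff n (n + 1) = - (real n / (real n + 1))"
      using well_poised_coeff_Suc[of n n] n by simp
    then show ?thesis using quot_square_sum_base[OF n] 2 by (simp add: add.commute)
  next
    case 3
    define K where "K = N - 1"
    have K: "N = K + 1" "n + 1 \<le> K" "K + 1 \<le> 2 * n" using 3 less.prems by (auto simp: K_def)
    have rK: "real (K - 1) = real K - 1" using K by (simp add: of_nat_diff)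
    define c where "c = well_poised_coeff n (K - 1)"
    have c0: "well_poised_coeff n K = - c * ((2 * real n - real K + 1) / real K)"
      using well_poised_coeff_Suc[of "K - 1" n] K rK by (simp add: c_def)
    have c1: "well_poised_coeff n (K + 1) = - well_poised_coeff n K * ((2 * real n - real K) / (real K + 1))"
      using K by (intro well_poised_coeff_Suc) simp
    have Kpos: "real K > 0" using K by simp
    have IH: "quot_square_sum n (real K) = well_poised_coeff n K * well_poised_sum n K"
      by (rule less.IH) (use K in auto)
    have "quot_square_sum n (real (K - 1)) = well_poised_coeff n (K - 1) * well_poised_sum n (K - 1)"
      by (rule less.IH) (use K in auto)
    then have IH': "quot_square_sum n (real K - 1) = c * well_poised_sum n (K - 1)" unfolding rK c_def .
    have "(real K + 1)^5 * quot_square_sum n (real K + 1) = rec_mid n K * quot_square_sum n (real K)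
       + real K^3 * ((2 * real n + 1)\<^sup>2 - real K^2) * quot_square_sum n (real K - 1)"
      using quot_square_sum_recurrence[of n "real K"] K by simp
    also have "\<dots> = well_poised_coeff n K * (rec_mid n K * well_poised_sum n K - real K^4 * (2 * real n + 1 + real K) * well_poised_sum n (K - 1))"
    proof -
      \<comment> \<open>The difference of squares splits into \<open>2 * n + 1 - K\<close> and
        \<open>2 * n + 1 + K\<close>; the first factor is absorbed by the step from \<open>c\<close>
        to \<open>well_poised_coeff n K\<close>.\<close>
      have "real K^3 * ((2 * real n + 1)\<^sup>2 - real K^2) * c = - well_poised_coeff n K * (real K^4 * (2 * real n + 1 + real K))"
        unfolding c0 using Kpos by (simp add: field_simps power_numeral_reduce)
      then have e: "real K^3 * ((2 * real n + 1)\<^sup>2 - real K^2) * (c * well_poised_sum n (K - 1))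
         = - well_poised_coeff n K * (real K^4 * (2 * real n + 1 + real K)) * well_poised_sum n (K - 1)"
        by (simp only: mult.assoc[symmetric])
      have collect: "r * (x * W) + - x * Y * V = x * (r * W - Y * V)" for r x W Y V :: real
        by (simp add: algebra_simps)
      show ?thesis unfolding IH IH' e by (rule collect)
    qed
    also have "\<dots> = - well_poised_coeff n K * ((real K + 1)^4 * (2 * real n - real K) * well_poised_sum n (K + 1))"
    proof -
      have "rec_mid n K * well_poised_sum n K - real K^4 * (2 * real n + 1 + real K) * well_poised_sum n (K - 1)
        = - ((real K + 1)^4 * (2 * real n - real K) * well_poised_sum n (K + 1))"
        using well_poised_sum_recurrence[OF K(2,3)] unfolding mult_minus_left by linarith
      then show ?thesis by simp
    qed
    also have "\<dots> = (real K + 1)^5 * (well_poised_coeff n (K + 1) * well_poised_sum n (K + 1))"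
      unfolding c1 using Kpos by (simp add: power_numeral_reduce)
    finally have "quot_square_sum n (real K + 1) = well_poised_coeff n (K + 1) * well_poised_sum n (K + 1)"
      using Kpos by simp
    then show ?thesis unfolding K by (simp add: add.commute)
  qed
qed

subsection \<open>Partial fractions with separated poles\<close>

lemma lagrange_interpolation:
  fixes x :: "'i \<Rightarrow> 'a::field" and p :: "'a poly"
  assumes S: "finite S" "inj_on x S" and deg: "degree p < card S"
  shows "p = (\<Sum>k\<in>S. smult (poly p (x k) / (\<Prod>l\<in>S-{k}. x k - x l)) (\<Prod>l\<in>S-{k}. [:- x l, 1:]))" (is "p = ?L")
proof (rule poly_eqI_degree[where A = "x ` S"])
  have card: "card (x ` S) = card S" using S by (simp add: card_image)
  show "degree p < card (x ` S)" using deg card by simp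
  have "degree (smult c (\<Prod>l\<in>S-{k}. [:- x l, 1:])) \<le> card S - 1" if "k \<in> S" for k c
  proof -
    have "degree (\<Prod>l\<in>S-{k}. [:- x l, 1:]) \<le> (\<Sum>l\<in>S-{k}. degree [:- x l, 1:])"
      using degree_prod_sum_le[of "S-{k}" "\<lambda>l. [:- x l, 1:]"] S(1) by (simp add: o_def)
    also have "\<dots> = card S - 1" using that S(1) by simp
    finally show ?thesis by (rule order_trans[OF degree_smult_le])
  qed
  then have "degree ?L \<le> card S - 1" using S(1) by (intro degree_sum_le)
  then show "degree ?L < card (x ` S)" using deg card by simp
  fix z assume "z \<in> x ` S"
  then obtain i where i: "i \<in> S" "z = x i" by auto
  have nz: "(\<Prod>l\<in>S-{i}. x i - x l) \<noteq> 0"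
    using S i(1) by (auto simp: prod_zero_iff inj_on_def)
  have "poly ?L z = (\<Sum>k\<in>S. (poly p (x k) / (\<Prod>l\<in>S-{k}. x k - x l)) * (\<Prod>l\<in>S-{k}. x i - x l))"
    by (simp add: poly_sum poly_prod i(2))
  also have "\<dots> = (\<Sum>k\<in>S. if k = i then poly p (x i) else 0)"
    using S i nz by (intro sum.cong) (auto simp: prod_zero_iff)
  also have "\<dots> = poly p z" using S i by simp
  finally show "poly p z = poly ?L z" ..
qed

text \<open>Compare the top coefficients in Lagrange's formula: every basis product is monic of
  degree \<open>card S - 1\<close>.\<close>

lemma divided_difference:
  fixes x :: "'i \<Rightarrow> 'a::field" and p :: "'a poly"
  assumes S: "finite S" "inj_on x S" and deg: "degree p < card S"
  shows "(\<Sum>k\<in>S. poly p (x k) / (\<Prod>l\<in>S-{k}. x k - x l)) = coeff p (card S - 1)"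
proof -
  have lead: "coeff (\<Prod>l\<in>S-{k}. [:- x l, 1:]) (card S - 1) = 1" if "k \<in> S" for k
  proof -
    have "degree (\<Prod>l\<in>S-{k}. [:- x l, 1:]) = (\<Sum>l\<in>S-{k}. degree [:- x l, 1:])"
      by (rule degree_prod_eq_sum_degree) auto
    also have "\<dots> = card S - 1" using that S(1) by simp
    finally have "coeff (\<Prod>l\<in>S-{k}. [:- x l, 1:]) (card S - 1) = lead_coeff (\<Prod>l\<in>S-{k}. [:- x l, 1:])" by simp
    then show ?thesis by (simp add: lead_coeff_prod)
  qed
  have "coeff p (card S - 1) = (\<Sum>k\<in>S. (poly p (x k) / (\<Prod>l\<in>S-{k}. x k - x l)) * coeff (\<Prod>l\<in>S-{k}. [:- x l, 1:]) (card S - 1))"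
    by (subst lagrange_interpolation[OF S deg]) (simp add: coeff_sum)
  then show ?thesis using lead by simp
qed

lemma poly_pochhammer: "poly (pochhammer [:a, 1:] k) t = pochhammer (a + t) k" for a t :: real
  by (induction k) (simp_all add: pochhammer_Suc of_nat_poly algebra_simps)

lemma degree_pochhammer_le: "degree (pochhammer [:a, 1:] k) \<le> k" for a :: real
proof (induction k)
  case (Suc k)
  have "degree (pochhammer [:a, 1:] k * ([:a, 1:] + of_nat k)) \<le> k + 1"
    by (rule order_trans[OF degree_mult_le add_mono[OF Suc]]) (simp add: of_nat_poly)
  then show ?case by (simp add: pochhammer_Suc)
qed simp

lemma pochhammer_shift_1: "pochhammer (t + 1) k * t = pochhammer t k * (t + real k)" for t :: real
  using pochhammer_rec[of t k] pochhammer_rec'[of t k] by (simp add: mult.commute)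

lemma pochhammer_split:
  fixes x :: real
  assumes "k \<le> n"
  shows "pochhammer (x - real n) n = pochhammer (x - real n) (n - k) * pochhammer (x - real k) k"
proof -
  have "x - real n + real (n - k) = x - real k" "n - (n - k) = k" using assms by (auto simp: of_nat_diff)
  then show ?thesis using pochhammer_product[of "n - k" n "x - real n"] by simp
qed

text \<open>In the variable \<open>x = t * (t + \<eta>)\<close>, the poles of \<open>quot n \<eta>\<close> are the values \<open>node k\<close> and its zeros the values \<open>root l\<close>.
  For integral \<open>\<eta>\<close> some nodes coincide, which is why \<open>\<eta>\<close> is kept real.\<close>

locale separated_nodes =
  fixes n :: nat and \<eta> :: real
  assumes eta: "\<eta> \<ge> real n"
    and separated: "\<And>k l. k \<le> n \<Longrightarrow> l \<le> n \<Longrightarrow> k \<noteq> l \<Longrightarrow> real k + real l \<noteq> \<eta>"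
begin

definition node :: "nat \<Rightarrow> real" where "node k = - real k * (\<eta> - real k)"
definition root :: "nat \<Rightarrow> real" where "root i = real i * (\<eta> + real i)"
definition w :: "nat \<Rightarrow> real \<Rightarrow> real" where "w k t = (t + real k) * (t + \<eta> - real k)"
text \<open>The constant in front normalizes \<open>v k\<close> to 1 at \<open>t = 1\<close>, so
  that all ratios of these functions agree at the first summation point.\<close>

definition v :: "nat \<Rightarrow> real \<Rightarrow> real" where
  "v k t = (pochhammer (1 + \<eta> - real k) k / fact k) * (pochhammer t k / pochhammer (t + \<eta> - real k) k)"
definition den :: "nat \<Rightarrow> real" where "den k = (\<Prod>l\<in>{..n}-{k}. node k - node l)"
definition roots_poly :: "nat \<Rightarrow> real poly" where "roots_poly i = (\<Prod>l=1..i. [:- root l, 1:])"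
definition nodes_poly :: "nat \<Rightarrow> real poly" where "nodes_poly a = (\<Prod>p<a. [:- node p, 1:])"
definition A :: "nat \<Rightarrow> real" where "A k = poly (roots_poly n) (node k) / den k"

lemma w_node: "w k t = t * (t + \<eta>) - node k"
  by (simp add: w_def node_def algebra_simps)

lemma w_root: "w k (real l) = root l - node k"
  by (simp add: w_node root_def algebra_simps)

lemma w_pos: "t > 0 \<Longrightarrow> k \<le> n \<Longrightarrow> w k t > 0"
  using eta by (auto simp: w_def intro!: mult_pos_pos)

lemma node_diff: "node k - node l = (real l - real k) * (\<eta> - real k - real l)"
  by (simp add: node_def algebra_simps)

lemma inj_node: "inj_on node {..n}"
proof (rule inj_onI)
  fix k l assume kl: "k \<in> {..n}" "l \<in> {..n}" "node k = node l"
  then have "(real l - real k) * (\<eta> - real k - real l) = 0" using node_diff[of k l] by simp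
  moreover have "\<eta> - real k - real l \<noteq> 0" if "k \<noteq> l" using separated[of k l] kl that by auto
  ultimately show "k = l" by auto
qed

lemma v_1: "k \<le> n \<Longrightarrow> v k 1 = 1"
proof -
  assume "k \<le> n"
  then have "pochhammer (1 + \<eta> - real k) k > 0" using eta by (intro pochhammer_pos) simp
  then show ?thesis by (simp add: v_def flip: pochhammer_fact)
qed

lemma v_pos: "t > 0 \<Longrightarrow> k \<le> n \<Longrightarrow> v k t > 0"
  unfolding v_def using eta by (intro mult_pos_pos divide_pos_pos pochhammer_pos) auto

lemma v_shift:
  assumes "t > 0" "k \<le> n"
  shows "v k (t + 1) * w 0 t = v k t * w k t"
proof -
  have p: "pochhammer (t + \<eta> - real k) k > 0" "pochhammer (t + 1 + \<eta> - real k) k > 0"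
    using assms eta by (auto intro!: pochhammer_pos)
  have q: "t + \<eta> > 0" "t + \<eta> - real k > 0" using assms eta by auto
  have "pochhammer (t + 1) k * t = pochhammer t k * (t + real k)" by (rule pochhammer_shift_1)
  then have a: "pochhammer (t + 1) k = pochhammer t k * (t + real k) / t" using assms by (simp add: eq_divide_eq)
  have "pochhammer (t + 1 + \<eta> - real k) k * (t + \<eta> - real k) = pochhammer (t + \<eta> - real k) k * (t + \<eta>)"
    using pochhammer_shift_1[of "t + \<eta> - real k" k] by (simp add: algebra_simps)
  then have b: "pochhammer (t + 1 + \<eta> - real k) k = pochhammer (t + \<eta> - real k) k * (t + \<eta>) / (t + \<eta> - real k)"
    using q by (simp add: eq_divide_eq)
  have "pochhammer (t + 1) k / pochhammer (t + 1 + \<eta> - real k) k * (t * (t + \<eta>))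
      = pochhammer t k / pochhammer (t + \<eta> - real k) k * ((t + real k) * (t + \<eta> - real k))"
    unfolding a b using p q assms by simp
  then have "pochhammer (1 + \<eta> - real k) k / fact k * (pochhammer (t + 1) k / pochhammer (t + 1 + \<eta> - real k) k * (t * (t + \<eta>)))
      = pochhammer (1 + \<eta> - real k) k / fact k * (pochhammer t k / pochhammer (t + \<eta> - real k) k * ((t + real k) * (t + \<eta> - real k)))"
    by (rule arg_cong)
  then show ?thesis unfolding v_def w_def by (simp only: mult.assoc of_nat_0 add_0_right diff_zero)
qed

text \<open>Iterating \<open>v_shift\<close> from 1 turns the value at a positive integer into a
  polynomial in \<open>node k\<close>, because \<open>w k\<close> at an integer is a root minus a
  node. This is what makes sums over k at integer arguments accessible as divided
  differences.\<close>

lemma v_nat: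
  assumes "k \<le> n"
  shows "v k (real i + 1) = (-1) ^ i * poly (roots_poly i) (node k) / (\<Prod>l=1..i. w 0 (real l))"
proof (induction i)
  case 0
  then show ?case using v_1[OF assms] by (simp add: roots_poly_def)
next
  case (Suc i)
  have "w 0 (real (Suc i)) > 0" by (intro w_pos) auto
  then have "v k (real (Suc i) + 1) = v k (real i + 1) * w k (real (Suc i)) / w 0 (real (Suc i))"
    using v_shift[of "real (Suc i)" k] assms by (simp add: eq_divide_eq add.commute)
  then show ?case unfolding Suc w_root[of k] by (simp add: roots_poly_def poly_prod algebra_simps)
qed

lemma degree_roots_poly: "degree (roots_poly i) = i" "lead_coeff (roots_poly i) = 1"
proof -
  show "lead_coeff (roots_poly i) = 1" unfolding roots_poly_def lead_coeff_prod by simp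
qed (simp add: roots_poly_def degree_prod_eq_sum_degree)

lemma degree_nodes_poly: "degree (nodes_poly i) = i" "lead_coeff (nodes_poly i) = 1"
proof -
  show "lead_coeff (nodes_poly i) = 1" unfolding nodes_poly_def lead_coeff_prod by simp
qed (simp add: nodes_poly_def degree_prod_eq_sum_degree)

lemma node_sum:
  assumes "degree p \<le> n"
  shows "(\<Sum>k\<le>n. poly p (node k) / den k) = coeff p n"
  using divided_difference[of "{..n}" node p] inj_node assms by (simp add: den_def)

lemma quot_partial_fractions:
  assumes "t > 0"
  shows "quot n \<eta> t = (\<Sum>k\<le>n. A k / w k t)"
proof -
  define X where "X = t * (t + \<eta>)"
  have W: "(\<Prod>k\<le>n. w k t) > 0" using w_pos[OF assms] by (intro prod_pos) auto
  have "roots_poly n = (\<Sum>k\<le>n. smult (A k) (\<Prod>l\<in>{..n}-{k}. [:- node l, 1:]))"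
    using lagrange_interpolation[of "{..n}" node "roots_poly n"] inj_node
    by (simp add: degree_roots_poly A_def den_def)
  then have "poly (roots_poly n) X = poly (\<Sum>k\<le>n. smult (A k) (\<Prod>l\<in>{..n}-{k}. [:- node l, 1:])) X" by (rule arg_cong)
  also have "\<dots> = (\<Sum>k\<le>n. A k * (\<Prod>l\<in>{..n}-{k}. w l t))"
    by (simp add: poly_sum poly_prod w_node X_def)
  also have "\<dots> = (\<Sum>k\<le>n. A k / w k t) * (\<Prod>k\<le>n. w k t)"
    unfolding sum_distrib_right
  proof (rule sum.cong)
    fix k assume k: "k \<in> {..n}"
    have "(\<Prod>k\<le>n. w k t) = w k t * (\<Prod>l\<in>{..n}-{k}. w l t)" using k by (intro prod.remove) auto
    then show "A k * (\<Prod>l\<in>{..n}-{k}. w l t) = A k / w k t * (\<Prod>k\<le>n. w k t)"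
      using w_pos[OF assms, of k] k by simp
  qed simp
  finally have e: "poly (roots_poly n) X = (\<Sum>k\<le>n. A k / w k t) * (\<Prod>k\<le>n. w k t)" .
  have W': "(\<Prod>k\<le>n. w k t) \<noteq> 0" using W by linarith
  have "(\<Sum>k\<le>n. A k / w k t) = poly (roots_poly n) X / (\<Prod>k\<le>n. w k t)"
    unfolding nonzero_eq_divide_eq[OF W'] using e by (rule sym)
  also have "poly (roots_poly n) X = (\<Prod>l=1..n. (t - real l) * (t + \<eta> + real l))"
    unfolding roots_poly_def poly_prod by (intro prod.cong) (auto simp: X_def root_def algebra_simps)
  also have "(\<Prod>k\<le>n. w k t) = (\<Prod>k=0..n. (t + real k) * (t + \<eta> - real k))"
    by (simp add: w_def atMost_atLeast0)
  finally show ?thesis by (simp add: quot_def)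
qed

text \<open>Both sides are polynomials of degree at most \<open>n\<close>; at \<open>t = 0, \<dots>, n\<close> the left-hand side is a divided difference of a monic
  polynomial of degree \<open>n - t\<close>, hence vanishes unless \<open>t = 0\<close>.\<close>

lemma sum_A_v_inverse_poly:
  "(\<Sum>k\<le>n. A k * (fact k / pochhammer (1 + \<eta> - real k) k) * (pochhammer (t + 1 + \<eta> - real k) k * pochhammer (t + 1 + real k) (n - k)))
    = (-1) ^ n * pochhammer (t - real n) n" 
proof -
  define F where "F = (\<Sum>k\<le>n. smult (A k * (fact k / pochhammer (1 + \<eta> - real k) k))
     (pochhammer [:1 + \<eta> - real k, 1:] k * pochhammer [:1 + real k, 1:] (n - k)))"
  define H where "H = smult ((-1) ^ n) (pochhammer [:- real n, 1:] n)"
  have Ft: "poly F t = (\<Sum>k\<le>n. A k * (fact k / pochhammer (1 + \<eta> - real k) k) * (pochhammer (t + 1 + \<eta> - real k) k * pochhammer (t + 1 + real k) (n - k)))" for t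
    by (simp add: F_def poly_sum poly_pochhammer algebra_simps)
  have Ht: "poly H t = (-1) ^ n * pochhammer (t - real n) n" for t
    by (simp add: H_def poly_pochhammer algebra_simps)
  have "F = H"
  proof (rule poly_eqI_degree[where A = "real ` {..n}"])
    have c: "card (real ` {..n}) = n + 1" by (simp add: card_image)
    have d: "degree (smult c (pochhammer [:1 + \<eta> - real k, 1:] k * pochhammer [:1 + real k, 1:] (n - k))) \<le> n" if "k \<le> n" for c k
      using degree_pochhammer_le[of "1 + \<eta> - real k" k] degree_pochhammer_le[of "1 + real k" "n - k"] that
      by (intro order_trans[OF degree_smult_le] order_trans[OF degree_mult_le]) linarith
    have "degree F \<le> n" unfolding F_def by (rule degree_sum_le) (simp, rule d, simp)
    then show "degree F < card (real ` {..n})" by (simp add: c)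
    have "degree H \<le> n" unfolding H_def by (rule order_trans[OF degree_smult_le degree_pochhammer_le])
    then show "degree H < card (real ` {..n})" by (simp add: c)
    fix s assume "s \<in> real ` {..n}"
    then obtain i where i: "i \<le> n" "s = real i" by auto
    define W0 where "W0 = (\<Prod>l=1..i. w 0 (real l))"
    have W0: "W0 > 0" unfolding W0_def by (intro prod_pos) (auto intro!: w_pos)
    \<comment> \<open>\<open>A k\<close> contains all n root factors at \<open>node k\<close> and
      \<open>v k (i + 1)\<close> the first i of them; their quotient leaves
      \<open>R\<close>.\<close>
    define R where "R = (\<Prod>l\<in>{i<..n}. [:- root l, 1:])"
    have R: "degree R = n - i" by (simp add: R_def degree_prod_eq_sum_degree)
    have R1: "lead_coeff R = 1" unfolding R_def lead_coeff_prod by simp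
    have split: "roots_poly n = roots_poly i * R"
    proof -
      have u: "{1..n} = {1..i} \<union> {i<..n}" using i by auto
      show ?thesis unfolding roots_poly_def R_def u by (rule prod.union_disjoint) auto
    qed
    have trm: "A k * (fact k / pochhammer (1 + \<eta> - real k) k) * (pochhammer (s + 1 + \<eta> - real k) k * pochhammer (s + 1 + real k) (n - k))
       = (-1) ^ i * pochhammer (s + 1) n * W0 * (poly R (node k) / den k)" if k: "k \<le> n" for k
    proof -
      have vp: "v k (s + 1) > 0" using k i by (intro v_pos) auto
      have pp: "pochhammer (1 + \<eta> - real k) k > 0" "pochhammer (s + 1 + \<eta> - real k) k > 0" "pochhammer (s + 1) k > 0"
        using k eta i by (auto intro!: pochhammer_pos)
      have "pochhammer (s + 1) n = pochhammer (s + 1) k * pochhammer (s + 1 + real k) (n - k)"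
        using k by (simp add: pochhammer_product)
      then have e1: "(fact k / pochhammer (1 + \<eta> - real k) k) * (pochhammer (s + 1 + \<eta> - real k) k * pochhammer (s + 1 + real k) (n - k)) * v k (s + 1)
         = pochhammer (s + 1) n"
        unfolding v_def using pp by simp
      have v: "v k (s + 1) = (-1) ^ i * poly (roots_poly i) (node k) / W0"
        using v_nat[OF k, of i] by (simp add: i W0_def)
      have "A k = (-1) ^ i * W0 * (poly R (node k) / den k) * v k (s + 1)"
        unfolding A_def split v using W0 by (simp add: field_simps flip: power_mult_distrib)
      then have "A k * (fact k / pochhammer (1 + \<eta> - real k) k) * (pochhammer (s + 1 + \<eta> - real k) k * pochhammer (s + 1 + real k) (n - k))
        = (-1) ^ i * W0 * (poly R (node k) / den k) * ((fact k / pochhammer (1 + \<eta> - real k) k) * (pochhammer (s + 1 + \<eta> - real k) k * pochhammer (s + 1 + real k) (n - k)) * v k (s + 1))"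
        by (simp only: mult_ac)
      then show ?thesis unfolding e1 by (simp only: mult_ac)
    qed
    have "poly F s = (-1) ^ i * pochhammer (s + 1) n * W0 * (\<Sum>k\<le>n. poly R (node k) / den k)"
      unfolding Ft sum_distrib_left by (intro sum.cong) (use trm in auto)
    also have "\<dots> = (-1) ^ i * pochhammer (s + 1) n * W0 * coeff R n" using R by (simp add: node_sum)
    also have "\<dots> = poly H s"
    proof (cases "i = 0")
      case True
      then show ?thesis using R R1 pochhammer_same[of n, where 'a = real] by (simp add: i Ht W0_def flip: pochhammer_fact)
    next
      case False
      then have "coeff R n = 0" using R i by (intro coeff_eq_0) simp
      moreover have "pochhammer (s - real n) n = 0"
        unfolding pochhammer_eq_0_iff using i False by (intro exI[of _ "n - i"]) (simp add: of_nat_diff)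
      ultimately show ?thesis by (simp add: Ht)
    qed
    finally show "poly F s = poly H s" .
  qed
  then show ?thesis using Ft[of t] Ht[of t] by simp
qed

lemma sum_A_v_inverse:
  assumes "t > 0"
  shows "(\<Sum>k\<le>n. A k / (v k t * w k t)) = (-1) ^ n * pochhammer (t - real n) n / (pochhammer t (n + 1) * (t + \<eta>))"
proof -
  have q: "pochhammer (t + 1) n > 0" using assms by (intro pochhammer_pos) auto
  have w0: "w 0 t = t * (t + \<eta>)" "w 0 t > 0" using w_pos[OF assms, of 0] by (auto simp: w_def)
  have trm: "A k / (v k t * w k t) = A k * (fact k / pochhammer (1 + \<eta> - real k) k) *
      (pochhammer (t + 1 + \<eta> - real k) k * pochhammer (t + 1 + real k) (n - k)) / (pochhammer (t + 1) n * w 0 t)" if k: "k \<le> n" for k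
  proof -
    have pp: "pochhammer (1 + \<eta> - real k) k > 0" "pochhammer (t + 1 + \<eta> - real k) k > 0" "pochhammer (t + 1) k > 0"
        "pochhammer (t + 1 + real k) (n - k) > 0"
      using k eta assms by (auto intro!: pochhammer_pos)
    have e: "pochhammer (t + 1) n = pochhammer (t + 1) k * pochhammer (t + 1 + real k) (n - k)"
      using k by (simp add: pochhammer_product)
    \<comment> \<open>This accounts for the argument \<open>t + 1\<close> in the polynomial
      identity.\<close>
    have vw: "v k t * w k t = v k (t + 1) * w 0 t" using v_shift[OF assms k] by simp
    show ?thesis unfolding e vw unfolding v_def using pp w0(2) by (simp add: divide_simps)
  qed
  have "(\<Sum>k\<le>n. A k / (v k t * w k t)) = (\<Sum>k\<le>n. A k * (fact k / pochhammer (1 + \<eta> - real k) k) *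
      (pochhammer (t + 1 + \<eta> - real k) k * pochhammer (t + 1 + real k) (n - k))) / (pochhammer (t + 1) n * w 0 t)"
    unfolding sum_divide_distrib by (intro sum.cong) (use trm in auto)
  also have "\<dots> = (-1) ^ n * pochhammer (t - real n) n / (pochhammer (t + 1) n * w 0 t)"
    by (simp only: sum_A_v_inverse_poly)
  also have "pochhammer (t + 1) n * w 0 t = pochhammer t (n + 1) * (t + \<eta>)"
    by (simp add: w0 pochhammer_rec mult_ac)
  finally show ?thesis .
qed

text \<open>Coefficients of \<open>roots_poly m\<close> in the Newton basis
  \<open>nodes_poly\<close>. The expansion is needed because in the sum of
  \<open>A k * v k t\<close> the numerator \<open>roots_poly n\<close> is multiplied at integer t by
  a polynomial of degree \<open>t - 1\<close>, which exceeds the admissible degree n as soon as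
  \<open>t > 1\<close>. The products \<open>nodes_poly a\<close> have smaller degree for
  \<open>a < n\<close>, and they vanish at the first a nodes.\<close>

definition expand_coeff :: "nat \<Rightarrow> nat \<Rightarrow> real" where
  "expand_coeff m a = (if a \<le> m then (-1) ^ (m - a) * (fact m)\<^sup>2 / ((fact a)\<^sup>2 * fact (m - a)) * pochhammer (\<eta> + 1) (m - a) else 0)"

text \<open>This is what \<open>x - root (m + 1) = (x - node a) + (node a - root (m + 1))\<close>
  demands of Newton coefficients when one more root factor is multiplied in.\<close>

lemma expand_coeff_Suc:
  assumes "a \<le> Suc m"
  shows "expand_coeff (Suc m) a = (if a = 0 then 0 else expand_coeff m (a - 1)) + (node a - root (Suc m)) * expand_coeff m a"
proof (cases "a = Suc m")
  case True
  then show ?thesis by (simp add: expand_coeff_def)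
next
  case False
  then obtain b where m: "m = a + b" using assms by (metis le_SucE le_Suc_ex)
  have nr: "node a - root (Suc m) = - ((2 * real a + real b + 1) * (\<eta> + 1 + real b))"
    by (simp add: node_def root_def m algebra_simps)
  have p: "pochhammer (\<eta> + 1) (Suc b) = pochhammer (\<eta> + 1) b * (\<eta> + 1 + real b)" by (simp add: pochhammer_Suc)
  have r: "expand_coeff m a = (-1) ^ b * (fact m)\<^sup>2 / ((fact a)\<^sup>2 * fact b) * pochhammer (\<eta> + 1) b"
    by (simp add: expand_coeff_def m)
  have l: "expand_coeff (Suc m) a = - ((-1) ^ b * ((real m + 1)\<^sup>2 * (fact m)\<^sup>2) / ((fact a)\<^sup>2 * ((real b + 1) * fact b)) * (pochhammer (\<eta> + 1) b * (\<eta> + 1 + real b)))"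
  proof -
    have "Suc m - a = Suc b" "a \<le> Suc m" using m by auto
    then show ?thesis unfolding expand_coeff_def p[symmetric] by (simp add: power_mult_distrib add.commute)
  qed
  have s: "(if a = 0 then 0 else expand_coeff m (a - 1)) = - ((-1) ^ b * (real a)\<^sup>2 * (fact m)\<^sup>2 / ((fact a)\<^sup>2 * ((real b + 1) * fact b)) * (pochhammer (\<eta> + 1) b * (\<eta> + 1 + real b)))"
  proof (cases a)
    case (Suc c)
    have "m - c = Suc b" "c \<le> m" using m Suc by auto
    then have "expand_coeff m c = - ((-1) ^ b * (fact m)\<^sup>2 / ((fact c)\<^sup>2 * fact (Suc b)) * pochhammer (\<eta> + 1) (Suc b))"
      by (simp add: expand_coeff_def)
    then show ?thesis unfolding p by (simp add: Suc power_mult_distrib add.commute)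
  qed simp
  show ?thesis unfolding l s r nr
    by (simp add: divide_simps) (simp add: m algebra_simps power2_eq_square)
qed

lemma roots_poly_expansion: "roots_poly m = (\<Sum>a\<le>m. smult (expand_coeff m a) (nodes_poly a))"
proof (induction m)
  case 0
  then show ?case by (simp add: roots_poly_def nodes_poly_def expand_coeff_def)
next
  case (Suc m)
  have step: "nodes_poly a * [:- root (Suc m), 1:] = nodes_poly (Suc a) + smult (node a - root (Suc m)) (nodes_poly a)" for a
  proof -
    have "[:- root (Suc m), 1:] = [:- node a, 1:] + [:node a - root (Suc m):]" by simp
    then show ?thesis by (simp only: distrib_left nodes_poly_def prod.lessThan_Suc) simp
  qed
  have "roots_poly (Suc m) = roots_poly m * [:- root (Suc m), 1:]" by (simp add: roots_poly_def)
  also have "\<dots> = (\<Sum>a\<le>m. smult (expand_coeff m a) (nodes_poly (Suc a))) + (\<Sum>a\<le>m. smult ((node a - root (Suc m)) * expand_coeff m a) (nodes_poly a))"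
    unfolding Suc sum_distrib_right mult_smult_left step by (simp add: smult_add_right sum.distrib mult.commute)
  also have "(\<Sum>a\<le>m. smult (expand_coeff m a) (nodes_poly (Suc a))) = (\<Sum>a\<le>Suc m. smult (if a = 0 then 0 else expand_coeff m (a - 1)) (nodes_poly a))"
    by (subst sum.atMost_Suc_shift) simp
  also have "(\<Sum>a\<le>m. smult ((node a - root (Suc m)) * expand_coeff m a) (nodes_poly a))
     = (\<Sum>a\<le>Suc m. smult ((node a - root (Suc m)) * expand_coeff m a) (nodes_poly a))"
    by (simp add: expand_coeff_def)
  finally show ?case
    by (simp only: sum.distrib[symmetric] smult_add_left[symmetric]) (intro sum.cong refl, simp add: expand_coeff_Suc)
qed

text \<open>The comparison points are \<open>t = 1 - a, \<dots>, j + 1\<close>: for \<open>t \<le> 0\<close> all terms vanish, for \<open>t \<ge> 1\<close> the sum is a divided difference of a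
  monic polynomial of degree \<open>a + t - 1\<close>.\<close>

lemma sum_nodes_poly_v_poly:
  assumes "a \<le> n"
  defines "j \<equiv> n - a"
  shows "(\<Sum>k\<le>n. poly (nodes_poly a) (node k) / den k * (pochhammer (1 + \<eta> - real k) k / fact k) * (pochhammer t k * pochhammer (t + \<eta> - real n) (n - k)))
    = (-1) ^ j * pochhammer (\<eta> + real j + 1 - real n) n / (fact j * pochhammer (\<eta> + 1) j * fact n) * pochhammer (t - real j) n"
proof -
  define C where "C = (-1) ^ j * pochhammer (\<eta> + real j + 1 - real n) n / (fact j * pochhammer (\<eta> + 1) j * fact n)"
  define F where "F = (\<Sum>k\<le>n. smult (poly (nodes_poly a) (node k) / den k * (pochhammer (1 + \<eta> - real k) k / fact k))
     (pochhammer [:0, 1:] k * pochhammer [:\<eta> - real n, 1:] (n - k)))"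
  define H where "H = smult C (pochhammer [:- real j, 1:] n)"
  have Ft: "poly F t = (\<Sum>k\<le>n. poly (nodes_poly a) (node k) / den k * (pochhammer (1 + \<eta> - real k) k / fact k) * (pochhammer t k * pochhammer (t + \<eta> - real n) (n - k)))" for t
    by (simp add: F_def poly_sum poly_pochhammer algebra_simps)
  have Ht: "poly H t = C * pochhammer (t - real j) n" for t
    by (simp add: H_def poly_pochhammer algebra_simps)
  define Z where "Z = real_of_int ` {1 - int a .. int j + 1}"
  have c: "card Z = n + 1" unfolding Z_def using assms by (subst card_image) (auto simp: inj_on_def)
  have "F = H"
  proof (rule poly_eqI_degree[where A = Z])
    have d: "degree (smult c (pochhammer [:0, 1:] k * pochhammer [:\<eta> - real n, 1:] (n - k))) \<le> n" if "k \<le> n" for c k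
      using degree_pochhammer_le[of 0 k] degree_pochhammer_le[of "\<eta> - real n" "n - k"] that
      by (intro order_trans[OF degree_smult_le] order_trans[OF degree_mult_le]) linarith
    have "degree F \<le> n" unfolding F_def by (rule degree_sum_le) (simp, rule d, simp)
    then show "degree F < card Z" by (simp add: c)
    have "degree H \<le> n" unfolding H_def by (rule order_trans[OF degree_smult_le degree_pochhammer_le])
    then show "degree H < card Z" by (simp add: c)
    fix s assume "s \<in> Z"
    then obtain i where i: "1 - int a \<le> i" "i \<le> int j + 1" "s = of_int i" unfolding Z_def by auto
    show "poly F s = poly H s"
    proof (cases "i \<le> 0")
      case True
      define q where "q = nat (- i)"
      have q: "s = - real q" "q < a" using True i by (auto simp: q_def)
      \<comment> \<open>The nodes with \<open>k < a\<close> are killed by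
        \<open>nodes_poly a\<close>; for \<open>k \<ge> a > q\<close> the Pochhammer symbol of
        \<open>- q\<close> contains the factor zero.\<close>
      have "poly (nodes_poly a) (node k) = 0 \<or> pochhammer s k = 0" for k
      proof (cases "k < a")
        case True
        then show ?thesis by (auto simp: nodes_poly_def poly_prod prod_zero_iff)
      next
        case False
        then show ?thesis using q by (auto simp: pochhammer_of_nat_eq_0_iff)
      qed
      then have "poly F s = 0" unfolding Ft by (intro sum.neutral) auto
      moreover have "pochhammer (s - real j) n = 0"
        unfolding pochhammer_eq_0_iff using q assms by (intro exI[of _ "j + q"]) (auto simp: of_nat_diff)
      ultimately show ?thesis by (simp add: Ht)
    next
      case False
      define q where "q = nat (i - 1)"
      have q: "s = real q + 1" "q \<le> j" using False i by (auto simp: q_def)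
      define W0 where "W0 = (\<Prod>l=1..q. w 0 (real l))"
      have W0: "W0 > 0" unfolding W0_def by (intro prod_pos) (auto intro!: w_pos)
      have trm: "poly (nodes_poly a) (node k) / den k * (pochhammer (1 + \<eta> - real k) k / fact k) * (pochhammer s k * pochhammer (s + \<eta> - real n) (n - k))
         = pochhammer (s + \<eta> - real n) n * (-1) ^ q / W0 * (poly (nodes_poly a * roots_poly q) (node k) / den k)" if k: "k \<le> n" for k
      proof -
        have pp: "pochhammer (s + \<eta> - real k) k > 0" using k eta q by (auto intro!: pochhammer_pos)
        note e = pochhammer_split[OF k, of "s + \<eta>"]
        have "(pochhammer (1 + \<eta> - real k) k / fact k) * (pochhammer s k * pochhammer (s + \<eta> - real n) (n - k)) = v k s * pochhammer (s + \<eta> - real n) n"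
          unfolding e v_def using pp by simp
        also have "v k s = (-1) ^ q * poly (roots_poly q) (node k) / W0"
          using v_nat[OF k, of q] by (simp add: q W0_def)
        finally have "poly (nodes_poly a) (node k) / den k * ((pochhammer (1 + \<eta> - real k) k / fact k) * (pochhammer s k * pochhammer (s + \<eta> - real n) (n - k)))
           = poly (nodes_poly a) (node k) / den k * ((-1) ^ q * poly (roots_poly q) (node k) / W0 * pochhammer (s + \<eta> - real n) n)"
          by (rule arg_cong)
        then show ?thesis unfolding poly_mult divide_inverse by (simp only: mult_ac)
      qed
      have deg: "degree (nodes_poly a * roots_poly q) = a + q"
        using degree_nodes_poly[of a] degree_roots_poly[of q] by (subst degree_mult_eq) auto
      have "poly F s = pochhammer (s + \<eta> - real n) n * (-1) ^ q / W0 * (\<Sum>k\<le>n. poly (nodes_poly a * roots_poly q) (node k) / den k)"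
        unfolding Ft sum_distrib_left by (intro sum.cong) (use trm in auto)
      also have "\<dots> = pochhammer (s + \<eta> - real n) n * (-1) ^ q / W0 * coeff (nodes_poly a * roots_poly q) n"
        using deg q assms by (subst node_sum) auto
      also have "\<dots> = poly H s"
      proof (cases "q = j")
        case True
        then have "coeff (nodes_poly a * roots_poly q) n = lead_coeff (nodes_poly a * roots_poly q)" using deg assms by simp
        also have "\<dots> = 1" unfolding lead_coeff_mult degree_nodes_poly(2) degree_roots_poly(2) by simp
        finally have l: "coeff (nodes_poly a * roots_poly q) n = 1" .
        have e1: "W0 = fact j * pochhammer (\<eta> + 1) j"
          unfolding W0_def True w_def by (induction j) (simp_all add: pochhammer_Suc algebra_simps)
        have e2: "pochhammer (s - real j) n = fact n" using q True by (simp flip: pochhammer_fact)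
        have e3: "s + \<eta> - real n = \<eta> + real j + 1 - real n" using q True by simp
        show ?thesis unfolding l Ht C_def e1 e2 e3 unfolding True by simp
      next
        case False
        then have "coeff (nodes_poly a * roots_poly q) n = 0" using deg q assms by (intro coeff_eq_0) auto
        moreover have "pochhammer (s - real j) n = 0"
          unfolding pochhammer_eq_0_iff using q False assms by (intro exI[of _ "j - q - 1"]) (auto simp: of_nat_diff)
        ultimately show ?thesis by (simp add: Ht)
      qed
      finally show ?thesis .
    qed
  qed
  then show ?thesis using Ft[of t] Ht[of t] by (simp add: C_def)
qed

text \<open>This is \<open>fact n\<close> times the sum in \<open>Rt\<close>, with the binomial
  coefficient involving \<open>N + j\<close> rewritten as a Pochhammer quotient so that it makes
  sense for real \<open>\<eta>\<close>.\<close>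

definition P :: "real \<Rightarrow> real" where
  "P t = (\<Sum>j\<le>n. real (n choose j) ^ 2 * (pochhammer (\<eta> + real j + 1 - real n) n / fact n) * pochhammer (t - real j) n)"

text \<open>The Newton expansion of \<open>roots_poly n\<close> reduces the sum to
  \<open>sum_nodes_poly_v_poly\<close>. With \<open>j = n - a\<close>, the squared binomial
  coefficient arises from \<open>expand_coeff n a\<close> times the constant found there; the
  factors \<open>pochhammer (\<eta> + 1) j\<close> cancel.\<close>

lemma sum_A_v:
  assumes "t > 0"
  shows "(\<Sum>k\<le>n. A k * v k t) = P t / pochhammer (t + \<eta> - real n) n"
proof -
  have pn: "pochhammer (t + \<eta> - real n) n > 0" using assms eta by (intro pochhammer_pos) auto
  have trm: "A k * v k t * pochhammer (t + \<eta> - real n) n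
     = (\<Sum>a\<le>n. expand_coeff n a * (poly (nodes_poly a) (node k) / den k * (pochhammer (1 + \<eta> - real k) k / fact k) * (pochhammer t k * pochhammer (t + \<eta> - real n) (n - k))))"
    if k: "k \<le> n" for k
  proof -
    have pp: "pochhammer (t + \<eta> - real k) k > 0" using k eta assms by (auto intro!: pochhammer_pos)
    note e = pochhammer_split[OF k, of "t + \<eta>"]
    have "v k t * pochhammer (t + \<eta> - real n) n = (pochhammer (1 + \<eta> - real k) k / fact k) * (pochhammer t k * pochhammer (t + \<eta> - real n) (n - k))"
      unfolding e v_def using pp by simp
    moreover have "A k = (\<Sum>a\<le>n. expand_coeff n a * (poly (nodes_poly a) (node k) / den k))"
      unfolding A_def roots_poly_expansion by (simp add: poly_sum sum_divide_distrib)
    ultimately have "A k * (v k t * pochhammer (t + \<eta> - real n) n) = (\<Sum>a\<le>n. expand_coeff n a * (poly (nodes_poly a) (node k) / den k))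
       * ((pochhammer (1 + \<eta> - real k) k / fact k) * (pochhammer t k * pochhammer (t + \<eta> - real n) (n - k)))" by simp
    then show ?thesis by (simp only: sum_distrib_right mult.assoc)
  qed
  have "(\<Sum>k\<le>n. A k * v k t) * pochhammer (t + \<eta> - real n) n
     = (\<Sum>k\<le>n. \<Sum>a\<le>n. expand_coeff n a * (poly (nodes_poly a) (node k) / den k * (pochhammer (1 + \<eta> - real k) k / fact k) * (pochhammer t k * pochhammer (t + \<eta> - real n) (n - k))))"
    unfolding sum_distrib_right by (intro sum.cong) (use trm in auto)
  also have "\<dots> = (\<Sum>a\<le>n. expand_coeff n a * (\<Sum>k\<le>n. poly (nodes_poly a) (node k) / den k * (pochhammer (1 + \<eta> - real k) k / fact k) * (pochhammer t k * pochhammer (t + \<eta> - real n) (n - k))))"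
    unfolding sum_distrib_left by (rule sum.swap)
  also have "\<dots> = (\<Sum>a\<le>n. expand_coeff n a * ((-1) ^ (n - a) * pochhammer (\<eta> + real (n - a) + 1 - real n) n / (fact (n - a) * pochhammer (\<eta> + 1) (n - a) * fact n) * pochhammer (t - real (n - a)) n))"
    by (intro sum.cong refl arg_cong2[where f = times] sum_nodes_poly_v_poly) auto
  also have "\<dots> = (\<Sum>j\<le>n. real (n choose j) ^ 2 * (pochhammer (\<eta> + real j + 1 - real n) n / fact n) * pochhammer (t - real j) n)"
  proof (rule sum.reindex_bij_witness[of _ "\<lambda>j. n - j" "\<lambda>j. n - j"])
    fix a assume "a \<in> {..n}"
    then have a: "a \<le> n" by simp
    have ne: "pochhammer (\<eta> + 1) (n - a) > 0" using eta by (intro pochhammer_pos) simp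
    have b: "real (n choose (n - a)) = fact n / (fact a * fact (n - a))"
      using a by (simp add: binomial_fact mult.commute)
    have sq: "((-1) ^ (n - a)) * ((-1::real) ^ (n - a)) = 1" by (simp flip: power_mult_distrib)
    have "expand_coeff n a * ((-1) ^ (n - a) / (fact (n - a) * pochhammer (\<eta> + 1) (n - a) * fact n)) = real (n choose (n - a)) ^ 2 / fact n"
      unfolding b expand_coeff_def using a ne sq by (simp add: power2_eq_square divide_simps)
    then have "expand_coeff n a * ((-1) ^ (n - a) / (fact (n - a) * pochhammer (\<eta> + 1) (n - a) * fact n)) * (pochhammer (\<eta> + real (n - a) + 1 - real n) n * pochhammer (t - real (n - a)) n)
      = real (n choose (n - a)) ^ 2 / fact n * (pochhammer (\<eta> + real (n - a) + 1 - real n) n * pochhammer (t - real (n - a)) n)" by simp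
    then show "real (n choose (n - a)) ^ 2 * (pochhammer (\<eta> + real (n - a) + 1 - real n) n / fact n) * pochhammer (t - real (n - a)) n
       = expand_coeff n a * ((-1) ^ (n - a) * pochhammer (\<eta> + real (n - a) + 1 - real n) n / (fact (n - a) * pochhammer (\<eta> + 1) (n - a) * fact n) * pochhammer (t - real (n - a)) n)"
      by (simp only: times_divide_eq_left times_divide_eq_right mult_ac)
  qed auto
  finally show ?thesis using pn by (simp add: P_def eq_divide_eq)
qed

end

subsection \<open>The telescoping identity behind the second series\<close>

lemma DERIV_pochhammer:
  fixes t b :: real
  assumes "t + b > 0"
  shows "((\<lambda>t. pochhammer (t + b) k) has_real_derivative pochhammer (t + b) k * (\<Sum>i<k. 1 / (t + b + real i))) (at t)"
proof (induction k)
  case (Suc k)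
  have "t + b + real k > 0" using assms by simp
  then show ?case unfolding pochhammer_Suc sum.lessThan_Suc
    by (auto intro!: derivative_eq_intros Suc simp: field_simps)
qed simp

context separated_nodes
begin

text \<open>The logarithmic derivative of \<open>v k\<close>.\<close>

definition ld :: "nat \<Rightarrow> real \<Rightarrow> real" where
  "ld k t = (\<Sum>i<k. 1 / (t + real i)) - (\<Sum>i<k. 1 / (t + (\<eta> - real k) + real i))"

definition ld' :: "nat \<Rightarrow> real \<Rightarrow> real" where
  "ld' k t = (\<Sum>i<k. - 1 / (t + real i)\<^sup>2) - (\<Sum>i<k. - 1 / (t + (\<eta> - real k) + real i)\<^sup>2)"

lemma DERIV_v:
  assumes "t > 0" "k \<le> n"
  shows "(v k has_real_derivative v k t * ld k t) (at t)"
proof -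
  have pos: "t + (\<eta> - real k) > 0" using assms eta by auto
  then have pp: "pochhammer (t + (\<eta> - real k)) k > 0" by (rule pochhammer_pos)
  have eq: "v k = (\<lambda>t. (pochhammer (1 + \<eta> - real k) k / fact k) * (pochhammer (t + 0) k / pochhammer (t + (\<eta> - real k)) k))"
    by (simp add: v_def[abs_def] add_diff_eq)
  have t: "t + 0 > 0" using assms by simp
  have collect: "C * ((a * x * b - a * (b * y)) / (b * b)) = C * (a / b) * (x - y)" if "b \<noteq> 0" for C a b x y :: real
    using that by (simp add: field_simps)
  have ne: "pochhammer (t + (\<eta> - real k)) k \<noteq> 0" using pp by simp
  show ?thesis unfolding eq ld_def
    using DERIV_cmult[OF DERIV_divide[OF DERIV_pochhammer[OF t, of k] DERIV_pochhammer[OF pos, of k] ne], of "pochhammer (1 + \<eta> - real k) k / fact k"]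
    unfolding collect[OF ne] by simp
qed

lemma DERIV_ld:
  assumes "t > 0" "k \<le> n"
  shows "(ld k has_real_derivative ld' k t) (at t)"
proof -
  have "t + (\<eta> - real k) + real i \<noteq> 0" "t + real i \<noteq> 0" for i using assms eta by auto
  then show ?thesis unfolding ld_def[abs_def] ld'_def
    by (auto intro!: derivative_eq_intros simp: power2_eq_square)
qed

text \<open>The logarithmic derivative of \<open>v_shift\<close>: every \<open>w k\<close>,
  including \<open>w 0\<close>, has derivative \<open>2 * t + \<eta>\<close>.\<close>

lemma ld_shift:
  assumes "t > 0" "k \<le> n"
  shows "ld k (t + 1) = ld k t + (2 * t + \<eta>) * (1 / w k t - 1 / w 0 t)"
proof -
  have tele: "(\<Sum>i<k. 1 / (s + 1 + real i)) = (\<Sum>i<k. 1 / (s + real i)) + 1 / (s + real k) - 1 / s" for s :: real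
    by (induction k) (simp_all add: add_ac)
  have nz: "t + real k \<noteq> 0" "t + \<eta> - real k \<noteq> 0" "t \<noteq> 0" "t + \<eta> \<noteq> 0" using assms eta by auto
  have "ld k (t + 1) = ld k t + (1 / (t + real k) - 1 / t) - (1 / (t + \<eta>) - 1 / (t + \<eta> - real k))"
    using tele[of t] tele[of "t + (\<eta> - real k)"] by (simp add: ld_def algebra_simps)
  also have "\<dots> = ld k t + ((2 * t + \<eta>) / ((t + real k) * (t + \<eta> - real k)) - (2 * t + \<eta>) / (t * (t + \<eta>)))"
    using nz by (simp add: divide_simps) (simp add: algebra_simps)
  finally show ?thesis by (simp add: w_def algebra_simps)
qed

definition u :: "nat \<Rightarrow> nat \<Rightarrow> real \<Rightarrow> real" where "u k l t = v k t / v l t"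

lemma u_1: "k \<le> n \<Longrightarrow> l \<le> n \<Longrightarrow> u k l 1 = 1"
  by (simp add: u_def v_1)

lemma DERIV_u:
  assumes "t > 0" "k \<le> n" "l \<le> n"
  shows "(u k l has_real_derivative u k l t * (ld k t - ld l t)) (at t)"
  unfolding u_def[abs_def]
  by (rule derivative_eq_intros DERIV_v assms refl)+ (use v_pos[OF assms(1,3)] in \<open>auto simp: field_simps\<close>)

lemma u_shift:
  assumes "t > 0" "k \<le> n" "l \<le> n"
  shows "u k l (t + 1) = u k l t * w k t / w l t"
proof -
  have pos: "v l t > 0" "w l t > 0" "w 0 t > 0" using v_pos w_pos assms by auto
  have "v i (t + 1) = v i t * w i t / w 0 t" if "i \<le> n" for i
    using v_shift[OF assms(1) that] pos by (simp add: eq_divide_eq)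
  then show ?thesis using assms pos by (simp add: u_def)
qed

text \<open>For \<open>k = l\<close> the denominator is zero, so \<open>c k k = 0\<close> by the
  convention for division: the diagonal drops out of \<open>anti\<close>, and antisymmetry holds for
  all pairs.\<close>

definition c :: "nat \<Rightarrow> nat \<Rightarrow> real" where "c k l = A k * A l / (node l - node k)"

text \<open>For \<open>k \<noteq> l\<close> the product \<open>A k * v k t * A l / (v l t * w l t)\<close> is the difference \<open>c k l * (u k l (t + 1) - u k l t)\<close>; the extra term
  \<open>- c k l * (ld k t - ld l t)\<close> in \<open>anti\<close> produces the square of \<open>\<Sum>k\<le>n. A k / w k t\<close>, and it leaves only \<open>c k l * (ld k 1 - ld l 1)\<^sup>2\<close> in the derivative at 1.\<close>

definition anti :: "real \<Rightarrow> real" where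
  "anti t = (\<Sum>k\<le>n. \<Sum>l\<le>n. c k l * ((u k l t - 1) * (ld k t - ld l t)))"

definition anti' :: "real \<Rightarrow> real" where
  "anti' t = (\<Sum>k\<le>n. \<Sum>l\<le>n. c k l * (u k l t * (ld k t - ld l t) * (ld k t - ld l t) + (u k l t - 1) * (ld' k t - ld' l t)))"

lemma DERIV_anti: "t > 0 \<Longrightarrow> (anti has_real_derivative anti' t) (at t)"
  unfolding anti_def[abs_def] anti'_def
  by (intro DERIV_sum DERIV_cmult) (auto intro!: derivative_eq_intros DERIV_u DERIV_ld simp: mult_ac)

text \<open>The boundary term vanishes because \<open>c k l = - c l k\<close>.\<close>

lemma anti'_1: "anti' 1 = 0"
proof -
  define B where "B k l = c k l * (ld k 1 - ld l 1)\<^sup>2" for k l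
  have "anti' 1 = (\<Sum>k\<le>n. \<Sum>l\<le>n. B k l)"
    unfolding anti'_def by (intro sum.cong refl) (simp add: u_1 B_def power2_eq_square)
  moreover have "(\<Sum>k\<le>n. \<Sum>l\<le>n. B k l) = - (\<Sum>k\<le>n. \<Sum>l\<le>n. B k l)"
  proof -
    have anti: "B k l = - B l k" for k l
    proof -
      have "c k l = - c l k" unfolding c_def
        by (metis minus_diff_eq minus_divide_right mult.commute)
      then show ?thesis by (simp add: B_def power2_commute)
    qed
    have "(\<Sum>k\<le>n. \<Sum>l\<le>n. B k l) = (\<Sum>l\<le>n. \<Sum>k\<le>n. B k l)" by (rule sum.swap)
    also have "\<dots> = (\<Sum>l\<le>n. \<Sum>k\<le>n. - B l k)" by (intro sum.cong refl anti)
    finally show ?thesis by (simp add: sum_negf)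
  qed
  ultimately show ?thesis by simp
qed

definition bilin :: "real \<Rightarrow> real" where
  "bilin t = (\<Sum>k\<le>n. A k * v k t) * (\<Sum>l\<le>n. A l / (v l t * w l t))"

lemma bilin_deriv:
  assumes t: "t > 0"
  shows "(bilin has_real_derivative anti (t + 1) - anti t - 2 * quot_square n \<eta> t) (at t)"
proof -
  define h where "h k l t = v k t / (v l t * w l t)" for k l t
  \<comment> \<open>The part of the claimed derivative that belongs to the pair k, l. Since
    \<open>2 * t + \<eta>\<close> is twice \<open>t + \<eta> / 2\<close>, partial fractions turn the
    last terms into \<open>2 * quot_square n \<eta> t\<close>.\<close>
  define D where "D k l = c k l * ((u k l (t + 1) - 1) * (ld k (t + 1) - ld l (t + 1))) - c k l * ((u k l t - 1) * (ld k t - ld l t))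
      - (2 * t + \<eta>) * (A k / w k t * (A l / w l t))" for k l
  have bil: "bilin = (\<lambda>t. \<Sum>k\<le>n. \<Sum>l\<le>n. A k * A l * h k l t)"
    by (rule ext, unfold bilin_def sum_product h_def, intro sum.cong refl) simp
  have "((\<lambda>t. A k * A l * h k l t) has_real_derivative D k l) (at t)" if k: "k \<le> n" and l: "l \<le> n" for k l
  proof (cases "k = l")
    case True
    have "w k t > 0" using w_pos[OF t k] .
    then have wd: "((\<lambda>t. A k * A k * (1 / w k t)) has_real_derivative - (A k * A k * (2 * t + \<eta>) / (w k t)\<^sup>2)) (at t)"
    proof -
      have "(w k has_real_derivative 2 * t + \<eta>) (at t)"
        unfolding w_node[abs_def] by (auto intro!: derivative_eq_intros)
      from DERIV_cmult[OF DERIV_inverse'[OF this], of "A k * A k"] show ?thesis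
        using \<open>w k t > 0\<close> by (simp add: divide_inverse power2_eq_square mult_ac)
    qed
    have "D k l = - (A k * A k * (2 * t + \<eta>) / (w k t)\<^sup>2)"
      unfolding D_def True c_def by (simp add: power2_eq_square)
    then have "((\<lambda>t. A k * A k * (1 / w k t)) has_real_derivative D k l) (at t)" using wd by simp
    then show ?thesis
      by (rule has_field_derivative_transform_within_open[where S = "{0<..}"])
         (use t v_pos[OF _ k] True in \<open>auto simp: h_def less_imp_neq[symmetric]\<close>)
  next
    case False
    then have d: "node l - node k \<noteq> 0" using inj_node k l unfolding inj_on_def by auto
    have eq: "A k * A l * h k l s = c k l * (u k l (s + 1) - u k l s)" if s: "s > 0" for s
    proof -
      have collect: "a * (x / (y * z)) = a / d * (x / y * (z + d) / z - x / y)" if "y > 0" "z > 0" "d \<noteq> 0" for a x y z d :: real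
        using that by (simp add: field_simps)
      have "w k s = w l s + (node l - node k)" by (simp add: w_node)
      then show ?thesis unfolding c_def h_def u_shift[OF s k l] unfolding u_def
        using collect[of "v l s" "w l s" "node l - node k" "A k * A l" "v k s"] d w_pos[OF s l] v_pos[OF s l] by simp
    qed
    have sh: "((\<lambda>s. u k l (s + 1)) has_real_derivative u k l (t + 1) * (ld k (t + 1) - ld l (t + 1))) (at t)"
      using DERIV_u[OF add_pos_pos[OF t zero_less_one] k l] by (simp only: DERIV_shift)
    have der: "((\<lambda>s. c k l * (u k l (s + 1) - u k l s)) has_real_derivative
        c k l * (u k l (t + 1) * (ld k (t + 1) - ld l (t + 1)) - u k l t * (ld k t - ld l t))) (at t)"
      by (intro DERIV_cmult DERIV_diff sh DERIV_u t k l)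
    have w: "w k t > 0" "w l t > 0" using w_pos t k l by auto
    \<comment> \<open>The \<open>- 1\<close> next to \<open>u k l\<close> in \<open>anti\<close>
      contributes exactly this difference. It cancels the product of partial fractions in
      \<open>D k l\<close> and leaves the derivative of the telescoped form.\<close>
    have "c k l * (ld k (t + 1) - ld l (t + 1) - (ld k t - ld l t)) = c k l * ((2 * t + \<eta>) * (1 / w k t - 1 / w l t))"
      unfolding ld_shift[OF t k] ld_shift[OF t l] by (simp add: algebra_simps)
    also have "1 / w k t - 1 / w l t = - (node l - node k) / (w k t * w l t)"
      using w by (simp add: w_node field_simps)
    also have "c k l * ((2 * t + \<eta>) * (- (node l - node k) / (w k t * w l t))) = - ((2 * t + \<eta>) * (A k / w k t * (A l / w l t)))"
    proof -
      have collect: "a * b / d * (x * (- d / (y * z))) = - (x * (a / y * (b / z)))" if "d \<noteq> 0" for a b d x y z :: real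
        using that by simp
      show ?thesis unfolding c_def by (rule collect[OF d])
    qed
    finally have "D k l = c k l * (u k l (t + 1) * (ld k (t + 1) - ld l (t + 1)) - u k l t * (ld k t - ld l t))"
      unfolding D_def by (simp add: algebra_simps)
    then have "((\<lambda>s. c k l * (u k l (s + 1) - u k l s)) has_real_derivative D k l) (at t)" using der by simp
    then show ?thesis
      by (rule has_field_derivative_transform_within_open[where S = "{0<..}"]) (use t eq in auto)
  qed
  then have bd: "(bilin has_real_derivative (\<Sum>k\<le>n. \<Sum>l\<le>n. D k l)) (at t)"
    unfolding bil by (intro DERIV_sum) auto
  have "(\<Sum>k\<le>n. \<Sum>l\<le>n. D k l) = anti (t + 1) - anti t - (2 * t + \<eta>) * ((\<Sum>k\<le>n. A k / w k t) * (\<Sum>l\<le>n. A l / w l t))"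
    unfolding D_def anti_def sum_subtractf sum_product by (simp only: sum_distrib_left)
  also have "\<dots> = anti (t + 1) - anti t - 2 * quot_square n \<eta> t"
    unfolding quot_partial_fractions[OF t, symmetric] quot_square_def by (simp add: power2_eq_square)
  finally show ?thesis using bd by (simp only:)
qed

text \<open>Both Pochhammer symbols have k factors with nonnegative offsets, so the function and its
  reciprocal are both bounded.\<close>

lemma decay_v:
  assumes "k \<le> n"
  shows "decay {\<eta>} 0 (\<lambda>_. v k)" "decay {\<eta>} 0 (\<lambda>_ t. 1 / v k t)"
proof -
  define C where "C = pochhammer (1 + \<eta> - real k) k / fact k"
  have "C > 0" unfolding C_def using assms eta by (intro divide_pos_pos pochhammer_pos) auto
  have v: "v k t = C * (\<Prod>i\<in>{0..<k}. (t + real i) / (t + (\<eta> - real k + real i)))" for t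
    by (simp add: v_def C_def pochhammer_prod prod_dividef algebra_simps)
  have v': "1 / v k t = 1 / C * (\<Prod>i\<in>{0..<k}. (t + (\<eta> - real k + real i)) / (t + real i))" for t
    by (simp add: v prod_dividef)
  have nn: "\<eta> - real k + real i \<ge> 0" for i using assms eta by simp
  have p1: "decay {\<eta>} 0 (\<lambda>e t. \<Prod>i\<in>{0..<k}. (t + real i) / (t + (\<eta> - real k + real i)))"
    by (intro decay_prod decay_quotient) (use nn in auto)
  have p2: "decay {\<eta>} 0 (\<lambda>e t. \<Prod>i\<in>{0..<k}. (t + (\<eta> - real k + real i)) / (t + real i))"
    by (intro decay_prod decay_quotient) (use nn in auto)
  have c: "decay {\<eta>} 0 (\<lambda>_ _. x)" for x by (intro decay_coeff) auto
  have "decay {\<eta>} 0 (\<lambda>e t. C * (\<Prod>i\<in>{0..<k}. (t + real i) / (t + (\<eta> - real k + real i))))"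
    using decay_mult[OF c p1, of C] by simp
  then show "decay {\<eta>} 0 (\<lambda>_. v k)" by (rule decay_cong) (simp only: v)
  have "decay {\<eta>} 0 (\<lambda>e t. 1 / C * (\<Prod>i\<in>{0..<k}. (t + (\<eta> - real k + real i)) / (t + real i)))"
    using decay_mult[OF c p2, of "1 / C"] by simp
  then show "decay {\<eta>} 0 (\<lambda>_ t. 1 / v k t)" by (rule decay_cong) (simp only: v')
qed

lemma decay_ld:
  assumes "k \<le> n"
  shows "decay {\<eta>} 1 (\<lambda>_. ld k)"
proof -
  have nn: "\<eta> - real k + real i \<ge> 0" for i using assms eta by simp
  have "decay {\<eta>} 1 (\<lambda>e t. \<Sum>i<k. 1 / (t + real i))"
    by (intro decay_sum decay_inverse) auto
  moreover have "decay {\<eta>} (0 + 1) (\<lambda>e t. (-1) * (\<Sum>i<k. 1 / (t + (\<eta> - real k + real i))))"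
    by (intro decay_mult decay_coeff decay_sum decay_inverse) (use nn in auto)
  ultimately have "decay {\<eta>} 1 (\<lambda>e t. (\<Sum>i<k. 1 / (t + real i)) + (-1) * (\<Sum>i<k. 1 / (t + (\<eta> - real k + real i))))"
    by (intro decay_add) auto
  then show ?thesis by (simp add: ld_def[abs_def] add.assoc)
qed

lemma decay_anti: "decay {\<eta>} 1 (\<lambda>_. anti)"
proof -
  have "decay {\<eta>} 1 (\<lambda>_ t. c k l * ((u k l t - 1) * (ld k t - ld l t)))" if "k \<le> n" "l \<le> n" for k l
  proof -
    have c: "decay {\<eta>} 0 (\<lambda>_ _. x)" for x by (intro decay_coeff) auto
    have "decay {\<eta>} 0 (\<lambda>_ t. v k t * (1 / v l t))"
      using decay_mult[OF decay_v(1)[OF that(1)] decay_v(2)[OF that(2)]] by simp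
    then have 1: "decay {\<eta>} 0 (\<lambda>_ t. v k t * (1 / v l t) + (-1))" by (rule decay_add) (rule c)
    have "decay {\<eta>} 1 (\<lambda>_ t. (-1) * ld l t)"
      using decay_mult[OF c[of "-1"] decay_ld[OF that(2)]] by simp
    with decay_ld[OF that(1)] have 2: "decay {\<eta>} 1 (\<lambda>_ t. ld k t + (-1) * ld l t)" by (rule decay_add)
    have "decay {\<eta>} 1 (\<lambda>_ t. (v k t * (1 / v l t) + (-1)) * (ld k t + (-1) * ld l t))"
      using decay_mult[OF 1 2] by simp
    from decay_mult[OF c[of "c k l"] this]
    have "decay {\<eta>} 1 (\<lambda>_ t. c k l * ((v k t * (1 / v l t) + (-1)) * (ld k t + (-1) * ld l t)))" by simp
    then show ?thesis by (simp add: u_def)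
  qed
  then show ?thesis unfolding anti_def[abs_def] by (intro decay_sum) auto
qed

end

subsection \<open>Passage to integral parameters\<close>

text \<open>Agrees with \<open>Rt n m\<close> at \<open>\<eta> = 2 * n - m\<close>.\<close>

definition Rt_param :: "nat \<Rightarrow> real \<Rightarrow> real \<Rightarrow> real" where
  "Rt_param n \<eta> t = pochhammer (t - real n) n / (pochhammer t (n + 1) * pochhammer (t + \<eta> - real n) (n + 1))
     * (\<Sum>j\<le>n. real (n choose j) ^ 2 * (pochhammer (\<eta> + real j + 1 - real n) n / fact n) * pochhammer (t - real j) n)"

lemma continuous_on_pochhammer: "continuous_on S (\<lambda>e. pochhammer (e + a) k)" for a :: real
  unfolding pochhammer_prod by (intro continuous_intros)

text \<open>Only coefficients continuous in \<open>e\<close> and denominators with nonnegative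
  offsets involve the parameter; each summand has 2n linear factors over 2n + 2.\<close>

lemma decay_Rt_param:
  assumes I: "compact I" "\<And>e. e \<in> I \<Longrightarrow> e \<ge> real n"
  shows "decay I 2 (Rt_param n)"
proof -
  define h where "h j e t = pochhammer (t - real n) n * pochhammer (t - real j) n / (pochhammer t (n + 1) * pochhammer (t + e - real n) (n + 1))" for j e t
  have h: "decay I 2 (h j)" for j
  proof (rule decay_prod_list_quotient'[OF I(1), where
      as = "map (\<lambda>i e. real i - real n) [0..<n] @ map (\<lambda>i e. real i - real j) [0..<n]" and
      bs = "map (\<lambda>i e. real i) [0..<n+1] @ map (\<lambda>i e. e - real n + real i) [0..<n+1]"])
    fix b and e assume "b \<in> set (map (\<lambda>i e. real i) [0..<n+1] @ map (\<lambda>i e. e - real n + real i) [0..<n+1])" "e \<in> I"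
    then show "b e \<ge> 0" using I(2)[of e] by (auto simp del: upt_Suc)
  next
    fix e t :: real
    show "h j e t = (\<Prod>a\<leftarrow>map (\<lambda>i e. real i - real n) [0..<n] @ map (\<lambda>i e. real i - real j) [0..<n]. t + a e)
       / (\<Prod>b\<leftarrow>map (\<lambda>i e. real i) [0..<n+1] @ map (\<lambda>i e. e - real n + real i) [0..<n+1]. t + b e)"
      unfolding h_def pochhammer_prod map_append prod_list.append map_map o_def prod_list_map_upt
      by (intro arg_cong2[where f = divide] arg_cong2[where f = times] prod.cong refl) auto
  next
    have c: "continuous_on I (\<lambda>e. real i)" "continuous_on I (\<lambda>e. real i - real l)" "continuous_on I (\<lambda>e. e - real n + real i)" for i l
      by (intro continuous_intros)+
    show "continuous_on I a" if "a \<in> set (map (\<lambda>i e. real i - real n) [0..<n] @ map (\<lambda>i e. real i - real j) [0..<n])" for a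
      using that c by auto
    show "continuous_on I b" if "b \<in> set (map (\<lambda>i e. real i) [0..<n+1] @ map (\<lambda>i e. e - real n + real i) [0..<n+1])" for b
      using that c unfolding set_append set_map by blast
  qed simp
  define p where "p j e = real (n choose j) ^ 2 * (pochhammer (e + (real j + 1 - real n)) n / fact n)" for j e
  have p: "continuous_on I (p j)" for j
    unfolding p_def by (intro continuous_on_mult continuous_on_divide continuous_on_const continuous_on_pochhammer) auto
  have "decay I 2 (\<lambda>e t. p j e * h j e t)" for j
    using decay_mult[OF decay_coeff[OF I(1) p] h, of j j] unfolding add_0 .
  then have "decay I 2 (\<lambda>e t. \<Sum>j\<le>n. p j e * h j e t)" by (intro decay_sum I)
  then show ?thesis
  proof (rule decay_cong)
    fix e t :: real
    have e: "e + (real j + 1 - real n) = e + real j + 1 - real n" for j by simp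
    show "(\<Sum>j\<le>n. p j e * h j e t) = Rt_param n e t"
      unfolding Rt_param_def sum_distrib_left p_def h_def
      by (intro sum.cong refl) (simp only: e times_divide_eq_left times_divide_eq_right divide_divide_eq_left mult_ac)
  qed
qed

context separated_nodes
begin

lemma bilin_eq_Rt_param:
  assumes "t > 0"
  shows "bilin t = (-1) ^ n * Rt_param n \<eta> t"
proof -
  have "pochhammer (t + \<eta> - real n) (n + 1) = pochhammer (t + \<eta> - real n) n * (t + \<eta>)"
    by (simp add: pochhammer_Suc)
  then show ?thesis
    unfolding bilin_def sum_A_v[OF assms] sum_A_v_inverse[OF assms] P_def Rt_param_def
    by (simp only: times_divide_eq_left times_divide_eq_right divide_divide_eq_left mult_ac)
qed

text \<open>One derivative comes from \<open>bilin_deriv\<close>, another from summing the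
  derivatives of the telescoping identity. Hence a second derivative of \<open>Rt_param\<close> is
  matched with a first derivative of \<open>quot_square\<close>.\<close>

lemma Rt_param_quot_square_sum:
  "(\<Sum>k. (deriv ^^ 2) (Rt_param n \<eta>) (1 + real k)) + 2 * (-1) ^ n * (\<Sum>k. deriv (quot_square n \<eta>) (1 + real k)) = 0"
proof -
  have Rt_param: "decay {\<eta>} 2 (Rt_param n)" by (rule decay_Rt_param) (use eta in auto)
  have sq: "decay {\<eta>} 1 (\<lambda>_. quot_square n \<eta>)" by (rule decay_quot_square_single[OF eta])
  define F where "F t = (-1) ^ n * deriv (Rt_param n \<eta>) t + 2 * quot_square n \<eta> t" for t
  have F: "F t = anti (t + 1) - anti t" if "t > 1/2" for t
  proof -
    have 1: "((\<lambda>t. (-1) ^ n * Rt_param n \<eta> t) has_real_derivative anti (t + 1) - anti t - 2 * quot_square n \<eta> t) (at t)"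
      by (rule has_field_derivative_transform_within_open[OF bilin_deriv, where S = "{0<..}"])
         (use that bilin_eq_Rt_param in auto)
    have 2: "((\<lambda>t. (-1) ^ n * Rt_param n \<eta> t) has_real_derivative (-1) ^ n * deriv (Rt_param n \<eta>) t) (at t)"
      by (intro DERIV_cmult decay_has_deriv[OF Rt_param]) (use that in auto)
    show ?thesis unfolding F_def using DERIV_unique[OF 1 2] by simp
  qed
  obtain f' f'' where D: "decay_data {\<eta>} 2 (Rt_param n) f' f''"
    and D1: "\<And>e t. e \<in> {\<eta>} \<Longrightarrow> t > 1/2 \<Longrightarrow> deriv (Rt_param n e) t = f' e t"
    and D2: "\<And>e t. e \<in> {\<eta>} \<Longrightarrow> t > 1/2 \<Longrightarrow> (deriv ^^ 2) (Rt_param n e) t = f'' e t"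
    by (rule decay_imp_deriv[OF Rt_param]) (rule that)
  define X Y where "X k = (deriv ^^ 2) (Rt_param n \<eta>) (1 + real k)" and "Y k = deriv (quot_square n \<eta>) (1 + real k)" for k
  have dF: "deriv F (1 + real k) = (-1) ^ n * X k + 2 * Y k" for k
  proof (rule DERIV_imp_deriv)
    have "(f' \<eta> has_real_derivative f'' \<eta> (1 + real k)) (at (1 + real k))"
      by (rule decay_dataD(2)[OF D]) auto
    moreover have "X k = f'' \<eta> (1 + real k)" unfolding X_def by (rule D2) auto
    ultimately have "(f' \<eta> has_real_derivative X k) (at (1 + real k))" by (simp only:)
    then have "(deriv (Rt_param n \<eta>) has_real_derivative X k) (at (1 + real k))"
      by (rule has_field_derivative_transform_within_open[where S = "{1/2<..}"]) (use D1 in auto)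
    then show "(F has_real_derivative (-1) ^ n * X k + 2 * Y k) (at (1 + real k))"
      unfolding F_def[abs_def] Y_def by (intro DERIV_add DERIV_cmult decay_has_deriv[OF sq]) auto
  qed
  have "(\<lambda>k. deriv F (1 + real k)) sums (- deriv anti 1)"
    by (rule decay_telescope_sums[OF decay_anti F, where a = "1/2"]) auto
  then have "(\<lambda>k. (-1) ^ n * X k + 2 * Y k) sums 0"
    using DERIV_imp_deriv[OF DERIV_anti[of 1]] anti'_1 by (simp add: dF)
  moreover have "summable X" unfolding X_def by (rule suminf_deriv_continuous(4)[OF Rt_param]) auto
  moreover have "summable Y" unfolding Y_def by (rule suminf_deriv_continuous(2)[OF sq]) auto
  then have "(\<lambda>k. (-1) ^ n * X k + 2 * Y k) sums ((-1) ^ n * suminf X + 2 * suminf Y)"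
    using \<open>summable X\<close> by (intro sums_add sums_mult summable_sums)
  ultimately have z: "(-1) ^ n * suminf X + 2 * suminf Y = 0" by (intro sums_unique2)
  have collect: "X + 2 * a * Y = a * (a * X + 2 * Y)" if "a * a = 1" for a X Y :: real
    using that by (simp add: distrib_left flip: mult.assoc)
  have sq1: "((-1::real) ^ n) * (-1) ^ n = 1" by (simp flip: power_mult_distrib)
  show ?thesis unfolding X_def[symmetric] Y_def[symmetric] by (subst collect[OF sq1]) (simp only: z mult_zero_right)
qed

end

text \<open>No integer lies strictly between \<open>N\<close> and \<open>N + 1\<close>, so all nodes
  are separated there. Approaching \<open>N\<close> from the right preserves
  \<open>\<eta> \<ge> n\<close> even when \<open>N = n\<close>.\<close>

lemma Rt_param_quot_square_sum_nat:
  assumes "n \<le> N"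
  shows "(\<Sum>k. (deriv ^^ 2) (Rt_param n (real N)) (1 + real k)) + 2 * (-1) ^ n * (\<Sum>k. deriv (quot_square n (real N)) (1 + real k)) = 0"
proof -
  define f where "f e = (\<Sum>k. (deriv ^^ 2) (Rt_param n e) (1 + real k)) + 2 * (-1) ^ n * (\<Sum>k. deriv (quot_square n e) (1 + real k))" for e
  have cl: "closure {real N<..<real N + 1} = {real N..real N + 1}" by (rule closure_greaterThanLessThan) simp
  have I: "compact {real N..real N + 1}" "\<And>e. e \<in> {real N..real N + 1} \<Longrightarrow> e \<ge> real n" using assms by auto
  have "continuous_on {real N..real N + 1} (\<lambda>e. \<Sum>k. (deriv ^^ 2) (Rt_param n e) (1 + real k))"
    by (rule suminf_deriv_continuous(3)[OF decay_Rt_param[OF I]]) auto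
  moreover have "continuous_on {real N..real N + 1} (\<lambda>e. \<Sum>k. deriv (quot_square n e) (1 + real k))"
    by (rule suminf_deriv_continuous(1)[OF decay_quot_square[OF I]]) auto
  ultimately have "continuous_on {real N..real N + 1} f"
    unfolding f_def[abs_def] by (intro continuous_on_add continuous_on_mult continuous_on_const)
  then have c: "continuous_on (closure {real N<..<real N + 1}) f" by (simp only: cl)
  have "f e = 0" if "e \<in> {real N<..<real N + 1}" for e
  proof -
    have "real k + real l \<noteq> e" for k l
    proof
      assume "real k + real l = e"
      then have "e = real (k + l)" by simp
      then have "real N < real (k + l)" "real (k + l) < real (N + 1)" using that by (simp_all only: greaterThanLessThan_iff of_nat_add of_nat_1)
      then have "N < k + l" "k + l < N + 1" by (simp_all only: of_nat_less_iff)
      then show False by simp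
    qed
    then interpret separated_nodes n e using assms that by unfold_locales simp_all
    show ?thesis unfolding f_def by (rule Rt_param_quot_square_sum)
  qed
  moreover have "real N \<in> closure {real N<..<real N + 1}" by (simp add: cl)
  ultimately have "f (real N) = 0" by (rule continuous_constant_on_closure[OF c])
  then show ?thesis unfolding f_def .
qed

subsection \<open>The theorem\<close>

text \<open>The common factor \<open>pochhammer t (N - n)\<close> of numerator and denominator
  cancels.\<close>

lemma Rt_eq_Rt_param:
  assumes "m \<le> n" "t > 0"
  shows "Rt n m t = Rt_param n (real (2 * n - m)) t"
proof -
  define N where "N = 2 * n - m"
  have N: "n \<le> N" using assms by (simp add: N_def)
  have e1: "pochhammer (t - real n) N = pochhammer (t - real n) n * pochhammer t (N - n)"
    using pochhammer_product[OF N, of "t - real n"] by simp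
  have e2: "pochhammer t (N + 1) = pochhammer t (N - n) * pochhammer (t + real N - real n) (n + 1)"
    using pochhammer_product[of "N - n" "N + 1" t] N by (simp add: algebra_simps Suc_diff_le)
  have e3: "real ((N + j) choose n) = pochhammer (real N + real j + 1 - real n) n / fact n" for j
    using N by (simp add: binomial_gbinomial gbinomial_pochhammer' algebra_simps)
  have e4: "(\<Sum>j\<le>n. x j * y j * (pochhammer (t - real j) n / fact n)) = (\<Sum>j\<le>n. x j * y j * pochhammer (t - real j) n) / fact n" for x y
    by (simp add: sum_divide_distrib)
  have collect: "f * (a * b) / (c * (b * d)) * (x / f) = a / (c * d) * x" if "b > 0" "f > 0" for a b c d f x :: real
    using that by simp
  show ?thesis
    unfolding Rt_def Rt_param_def N_def[symmetric] atMost_atLeast0[symmetric] e1 e2 e3 e4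
    by (rule collect) (use assms in \<open>auto intro!: pochhammer_pos\<close>)
qed

lemma pochhammer_eq_prod: "pochhammer (t + 1) k = (\<Prod>l=1..k. t + real l)" for t :: real
  by (induction k) (simp_all add: pochhammer_Suc algebra_simps)

lemma pochhammer_minus_eq_prod: "pochhammer (t - real k) k = (\<Prod>l=1..k. t - real l)" for t :: real
proof -
  have "pochhammer (t - real k) k = (\<Prod>i\<in>{0..<k}. t - real k + real i)" by (simp add: pochhammer_prod)
  also have "\<dots> = (\<Prod>l=1..k. t - real l)"
    by (rule prod.reindex_bij_witness[of _ "\<lambda>l. k - l" "\<lambda>i. k - i"]) (auto simp: of_nat_diff)
  finally show ?thesis .
qed

text \<open>The factors \<open>t + n + l\<close> with \<open>l \<le> N - n\<close>, collected in
  \<open>Q\<close>, occur both in \<open>pochhammer (t + n + 1) n\<close> and in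
  \<open>pochhammer t (N + 1)\<close>. Their cancellation shortens the second product to
  \<open>l > N - n\<close> and leaves the fourth power of \<open>pochhammer t (n + 1)\<close>
  below.\<close>

lemma R_eq_well_poised:
  assumes "m \<le> n" "t > 0"
  shows "R n m t = (-1) ^ m * (fact n)\<^sup>2 / (fact m * fact (2 * n - m)) * well_poised n (2 * n - m) t"
proof -
  define N where "N = 2 * n - m"
  have N: "n \<le> N" "N - n \<le> n" "m = n - (N - n)" using assms by (auto simp: N_def)
  have "2 * n = N + m" using assms by (simp add: N_def)
  then have "2 * real n = real N + real m" by linarith
  then have a1: "t - 2 * real n + real m = t - real N" by simp
  have s: "(\<Prod>l=1..n. g l) = (\<Prod>l=1..N-n. g l) * (\<Prod>l\<in>{N-n<..n}. g l)" for g :: "nat \<Rightarrow> real"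
  proof -
    have "{1..n} = {1..N-n} \<union> {N-n<..n}" using N by auto
    then show ?thesis by (simp only:) (rule prod.union_disjoint, auto)
  qed
  define Q where "Q = (\<Prod>l=1..N-n. t + real n + real l)"
  have Q: "Q > 0" unfolding Q_def using assms by (intro prod_pos) auto
  have pm: "pochhammer (t - real n) m = (\<Prod>l\<in>{N-n<..n}. t - real l)"
  proof -
    have "pochhammer (t - real n) m = (\<Prod>i\<in>{0..<m}. t - real n + real i)" by (simp add: pochhammer_prod)
    also have "\<dots> = (\<Prod>l\<in>{N-n<..n}. t - real l)"
      by (rule prod.reindex_bij_witness[of _ "\<lambda>l. n - l" "\<lambda>i. n - i"]) (use N in \<open>auto simp: of_nat_diff\<close>)
    finally show ?thesis .
  qed
  have pn: "pochhammer (t + real n + 1) n = Q * (\<Prod>l\<in>{N-n<..n}. t + real n + real l)"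
    unfolding pochhammer_eq_prod s Q_def ..
  have pN: "pochhammer t (N + 1) = pochhammer t (n + 1) * Q"
  proof -
    have "pochhammer t (N + 1) = pochhammer t (n + 1) * pochhammer (t + real n + 1) (N - n)"
      using pochhammer_product[of "n + 1" "N + 1" t] N by (simp add: algebra_simps)
    then show ?thesis unfolding pochhammer_eq_prod Q_def .
  qed
  have D: "(\<Prod>k=0..n. t + real k) = pochhammer t (n + 1)"
    by (simp add: pochhammer_prod atLeastLessThanSuc_atLeastAtMost)
  have "pochhammer t (n + 1) > 0" using assms by (intro pochhammer_pos)
  then show ?thesis
    unfolding R_def well_poised_def N_def[symmetric] a1 pm pn pN D pochhammer_minus_eq_prod prod.distrib
      pochhammer_eq_prod[of "t + real n" N] using Q
    by (simp add: power2_eq_square power4_eq_xxxx mult_ac)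
qed

theorem theorem1:
  fixes n m :: nat
  assumes "m \<le> n"
  shows "\<exists>S. (\<lambda>k. - (1/3) * deriv (R n m) (real (n - m + 1 + k))) sums S
            \<and> (\<lambda>k. (1/6) * (deriv ^^ 2) (Rt n m) (real (1 + k))) sums S"
proof -
  define N where "N = 2 * n - m"
  have N: "n \<le> N" "N \<le> 2 * n" "N - n = n - m" "2 * n - N = m" using assms by (auto simp: N_def)
  define C where "C = (-1) ^ m * (fact n)\<^sup>2 / (fact m * fact N :: real)"
  have R: "deriv (R n m) t = C * deriv (well_poised n N) t" if "t > 1/2" for t
  proof -
    have "((\<lambda>t. C * well_poised n N t) has_real_derivative C * deriv (well_poised n N) t) (at t)"
      using decay_has_deriv[OF decay_well_poised[OF N(1,2)]] that by (intro DERIV_cmult) auto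
    then have "(R n m has_real_derivative C * deriv (well_poised n N) t) (at t)"
      by (rule has_field_derivative_transform_within_open[where S = "{0<..}"])
         (use that R_eq_well_poised[OF assms] in \<open>auto simp: C_def N_def\<close>)
    then show ?thesis by (rule DERIV_imp_deriv)
  qed
  have Rt: "(deriv ^^ 2) (Rt n m) t = (deriv ^^ 2) (Rt_param n (real N)) t" if "t > 0" for t
  proof -
    have "eventually (\<lambda>s. s \<in> {0<..}) (nhds t)" using that by (intro eventually_nhds_in_open) auto
    then have "eventually (\<lambda>s. Rt n m s = Rt_param n (real N) s) (nhds t)"
      by eventually_elim (use Rt_eq_Rt_param[OF assms] in \<open>simp add: N_def\<close>)
    then show ?thesis by (rule higher_deriv_cong_ev) simp
  qed
  \<comment> \<open>Used with \<open>a = n - m\<close> for the series of \<open>R\<close> and with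
    \<open>a = 0\<close> for \<open>quot_square\<close>: the terms before \<open>n + 1\<close>
    vanish, so series with different starting points can be compared.\<close>
  have zero_sums: "(\<lambda>k. f (real (a + 1 + k))) sums (\<Sum>k. f (real n + 1 + real k))"
    if "\<And>i. a < i \<Longrightarrow> i \<le> n \<Longrightarrow> f (real i) = 0" "a \<le> n" "summable (\<lambda>k. f (real n + 1 + real k))" for a and f :: "real \<Rightarrow> real"
  proof -
    have "(\<lambda>k. f (real (a + 1 + (k + (n - a))))) sums (\<Sum>k. f (real n + 1 + real k))"
      using summable_sums[OF that(3)] \<open>a \<le> n\<close> by (simp add: of_nat_diff algebra_simps)
    moreover have "(\<Sum>k<n-a. f (real (a + 1 + k))) = 0" by (intro sum.neutral ballI that(1)) (use that(2) in auto)
    ultimately show ?thesis by (subst (asm) sums_iff_shift) simp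
  qed
  have well_poised: "decay {0} 1 (\<lambda>_. well_poised n N)" by (rule decay_well_poised_single[OF N(1,2)])
  have sq: "decay {real N} 1 (\<lambda>_. quot_square n (real N))" by (rule decay_quot_square_single) (use N in simp)
  have "(\<lambda>k. deriv (well_poised n N) (real (n - m + 1 + k))) sums well_poised_sum n N"
    unfolding well_poised_sum_def
    by (rule zero_sums) (use deriv_well_poised_zero[of N n] suminf_deriv_continuous(2)[OF well_poised] N in auto)
  from sums_mult[OF this, of "- (1/3) * C"]
  have 1: "(\<lambda>k. - (1/3) * deriv (R n m) (real (n - m + 1 + k))) sums (- (1/3) * C * well_poised_sum n N)"
    by (simp add: R)
  have "(\<lambda>k. deriv (quot_square n (real N)) (real (0 + 1 + k))) sums quot_square_sum n (real N)"
    unfolding quot_square_sum_def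
    by (rule zero_sums) (use deriv_quot_square_zero suminf_deriv_continuous(2)[OF sq] N in auto)
  then have "(\<Sum>k. deriv (quot_square n (real N)) (1 + real k)) = quot_square_sum n (real N)" by (simp add: sums_iff)
  \<comment> \<open>The factor \<open>- 2\<close>, multiplied by the prefactor \<open>1/6\<close>,
    yields the \<open>- 1/3\<close> of the other side.\<close>
  then have "(\<Sum>k. (deriv ^^ 2) (Rt_param n (real N)) (1 + real k)) = - 2 * ((-1) ^ n * well_poised_coeff n N) * well_poised_sum n N"
    using Rt_param_quot_square_sum_nat[OF N(1)] quot_square_sum_eq_well_poised_sum[OF N(1,2)] by simp
  moreover have "(-1) ^ n * well_poised_coeff n N = C"
  proof -
    \<comment> \<open>From \<open>2 * n = N + m\<close>; only the parity of the exponent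
      matters.\<close>
    have "n + (n + N) = m + 2 * N" using N by simp
    then have "(-1::real) ^ n * (-1) ^ (n + N) = (-1) ^ m"
      by (metis power_add power_mult power_minus1_even mult.right_neutral)
    then show ?thesis by (simp add: well_poised_coeff_def C_def N mult.assoc[symmetric])
  qed
  moreover have "summable (\<lambda>k. (deriv ^^ 2) (Rt_param n (real N)) (1 + real k))"
    by (rule suminf_deriv_continuous(4)[OF decay_Rt_param[of "{real N}"]]) (use N in auto)
  ultimately have "(\<lambda>k. (deriv ^^ 2) (Rt_param n (real N)) (1 + real k)) sums (- 2 * C * well_poised_sum n N)"
    by (simp add: sums_iff)
  from sums_mult[OF this, of "1/6"]
  have "(\<lambda>k. (1/6) * (deriv ^^ 2) (Rt n m) (real (1 + k))) sums (- (1/3) * C * well_poised_sum n N)"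
    by (simp add: Rt)
  with 1 show ?thesis by blast
qed

end
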